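(* Let $N>p\ge1$, let $\mathbf X$ be a fixed real $N\times p$ matrix of full column rank, $\mathbf Y\in\mathbb R^N$, $a>1$, $b>0$. Let $\Pi$ be the posterior distribution of $(\sigma^{-2},\beta)\in(0,\infty)\times\mathbb R^p$ given $\mathbf Y$ in the Bayesian hierarchical model described in the context, and let $P_2=G_1H_2$ be the Metropolis-within-Gibbs sampler that first draws $\sigma^{-2}$ exactly from its full conditional and then updates $\beta$ by one step of Random-Walk Metropolis with step size $\sigma_0>0$ targeting its full conditional. When $\sigma_0$ is fixed, the following convergence bound holds for $P_2$: for any $f\in L^2_0(\Pi)$ such that $\|f\|_{\mathrm{osc}}^2<\infty$ and any integer $n\ge2$, $$\|P_2^nf\|_\Pi^2\le\tilde C\cdot\|f\|_{\mathrm{osc}}^2\cdot(n-1)^{-\min\{a',\,b'/C_2\}},$$ where $a'=a+\frac N2-\frac p2$, $b'=b+\frac{\mathbf Y^\top\mathbf Y-u^\top(\mathbf X^\top\mathbf X)u}{2}$, $u=(\mathbf X^\top\mathbf X)^{-1}\mathbf X^\top\mathbf Y$, $C_2=2\cdot\lambda_{\max}(\mathbf X^\top\mathbf X)\cdot p\cdot\sigma_0^2$, $\lambda_{\max}(\mathbf X^\top\mathbf X)$ is the maximum eigenvalue of $\mathbf X^\top\mathbf X$, and $\tilde C$ is a universal constant.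
   Context: Model: $\mathbf Y\mid\sigma,\beta\sim\mathcal N(\mathbf X\beta,\sigma^2I)$ with priors $\sigma^{-2}\sim\Gamma(a,b)$ (shape $a$, rate $b$) and flat (improper) prior $\beta\propto1$; the hyperparameters $a,b$ are known. Full conditionals: $\sigma^{-2}\mid\beta,\mathbf Y\sim\Gamma\big(a+\frac N2,\ b+\frac12(\mathbf Y-\mathbf X\beta)^\top(\mathbf Y-\mathbf X\beta)\big)$ and $\beta\mid\sigma^{-2},\mathbf Y\sim\mathcal N\big((\mathbf X^\top\mathbf X)^{-1}\mathbf X^\top\mathbf Y,\ \sigma^{2}(\mathbf X^\top\mathbf X)^{-1}\big)$. $G_1$ is the operator on $L^2(\Pi)$ that refreshes $\sigma^{-2}$ from its full conditional keeping $\beta$ fixed. $H_2$ keeps $\sigma^{-2}$ fixed and moves $\beta$ by the Random-Walk Metropolis kernel $H_{2|\sigma^{-2}}$: propose $\beta'=\beta+\sigma_0Z$, $Z\sim\mathcal N(0,I_p)$, accept with probability $\min\{1,\pi(\beta'|\sigma^{-2},\mathbf Y)/\pi(\beta|\sigma^{-2},\mathbf Y)\}$, otherwise stay. Operators act on functions, $P_2f=G_1(H_2f)$. $L^2_0(\Pi)$: mean-zero functions in $L^2(\Pi)$; $\|f\|_\Pi^2=\int f^2\,d\Pi$; $\|f\|_{\mathrm{osc}}=\operatorname{ess\,sup}_\Pi f-\operatorname{ess\,inf}_\Pi f$.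
   Formalization: The constant C̃ is independent of f and n but may depend on the fixed data N, p, X, Y, a, b, σ₀; a truly universal C̃ is impossible (σ₀=1, N=2, p=1, X=(1,0)ᵀ, Y=0, b=a'→∞, f=sign β, n=3). *)

theory Defs
  imports "HOL-Probability.Probability"
begin

section \<open>Densities\<close>

text \<open>Gamma distribution with shape \<open>a\<close> and rate \<open>b\<close>.\<close>

definition gamma_density :: "real \<Rightarrow> real \<Rightarrow> real \<Rightarrow> real" where
  "gamma_density a b t =
     (if 0 < t then b powr a / Gamma a * t powr (a - 1) * exp (- b * t) else 0)"

definition gamma_measure :: "real \<Rightarrow> real \<Rightarrow> real measure" where
  "gamma_measure a b = density lborel (\<lambda>t. ennreal (gamma_density a b t))"

text \<open>Multivariate normal distribution with mean \<open>m\<close> and covariance matrix \<open>S\<close>.\<close>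

definition mvn_density :: "real^'d \<Rightarrow> real^'d^'d \<Rightarrow> real^'d \<Rightarrow> real" where
  "mvn_density m S x =
     exp (- ((x - m) \<bullet> (matrix_inv S *v (x - m))) / 2) / sqrt ((2 * pi) ^ CARD('d) * det S)"

definition mvn_measure :: "real^'d \<Rightarrow> real^'d^'d \<Rightarrow> (real^'d) measure" where
  "mvn_measure m S = density lborel (\<lambda>x. ennreal (mvn_density m S x))"


section \<open>The hierarchical model and its posterior\<close>

text \<open>
  A state is a pair \<open>(t, \<beta>)\<close>, where \<open>t\<close> is the precision \<open>\<sigma>\<^sup>-\<^sup>2\<close>, so that \<open>\<sigma> = 1 / sqrt t\<close>.
  The design matrix \<open>X\<close> has its rows indexed by \<open>'n\<close> and its columns by \<open>'p\<close>.
  The state space is all of \<open>\<real> \<times> \<real>\<^sup>p\<close>; the Gamma prior density vanishes for \<open>t \<le> 0\<close>, so the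
  posterior is carried by \<open>(0, \<infinity>) \<times> \<real>\<^sup>p\<close>.
\<close>

definition likelihood :: "real^'p^'n \<Rightarrow> real^'n \<Rightarrow> real \<times> (real^'p) \<Rightarrow> real" where
  "likelihood X Y = (\<lambda>(t, \<beta>). mvn_density (X *v \<beta>) ((1 / t) *\<^sub>R mat 1) Y)"

text \<open>Prior times likelihood; the flat prior on \<open>\<beta>\<close> contributes the factor 1.\<close>

definition joint_density ::
  "real^'p^'n \<Rightarrow> real^'n \<Rightarrow> real \<Rightarrow> real \<Rightarrow> real \<times> (real^'p) \<Rightarrow> real" where
  "joint_density X Y a b = (\<lambda>(t, \<beta>). gamma_density a b t * likelihood X Y (t, \<beta>))"

definition posterior ::
  "real^'p^'n \<Rightarrow> real^'n \<Rightarrow> real \<Rightarrow> real \<Rightarrow> (real \<times> (real^'p)) measure" where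
  "posterior X Y a b = density lborel
     (\<lambda>x. ennreal (joint_density X Y a b x / (LINT z|lborel. joint_density X Y a b z)))"

definition ols :: "real^'p^'n \<Rightarrow> real^'n \<Rightarrow> real^'p" where
  "ols X Y = matrix_inv (transpose X ** X) *v (transpose X *v Y)"

text \<open>Full conditional of \<open>t\<close> given \<open>\<beta>\<close>, and density of the full conditional of \<open>\<beta>\<close> given \<open>t\<close>.\<close>

definition precision_conditional ::
  "real^'p^'n \<Rightarrow> real^'n \<Rightarrow> real \<Rightarrow> real \<Rightarrow> real^'p \<Rightarrow> real measure" where
  "precision_conditional X Y a b \<beta> =
     gamma_measure (a + real CARD('n) / 2) (b + ((Y - X *v \<beta>) \<bullet> (Y - X *v \<beta>)) / 2)"

definition beta_conditional_density ::
  "real^'p^'n \<Rightarrow> real^'n \<Rightarrow> real \<Rightarrow> real^'p \<Rightarrow> real" where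
  "beta_conditional_density X Y t =
     mvn_density (ols X Y) ((1 / t) *\<^sub>R matrix_inv (transpose X ** X))"


section \<open>The Metropolis-within-Gibbs sampler\<close>

text \<open>
  Action on functions of the Random-Walk Metropolis kernel with step size \<open>s\<close> and target
  density \<open>d\<close>: the first term of the integrand is acceptance, the second is rejection.
\<close>

definition rwm :: "real \<Rightarrow> (real^'p \<Rightarrow> real) \<Rightarrow> (real^'p \<Rightarrow> real) \<Rightarrow> real^'p \<Rightarrow> real" where
  "rwm s d g \<beta> =
     (LINT z|mvn_measure 0 (mat 1).
        (let \<beta>' = \<beta> + s *\<^sub>R z; \<alpha> = min 1 (d \<beta>' / d \<beta>)
         in \<alpha> * g \<beta>' + (1 - \<alpha>) * g \<beta>))"

definition G1 :: "real^'p^'n \<Rightarrow> real^'n \<Rightarrow> real \<Rightarrow> real \<Rightarrow>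
    (real \<times> (real^'p) \<Rightarrow> real) \<Rightarrow> (real \<times> (real^'p) \<Rightarrow> real)" where
  "G1 X Y a b f = (\<lambda>(t, \<beta>). LINT t'|precision_conditional X Y a b \<beta>. f (t', \<beta>))"

definition H2 :: "real^'p^'n \<Rightarrow> real^'n \<Rightarrow> real \<Rightarrow>
    (real \<times> (real^'p) \<Rightarrow> real) \<Rightarrow> (real \<times> (real^'p) \<Rightarrow> real)" where
  "H2 X Y s f = (\<lambda>(t, \<beta>). rwm s (beta_conditional_density X Y t) (\<lambda>\<beta>'. f (t, \<beta>')) \<beta>)"

definition P2 :: "real^'p^'n \<Rightarrow> real^'n \<Rightarrow> real \<Rightarrow> real \<Rightarrow> real \<Rightarrow>
    (real \<times> (real^'p) \<Rightarrow> real) \<Rightarrow> (real \<times> (real^'p) \<Rightarrow> real)" where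
  "P2 X Y a b s f = G1 X Y a b (H2 X Y s f)"


section \<open>Function spaces, norms and the largest eigenvalue\<close>

text \<open>Elements of \<open>L\<^sup>2\<close> are represented by functions rather than by classes modulo null sets.\<close>

definition L2_0 :: "'s measure \<Rightarrow> ('s \<Rightarrow> real) set" where
  "L2_0 M = {f \<in> borel_measurable M. integrable M (\<lambda>x. (f x)\<^sup>2) \<and> (LINT x|M. f x) = 0}"

definition L2_norm :: "'s measure \<Rightarrow> ('s \<Rightarrow> real) \<Rightarrow> real" where
  "L2_norm M f = sqrt (LINT x|M. (f x)\<^sup>2)"

text \<open>The essential infimum of \<open>f\<close> is minus the essential supremum of \<open>- f\<close>.\<close>

definition osc_norm :: "'s measure \<Rightarrow> ('s \<Rightarrow> real) \<Rightarrow> ereal" where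
  "osc_norm M f = esssup M (\<lambda>x. ereal (f x)) - (- esssup M (\<lambda>x. - ereal (f x)))"

definition max_eigenvalue :: "real^'d^'d \<Rightarrow> real" where
  "max_eigenvalue A = Max {l. \<exists>v. v \<noteq> 0 \<and> A *v v = l *\<^sub>R v}"

end

theory Submission
  imports Defs
begin

text \<open>
  It suffices to obtain the rate \<open>n\<^sup>-\<^sup>a\<^sup>'\<close>, as \<open>min a' (b' / C\<^sub>2) \<le> a'\<close>. After one step
  the iterates depend on \<open>\<beta>\<close> only, whose marginal density is proportional to \<open>E(\<beta>)\<^sup>-\<^sup>\<alpha>\<close> with
  \<open>E(\<beta>) = b + |Y - X\<beta>|\<^sup>2 / 2\<close> and \<open>\<alpha> = a + N / 2\<close>, a polynomial tail since \<open>E(\<beta>)\<close> is comparable to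
  \<open>1 + |\<beta>|\<^sup>2\<close>. One step loses in squared norm at least the mean variance of \<open>g\<close> under the kernel
  \<open>H\<^sub>2\<close>; as \<open>t\<close> is typically of order \<open>1 / E(\<beta>)\<close>, moves of size \<open>\<sigma>\<^sub>0\<close> are accepted with probability
  bounded below, so the loss dominates the Dirichlet form of a local random walk with reversible
  density \<open>E\<^sup>-\<^sup>\<alpha>\<close>. Straight-line paths give a Poincare inequality with constant \<open>R\<^sup>2\<close> on balls of
  radius \<open>R\<close>; chaining dyadic balls up to radius \<open>2\<^sup>J\<close> and bounding the rest by the oscillation yields
  \<open>Var g \<le> C (4\<^sup>J D(g) + 4\<^sup>-\<^sup>a\<^sup>'\<^sup>J osc(g)\<^sup>2)\<close> for all \<open>J\<close>. Optimizing over \<open>J\<close> gives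
  \<open>v\<^sub>n\<^sub>+\<^sub>1 \<le> v\<^sub>n - c v\<^sub>n powr (1 + 1 / a')\<close> for the normalized squared norms, hence the decay \<open>n\<^sup>-\<^sup>a\<^sup>'\<close>.
\<close>

section \<open>A weak Poincare inequality for densities with polynomial tails\<close>

text \<open>Given \<open>t\<close>, a short move is accepted with probability at least
  \<open>exp (- t * (\<kappa> * E x))\<close>, which has no positive lower bound as \<open>t\<close>
  grows. But \<open>t\<close> given \<open>x\<close> is Gamma distributed with rate
  \<open>E x\<close>, so the Gamma average of this bound is
  \<open>(1 + \<kappa>) powr (- \<alpha>)\<close>, the same for every \<open>x\<close>. The loss of
  squared norm is the energy of the adjoint of \<open>R\<close> composed with \<open>R\<close>, not
  that of \<open>R\<close>, so an energy built from single moves would not control it directly.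
  Pairs of proposals from a common point are compared instead; their difference is again a short
  increment, and no positivity of the spectrum is called for. Passing from one dyadic ball to the
  next multiplies the inherited error by a fixed factor, yet the errors do not compound: that factor
  is at most 3/2 times the volume ratio \<open>2 ^ DIM('a)\<close>, while the new error grows like
  \<open>(4 * \<theta>) ^ j\<close> with \<open>\<theta> = 4 powr \<alpha> > 2 ^ DIM('a)\<close>.
  The weight, of order \<open>1 / \<theta> ^ j\<close> on the shell, then leaves
  \<open>4 ^ j\<close>. The same inequality for \<theta> makes the masses of the shells
  summable.\<close>

lemma nn_integral_lborel_translate:
  fixes f :: "'a::euclidean_space \<Rightarrow> ennreal"
  assumes [measurable]: "f \<in> borel_measurable borel"
  shows "(\<integral>\<^sup>+x. f (x + c) \<partial>lborel) = (\<integral>\<^sup>+x. f x \<partial>lborel)"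
proof -
  have "(\<integral>\<^sup>+x. f x \<partial>lborel) = (\<integral>\<^sup>+x. f x \<partial>(distr lborel borel ((+) c)))"
    by (simp add: lborel_distr_plus)
  also have "\<dots> = (\<integral>\<^sup>+x. f (x + c) \<partial>lborel)"
    by (subst nn_integral_distr) (auto simp: add.commute)
  finally show ?thesis by simp
qed

lemma nn_integral_lborel_affine:
  fixes f :: "'a::euclidean_space \<Rightarrow> ennreal"
  assumes [measurable]: "f \<in> borel_measurable borel" and c: "c \<noteq> 0"
  shows "(\<integral>\<^sup>+x. f x \<partial>lborel) = ennreal (\<bar>c\<bar> ^ DIM('a)) * (\<integral>\<^sup>+x. f (v + c *\<^sub>R x) \<partial>lborel)"
  by (subst lborel_affine[OF c, of v])
    (simp add: nn_integral_density nn_integral_distr nn_integral_cmult)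

lemma nn_integral_lborel_uminus:
  fixes f :: "'a::euclidean_space \<Rightarrow> ennreal"
  assumes [measurable]: "f \<in> borel_measurable borel"
  shows "(\<integral>\<^sup>+x. f (- x) \<partial>lborel) = (\<integral>\<^sup>+x. f x \<partial>lborel)"
  using nn_integral_lborel_affine[of f "-1" 0] by simp

section \<open>Straight-line paths in a ball\<close>

lemma increment_squared_le_sum_steps:
  fixes g :: "'a::real_vector \<Rightarrow> real"
  shows "(g y - g (y + real n *\<^sub>R d))\<^sup>2
    \<le> real n * (\<Sum>k<n. (g (y + real k *\<^sub>R d) - g (y + real k *\<^sub>R d + d))\<^sup>2)"
proof -
  have "g y - g (y + real n *\<^sub>R d) = (\<Sum>k<n. g (y + real k *\<^sub>R d) - g (y + real k *\<^sub>R d + d))"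
    by (induction n) (auto simp: algebra_simps)
  then show ?thesis
    using sum_squared_le_sum_of_squares[of "\<lambda>k. g (y + real k *\<^sub>R d) - g (y + real k *\<^sub>R d + d)" "{..<n}"]
    by (simp add: mult.commute)
qed

text \<open>The point \<open>a\<close> is the \<open>k\<close>-th of the \<open>n + 1\<close>
  equidistant points of a segment whose ends lie in the ball, so convexity keeps it there, and
  \<open>n\<close> steps \<open>d\<close> span at most a diameter. The bound is free of
  \<open>k\<close>, so all steps of a path can be estimated by the same integral.\<close>

lemma segment_step_indicator:
  fixes a d :: "'a::real_normed_vector"
  assumes "k < n"
  shows "indicator (cball 0 \<rho>) (a - real k *\<^sub>R d) * indicator (cball 0 \<rho>) (a - real k *\<^sub>R d + real n *\<^sub>R d)
    \<le> (indicator (cball 0 \<rho>) a * indicator (cball 0 (2 * \<rho> / n)) d :: ennreal)"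
proof (cases "a - real k *\<^sub>R d \<in> cball 0 \<rho> \<and> a - real k *\<^sub>R d + real n *\<^sub>R d \<in> cball 0 \<rho>")
  case True
  define y z where "y = a - real k *\<^sub>R d" and "z = a - real k *\<^sub>R d + real n *\<^sub>R d"
  have n: "real n > 0" using assms by simp
  have y: "norm y \<le> \<rho>" and z: "norm z \<le> \<rho>" using True by (auto simp: y_def z_def)
  have "a = (1 - k/n) *\<^sub>R y + (k/n) *\<^sub>R z"
    using n by (simp add: y_def z_def algebra_simps)
  moreover have "(1 - k/n) *\<^sub>R y + (k/n) *\<^sub>R z \<in> cball 0 \<rho>"
    using y z assms by (intro convexD_alt convex_cball) auto
  ultimately have a: "a \<in> cball 0 \<rho>" by simp
  have "real n *\<^sub>R d = z - y" by (simp add: y_def z_def)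
  then have "real n * norm d \<le> 2 * \<rho>"
    using norm_triangle_ineq4[of z y] y z norm_scaleR[of "real n" d] by simp
  then have "norm d \<le> 2 * \<rho> / n" using n by (simp add: field_simps)
  with a show ?thesis by (simp add: indicator_def)
qed (auto simp: indicator_def)

text \<open>The exponent collects a factor \<open>n\<close> to the power of the dimension from the
  substitution \<open>z = y + n d\<close>, one \<open>n\<close> from the Cauchy-Schwarz inequality
  along the path, and one from summing \<open>n\<close> equal bounds. Only the start
  \<open>a\<close> of a step is confined to the ball, not its end \<open>a + d\<close>, which suits
  an energy that carries its weight at the start.\<close>

lemma path_poincare_ball:
  fixes g :: "'a::euclidean_space \<Rightarrow> real"
  assumes [measurable]: "g \<in> borel_measurable borel" and n: "n > 0"
  shows "(\<integral>\<^sup>+y\<in>cball 0 \<rho>. (\<integral>\<^sup>+z\<in>cball 0 \<rho>. ennreal ((g y - g z)\<^sup>2) \<partial>lborel) \<partial>lborel)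
    \<le> ennreal (real n ^ (DIM('a) + 2)) *
       (\<integral>\<^sup>+d\<in>cball 0 (2 * \<rho> / n). (\<integral>\<^sup>+a\<in>cball 0 \<rho>. ennreal ((g a - g (a + d))\<^sup>2) \<partial>lborel) \<partial>lborel)"
    (is "?L \<le> _ * ?R")
proof -
  let ?B = "cball (0::'a) \<rho>"
  have [measurable]: "?B \<in> sets borel" by simp
  define F where "F k y d = indicator ?B y * indicator ?B (y + real n *\<^sub>R d)
     * ennreal ((g (y + real k *\<^sub>R d) - g (y + real k *\<^sub>R d + d))\<^sup>2)" for k y d
  have [measurable]: "(\<lambda>(y,d). F k y d) \<in> borel_measurable (borel \<Otimes>\<^sub>M borel)" for k
    unfolding F_def by measurable
  have inner: "(\<integral>\<^sup>+z\<in>?B. ennreal ((g y - g z)\<^sup>2) \<partial>lborel) * indicator ?B y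
     \<le> ennreal (real n ^ (DIM('a) + 1)) * (\<Sum>k<n. \<integral>\<^sup>+d. F k y d \<partial>lborel)" for y
  proof -
    have "(\<integral>\<^sup>+z\<in>?B. ennreal ((g y - g z)\<^sup>2) \<partial>lborel) * indicator ?B y
      = ennreal (real n ^ DIM('a)) * (\<integral>\<^sup>+d. ennreal ((g y - g (y + real n *\<^sub>R d))\<^sup>2)
           * indicator ?B (y + real n *\<^sub>R d) * indicator ?B y \<partial>lborel)"
      using n by (subst nn_integral_lborel_affine[where c="real n" and v=y])
         (auto simp: indicator_def)
    also have "\<dots> \<le> ennreal (real n ^ DIM('a)) * (\<integral>\<^sup>+d. ennreal (real n) * (\<Sum>k<n. F k y d) \<partial>lborel)"
    proof (intro mult_left_mono nn_integral_mono)
      fix d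
      have "ennreal ((g y - g (y + real n *\<^sub>R d))\<^sup>2)
        \<le> ennreal (real n * (\<Sum>k<n. (g (y + real k *\<^sub>R d) - g (y + real k *\<^sub>R d + d))\<^sup>2))"
        by (intro ennreal_leI increment_squared_le_sum_steps)
      also have "\<dots> = ennreal (real n) * (\<Sum>k<n. ennreal ((g (y + real k *\<^sub>R d) - g (y + real k *\<^sub>R d + d))\<^sup>2))"
        by (simp add: ennreal_mult sum_nonneg)
      finally show "ennreal ((g y - g (y + real n *\<^sub>R d))\<^sup>2)
           * indicator ?B (y + real n *\<^sub>R d) * indicator ?B y \<le> ennreal (real n) * (\<Sum>k<n. F k y d)"
        by (auto simp: F_def indicator_def)
    qed auto
    also have "\<dots> = ennreal (real n ^ (DIM('a) + 1)) * (\<Sum>k<n. \<integral>\<^sup>+d. F k y d \<partial>lborel)"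
      by (simp add: nn_integral_cmult nn_integral_sum ennreal_mult[symmetric] mult.assoc[symmetric] power_commutes)
    finally show ?thesis .
  qed
  \<comment> \<open>Translating by \<open>k\<close> steps makes the start of the \<open>k\<close>-th
    step the new variable of integration.\<close>
  have step: "(\<integral>\<^sup>+y. \<integral>\<^sup>+d. F k y d \<partial>lborel \<partial>lborel) \<le> ?R" if k: "k < n" for k
  proof -
    have "(\<integral>\<^sup>+y. \<integral>\<^sup>+d. F k y d \<partial>lborel \<partial>lborel) = (\<integral>\<^sup>+d. \<integral>\<^sup>+y. F k y d \<partial>lborel \<partial>lborel)"
      by (rule lborel_pair.Fubini') simp
    also have "\<dots> = (\<integral>\<^sup>+d. \<integral>\<^sup>+a. F k (a - real k *\<^sub>R d) d \<partial>lborel \<partial>lborel)"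
    proof (rule nn_integral_cong)
      fix d :: 'a
      show "(\<integral>\<^sup>+y. F k y d \<partial>lborel) = (\<integral>\<^sup>+a. F k (a - real k *\<^sub>R d) d \<partial>lborel)"
        using nn_integral_lborel_translate[of "\<lambda>y. F k y d" "- (real k *\<^sub>R d)"] by simp
    qed
    also have "\<dots> \<le> (\<integral>\<^sup>+d. \<integral>\<^sup>+a. indicator (cball 0 (2 * \<rho> / n)) d *
         (ennreal ((g a - g (a + d))\<^sup>2) * indicator ?B a) \<partial>lborel \<partial>lborel)"
    proof (intro nn_integral_mono)
      fix d a :: 'a
      show "F k (a - real k *\<^sub>R d) d \<le> indicator (cball 0 (2 * \<rho> / n)) d *
         (ennreal ((g a - g (a + d))\<^sup>2) * indicator ?B a)"
        using mult_right_mono[OF segment_step_indicator[OF k, of \<rho> a d], of "ennreal ((g a - g (a + d))\<^sup>2)"]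
        by (simp add: F_def ac_simps)
    qed
    also have "\<dots> = ?R"
      by (intro nn_integral_cong) (subst nn_integral_cmult, auto simp: mult.commute)
    finally show ?thesis .
  qed
  have "?L \<le> (\<integral>\<^sup>+y. ennreal (real n ^ (DIM('a) + 1)) * (\<Sum>k<n. \<integral>\<^sup>+d. F k y d \<partial>lborel) \<partial>lborel)"
    by (intro nn_integral_mono inner)
  also have "\<dots> = ennreal (real n ^ (DIM('a) + 1)) * (\<Sum>k<n. \<integral>\<^sup>+y. \<integral>\<^sup>+d. F k y d \<partial>lborel \<partial>lborel)"
    by (subst nn_integral_cmult) (auto simp: nn_integral_sum)
  also have "\<dots> \<le> ennreal (real n ^ (DIM('a) + 1)) * (\<Sum>k<n. ?R)"
    by (intro mult_left_mono sum_mono step) auto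
  also have "\<dots> = ennreal (real n ^ (DIM('a) + 2)) * ?R"
    by (simp add: ennreal_of_nat_eq_real_of_nat ennreal_mult[symmetric] mult.assoc[symmetric])
      (simp add: ac_simps)
  finally show ?thesis .
qed

section \<open>Squared differences over pairs of sets\<close>

definition pair_integral :: "('a::euclidean_space \<Rightarrow> real) \<Rightarrow> 'a set \<Rightarrow> 'a set \<Rightarrow> ennreal" where
  "pair_integral g A B = (\<integral>\<^sup>+y\<in>A. (\<integral>\<^sup>+z\<in>B. ennreal ((g y - g z)\<^sup>2) \<partial>lborel) \<partial>lborel)"

text \<open>Unnormalized energy of a walk with increments uniform in a ball of radius
  \<open>r\<close>; the weight is attached to the starting point only.\<close>

definition increment_energy ::
  "('a::euclidean_space \<Rightarrow> real) \<Rightarrow> real \<Rightarrow> ('a \<Rightarrow> real) \<Rightarrow> ennreal" where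
  "increment_energy w r g =
     (\<integral>\<^sup>+d\<in>cball 0 r. (\<integral>\<^sup>+y. ennreal (w y) * ennreal ((g y - g (y + d))\<^sup>2) \<partial>lborel) \<partial>lborel)"

lemma ennreal_scale:
  "0 \<le> a \<Longrightarrow> 0 \<le> b \<Longrightarrow> ennreal a * (ennreal b * D) = ennreal (a * b) * D"
  by (simp add: ennreal_mult mult.assoc)

text \<open>The weights are conjugate, 1/3 + 2/3 = 1. The smaller one, 3/2, goes to the term that is
  carried from ball to ball in the later induction.\<close>

lemma square_triangle_weighted: "(x - z)\<^sup>2 \<le> 3 * (x - y)\<^sup>2 + 3/2 * (y - z :: real)\<^sup>2"
proof -
  have "3 * (x - y)\<^sup>2 + 3/2 * (y - z)\<^sup>2 - (x - z)\<^sup>2 = (2 * (x - y) - (y - z))\<^sup>2 / 2"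
    by (simp add: power2_eq_square field_simps)
  then show ?thesis using zero_le_power2[of "2 * (x - y) - (y - z)"] by linarith
qed

text \<open>The pointwise inequality is averaged over an intermediate point in \<open>C\<close>; on
  the right, each term misses one of the three variables, whose integration gives the volume in
  front.\<close>

lemma pair_integral_triangle:
  fixes g :: "'a::euclidean_space \<Rightarrow> real"
  assumes [measurable]: "g \<in> borel_measurable borel" "A \<in> sets borel" "B \<in> sets borel" "C \<in> sets borel"
  shows "emeasure lborel C * pair_integral g A B
    \<le> 3 * (emeasure lborel B * pair_integral g A C) + ennreal (3/2) * (emeasure lborel A * pair_integral g C B)"
proof -
  let ?f = "\<lambda>y z. ennreal ((g y - g z)\<^sup>2)"
  have "emeasure lborel C * pair_integral g A B
    = (\<integral>\<^sup>+x. indicator C x * pair_integral g A B \<partial>lborel)"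
    by (simp add: nn_integral_multc)
  also have "\<dots> = (\<integral>\<^sup>+x. \<integral>\<^sup>+y. \<integral>\<^sup>+z. indicator C x * indicator A y * indicator B z * ?f y z \<partial>lborel \<partial>lborel \<partial>lborel)"
    unfolding pair_integral_def
    by (simp add: nn_integral_cmult nn_integral_multc ac_simps flip: nn_integral_cmult)
  also have "\<dots> \<le> (\<integral>\<^sup>+x. \<integral>\<^sup>+y. \<integral>\<^sup>+z. 3 * (indicator C x * indicator A y * indicator B z * ?f y x)
       + ennreal (3/2) * (indicator C x * indicator A y * indicator B z * ?f x z) \<partial>lborel \<partial>lborel \<partial>lborel)"
  proof (intro nn_integral_mono)
    fix x y z
    have "?f y z \<le> ennreal (3 * (g y - g x)\<^sup>2 + 3/2 * (g x - g z)\<^sup>2)"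
      by (intro ennreal_leI square_triangle_weighted)
    also have "\<dots> = 3 * ?f y x + ennreal (3/2) * ?f x z"
      by (subst ennreal_plus) (simp_all add: ennreal_mult' del: times_divide_eq_left)
    finally show "indicator C x * indicator A y * indicator B z * ?f y z
      \<le> 3 * (indicator C x * indicator A y * indicator B z * ?f y x)
       + ennreal (3/2) * (indicator C x * indicator A y * indicator B z * ?f x z)"
      by (auto simp: indicator_def)
  qed
  also have "\<dots> = 3 * (\<integral>\<^sup>+x. \<integral>\<^sup>+y. \<integral>\<^sup>+z. indicator C x * indicator A y * indicator B z * ?f y x \<partial>lborel \<partial>lborel \<partial>lborel)
       + ennreal (3/2) * (\<integral>\<^sup>+x. \<integral>\<^sup>+y. \<integral>\<^sup>+z. indicator C x * indicator A y * indicator B z * ?f x z \<partial>lborel \<partial>lborel \<partial>lborel)"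
    by (simp add: nn_integral_add nn_integral_cmult)
  also have "(\<integral>\<^sup>+x. \<integral>\<^sup>+y. \<integral>\<^sup>+z. indicator C x * indicator A y * indicator B z * ?f y x \<partial>lborel \<partial>lborel \<partial>lborel)
    = (\<integral>\<^sup>+y. \<integral>\<^sup>+x. \<integral>\<^sup>+z. indicator C x * indicator A y * indicator B z * ?f y x \<partial>lborel \<partial>lborel \<partial>lborel)"
    by (rule lborel_pair.Fubini') measurable
  also have "\<dots> = (\<integral>\<^sup>+y. \<integral>\<^sup>+x. emeasure lborel B * (indicator A y * (indicator C x * ?f y x)) \<partial>lborel \<partial>lborel)"
    by (intro nn_integral_cong)
      (simp add: nn_integral_cmult nn_integral_multc mult.assoc, simp add: ac_simps)
  also have "\<dots> = emeasure lborel B * pair_integral g A C"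
    by (simp add: pair_integral_def nn_integral_cmult mult.commute)
  also have "(\<integral>\<^sup>+x. \<integral>\<^sup>+y. \<integral>\<^sup>+z. indicator C x * indicator A y * indicator B z * ?f x z \<partial>lborel \<partial>lborel \<partial>lborel)
    = (\<integral>\<^sup>+x. \<integral>\<^sup>+y. indicator A y * (indicator C x * (\<integral>\<^sup>+z. ?f x z * indicator B z \<partial>lborel)) \<partial>lborel \<partial>lborel)"
    by (intro nn_integral_cong) (simp add: nn_integral_cmult mult.assoc, simp add: ac_simps)
  also have "\<dots> = emeasure lborel A * pair_integral g C B"
    by (simp add: pair_integral_def nn_integral_multc nn_integral_cmult mult.commute)
  finally show ?thesis .
qed

lemma emeasure_cball_scale:
  assumes "k \<ge> 0" "r \<ge> 0"
  shows "emeasure lborel (cball (0::'a::euclidean_space) (k * r))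
    = ennreal (k ^ DIM('a)) * emeasure lborel (cball (0::'a) r)"
  using assms by (simp add: emeasure_cball power_mult_distrib ennreal_mult[symmetric] ac_simps)

section \<open>Weak Poincare inequality for weights of dyadic decay\<close>

text \<open>A polynomial tail read off on dyadic scales: \<open>w\<close> is of order
  \<open>1 / \<theta> ^ j\<close> at distance about \<open>2 ^ j * r\<close>. The volume of these
  shells grows by \<open>2 ^ DIM('a)\<close> per scale, so the condition on \<theta> is summability.
  The base radius is \<open>r / 2\<close> so that two points of the base ball differ by one
  admissible increment.\<close>

locale dyadic_weight =
  fixes w :: "'a::euclidean_space \<Rightarrow> real" and r \<theta> cl cu :: real
  assumes w_meas[measurable]: "w \<in> borel_measurable borel"
    and w_nonneg: "w y \<ge> 0"
    and r_pos: "r > 0" and cl_pos: "cl > 0" and cu_pos: "cu > 0"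
    and \<theta>: "\<theta> > 2 ^ DIM('a)"
    and w_lower: "norm y \<le> 2 ^ j * (r / 2) \<Longrightarrow> cl / \<theta> ^ j \<le> w y"
    and w_upper: "norm y > 2 ^ j * (r / 2) \<Longrightarrow> w y \<le> cu / \<theta> ^ j"
    and w_bounded: "w y \<le> cu"
begin

definition B :: "nat \<Rightarrow> 'a set" where "B j = cball 0 (2 ^ j * (r / 2))"

lemma B_meas[measurable]: "B j \<in> sets borel"
  by (simp add: B_def)

lemma B_mono: "i \<le> j \<Longrightarrow> B i \<subseteq> B j"
  using r_pos by (auto simp: B_def cball_subset_cball_iff intro!: mult_right_mono power_increasing)

lemma emeasure_B: "emeasure lborel (B j) = ennreal ((2 ^ DIM('a)) ^ j) * emeasure lborel (B 0)"
  using r_pos emeasure_cball_scale[of "2 ^ j" "r / 2", where 'a='a]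
  by (simp add: B_def power_mult[symmetric] mult.commute)

lemma emeasure_B0: "emeasure lborel (B 0) = ennreal (measure lborel (B 0))" "measure lborel (B 0) > 0"
  using r_pos by (auto simp: B_def emeasure_eq_ennreal_measure emeasure_cball content_cball_pos)

lemma \<theta>_pos: "\<theta> > 0"
  using \<theta> zero_less_power[of "2::real" "DIM('a)"] by linarith

lemma \<theta>_ge1: "\<theta> > 1"
  using \<theta> one_le_power[of "2::real" "DIM('a)"] by linarith

text \<open>Cutting a segment of \<open>B j\<close> into \<open>2 ^ j\<close> pieces makes each
  piece at most \<open>r\<close> long. The path estimate costs
  \<open>(2 ^ j) ^ (DIM('a) + 2)\<close>, and inserting the weight costs the reciprocal
  \<open>\<theta> ^ j / cl\<close> of its lower bound on \<open>B j\<close>.\<close>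

lemma pair_integral_B_self:
  assumes [measurable]: "g \<in> borel_measurable borel"
  shows "pair_integral g (B j) (B j)
    \<le> ennreal ((2 ^ DIM('a)) ^ j * (4 * \<theta>) ^ j / cl) * increment_energy w r g"
proof -
  have eq: "2 * (2 ^ j * (r / 2)) / real (2 ^ j) = r" by simp
  have "pair_integral g (B j) (B j) \<le> ennreal (real (2^j) ^ (DIM('a) + 2)) *
     (\<integral>\<^sup>+d\<in>cball 0 r. (\<integral>\<^sup>+a\<in>B j. ennreal ((g a - g (a + d))\<^sup>2) \<partial>lborel) \<partial>lborel)"
    using path_poincare_ball[of g "2 ^ j" "2 ^ j * (r / 2)"]
    unfolding pair_integral_def B_def eq by simp
  also have "\<dots> \<le> ennreal (real (2^j) ^ (DIM('a) + 2)) * (ennreal (\<theta> ^ j / cl) * increment_energy w r g)"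
  proof (intro mult_left_mono)
    have "(\<integral>\<^sup>+d\<in>cball 0 r. (\<integral>\<^sup>+a\<in>B j. ennreal ((g a - g (a + d))\<^sup>2) \<partial>lborel) \<partial>lborel)
      \<le> (\<integral>\<^sup>+d\<in>cball 0 r. ennreal (\<theta> ^ j / cl) * (\<integral>\<^sup>+a. ennreal (w a) * ennreal ((g a - g (a + d))\<^sup>2) \<partial>lborel) \<partial>lborel)"
    proof (intro nn_integral_mono mult_right_mono)
      fix d :: 'a
      have "(\<integral>\<^sup>+a\<in>B j. ennreal ((g a - g (a + d))\<^sup>2) \<partial>lborel)
        \<le> (\<integral>\<^sup>+a. ennreal (\<theta> ^ j / cl) * (ennreal (w a) * ennreal ((g a - g (a + d))\<^sup>2)) \<partial>lborel)"
      proof (intro nn_integral_mono)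
        fix a :: 'a
        have "ennreal ((g a - g (a + d))\<^sup>2) \<le> ennreal ((\<theta> ^ j / cl * w a) * (g a - g (a + d))\<^sup>2)" if "a \<in> B j"
        proof (intro ennreal_leI)
          have "1 \<le> \<theta> ^ j / cl * w a"
            using w_lower[of a j] that cl_pos \<theta>_pos by (simp add: B_def field_simps)
          then show "(g a - g (a + d))\<^sup>2 \<le> (\<theta> ^ j / cl * w a) * (g a - g (a + d))\<^sup>2"
            using mult_right_mono[of 1 "\<theta> ^ j / cl * w a" "(g a - g (a + d))\<^sup>2"] by simp
        qed
        then show "ennreal ((g a - g (a + d))\<^sup>2) * indicator (B j) a
          \<le> ennreal (\<theta> ^ j / cl) * (ennreal (w a) * ennreal ((g a - g (a + d))\<^sup>2))"
          using w_nonneg[of a] \<theta>_pos cl_pos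
          by (auto simp: indicator_def ennreal_mult' mult.assoc simp del: times_divide_eq_left)
      qed
      also have "\<dots> = ennreal (\<theta> ^ j / cl) * (\<integral>\<^sup>+a. ennreal (w a) * ennreal ((g a - g (a + d))\<^sup>2) \<partial>lborel)"
        by (simp add: nn_integral_cmult)
      finally show "(\<integral>\<^sup>+a\<in>B j. ennreal ((g a - g (a + d))\<^sup>2) \<partial>lborel) \<le> \<dots>" .
    qed auto
    also have "\<dots> = ennreal (\<theta> ^ j / cl) * increment_energy w r g"
      unfolding increment_energy_def mult.assoc by (rule nn_integral_cmult) (measurable, simp_all)
    finally show "(\<integral>\<^sup>+d\<in>cball 0 r. (\<integral>\<^sup>+a\<in>B j. ennreal ((g a - g (a + d))\<^sup>2) \<partial>lborel) \<partial>lborel) \<le> \<dots>" .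
  qed auto
  also have "\<dots> = ennreal (real (2^j) ^ (DIM('a) + 2) * (\<theta> ^ j / cl)) * increment_energy w r g"
    using \<theta>_pos cl_pos by (intro ennreal_scale) auto
  also have "real (2^j) ^ (DIM('a) + 2) * (\<theta> ^ j / cl) = (2 ^ DIM('a)) ^ j * (4 * \<theta>) ^ j / cl"
    by (simp add: power_add power_mult_distrib power2_eq_square flip: power_mult)
      (simp add: mult.commute flip: power_mult_distrib)
  finally show ?thesis .
qed

text \<open>Induction through the intermediate ball \<open>B j\<close>: pairs in
  \<open>B (Suc j)\<close> and \<open>B j\<close> are controlled by paths, pairs in
  \<open>B j\<close> and \<open>B 0\<close> by the induction hypothesis. Dividing by the finite
  positive volume of \<open>B j\<close> completes the step.\<close>

lemma pair_integral_B_B0: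
  assumes [measurable]: "g \<in> borel_measurable borel"
  shows "pair_integral g (B j) (B 0)
    \<le> ennreal (6 * 2 ^ DIM('a) / cl * (4 * \<theta>) ^ j) * increment_energy w r g"
proof (induction j)
  case 0
  have "1 \<le> 6 * (2::real) ^ DIM('a)" using one_le_power[of "2::real" "DIM('a)"] by linarith
  then show ?case
    using cl_pos by (intro order_trans[OF pair_integral_B_self[OF assms, of 0]] mult_right_mono ennreal_leI)
      (auto simp: divide_right_mono)
next
  case (Suc j)
  let ?P = "2 ^ DIM('a) :: real" and ?D = "increment_energy w r g" and ?b = "measure lborel (B 0)"
  have "pair_integral g (B (Suc j)) (B j) \<le> pair_integral g (B (Suc j)) (B (Suc j))"
    unfolding pair_integral_def using B_mono[of j "Suc j"]
    by (intro nn_integral_mono mult_right_mono) (auto simp: indicator_def)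
  also have "\<dots> \<le> ennreal (?P ^ Suc j * (4 * \<theta>) ^ Suc j / cl) * ?D"
    by (rule pair_integral_B_self) simp
  finally have 1: "pair_integral g (B (Suc j)) (B j) \<le> \<dots>" .
  have "emeasure lborel (B j) * pair_integral g (B (Suc j)) (B 0)
    \<le> 3 * (emeasure lborel (B 0) * pair_integral g (B (Suc j)) (B j))
       + ennreal (3/2) * (emeasure lborel (B (Suc j)) * pair_integral g (B j) (B 0))"
    by (rule pair_integral_triangle) auto
  also have "\<dots> \<le> 3 * (ennreal ?b * (ennreal (?P ^ Suc j * (4 * \<theta>) ^ Suc j / cl) * ?D))
       + ennreal (3/2) * (ennreal (?P ^ Suc j) * ennreal ?b * (ennreal (6 * ?P / cl * (4 * \<theta>) ^ j) * ?D))"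
    unfolding emeasure_B[of "Suc j"] emeasure_B0(1)
    by (intro add_mono mult_left_mono Suc 1) auto
  also have "\<dots> = ennreal (3 * (?b * (?P ^ Suc j * (4 * \<theta>) ^ Suc j / cl))
       + (3/2) * (?P ^ Suc j * ?b * (6 * ?P / cl * (4 * \<theta>) ^ j))) * ?D"
  proof -
    have "3 * (ennreal x * (ennreal y * ?D)) + ennreal (3/2) * (ennreal z * ennreal x * (ennreal v * ?D))
        = ennreal (3 * (x * y) + (3/2) * (z * x * v)) * ?D" if "x \<ge> 0" "y \<ge> 0" "z \<ge> 0" "v \<ge> 0" for x y z v
    proof -
      have "ennreal (c * (x * y) + c' * (z * x * v)) = ennreal c * (ennreal x * ennreal y)
          + ennreal c' * (ennreal z * ennreal x * ennreal v)" if "c \<ge> 0" "c' \<ge> 0" for c c'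
        using that \<open>x \<ge> 0\<close> \<open>y \<ge> 0\<close> \<open>z \<ge> 0\<close> \<open>v \<ge> 0\<close> by (simp add: ennreal_mult)
      from this[of 3 "3/2"] show ?thesis by (simp only: ring_distribs mult.assoc) simp
    qed
    then show ?thesis using emeasure_B0(2) \<theta>_pos cl_pos by simp
  qed
  also have "\<dots> \<le> ennreal (?P ^ j * ?b * (6 * ?P / cl * (4 * \<theta>) ^ Suc j)) * ?D"
  proof (intro mult_right_mono ennreal_leI)
    \<comment> \<open>In units of \<open>Q\<close> the two terms amount to
      \<open>12 * \<theta>\<close> and 9 times \<open>2 ^ DIM('a)\<close>, against
      \<open>24 * \<theta>\<close> on the right. The constant 6 in the bound is large enough for
      this to close, since \<open>2 ^ DIM('a) < \<theta>\<close>.\<close>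
    define Q where "Q = ?P ^ j * ?b * ?P * (4 * \<theta>) ^ j / cl"
    have Q: "Q \<ge> 0" using emeasure_B0(2) \<theta>_pos cl_pos by (simp add: Q_def)
    have "3 * (?b * (?P ^ Suc j * (4 * \<theta>) ^ Suc j / cl)) + (3/2) * (?P ^ Suc j * ?b * (6 * ?P / cl * (4 * \<theta>) ^ j))
      = (12 * \<theta> + 9 * ?P) * Q" by (simp add: Q_def field_simps add_divide_distrib)
    also have "\<dots> \<le> (24 * \<theta>) * Q" using \<theta> Q \<theta>_pos by (intro mult_right_mono) auto
    also have "\<dots> = ?P ^ j * ?b * (6 * ?P / cl * (4 * \<theta>) ^ Suc j)" by (simp add: Q_def field_simps)
    finally show "3 * (?b * (?P ^ Suc j * (4 * \<theta>) ^ Suc j / cl))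
       + (3/2) * (?P ^ Suc j * ?b * (6 * ?P / cl * (4 * \<theta>) ^ j)) \<le> \<dots>" .
  qed auto
  also have "\<dots> = emeasure lborel (B j) * (ennreal (6 * ?P / cl * (4 * \<theta>) ^ Suc j) * ?D)"
  proof -
    have b: "emeasure lborel (B j) = ennreal (?P ^ j * ?b)"
      using emeasure_B0(2) unfolding emeasure_B[of j] emeasure_B0(1) by (subst ennreal_mult) auto
    show ?thesis
      using emeasure_B0(2) \<theta>_pos cl_pos unfolding b by (intro ennreal_scale[symmetric]) auto
  qed
  finally have le: "emeasure lborel (B j) * pair_integral g (B (Suc j)) (B 0)
    \<le> emeasure lborel (B j) * (ennreal (6 * ?P / cl * (4 * \<theta>) ^ Suc j) * ?D)" .
  have "emeasure lborel (B j) = ennreal (?P ^ j * ?b)" "?P ^ j * ?b > 0"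
    using emeasure_B0(2) unfolding emeasure_B[of j] emeasure_B0(1) by (auto simp: ennreal_mult')
  with le show ?case
    by (subst (asm) ennreal_mult_le_mult_iff) auto
qed

text \<open>The reference point ranges uniformly over the core \<open>B 0\<close>; for a function of
  mean zero this dominates its variance, up to the volume of the core.\<close>

definition weighted_pair :: "('a \<Rightarrow> real) \<Rightarrow> 'a set \<Rightarrow> ennreal" where
  "weighted_pair g A = (\<integral>\<^sup>+y\<in>A. ennreal (w y) * (\<integral>\<^sup>+z\<in>B 0. ennreal ((g y - g z)\<^sup>2) \<partial>lborel) \<partial>lborel)"

lemma weighted_pair_le:
  assumes [measurable]: "g \<in> borel_measurable borel" "A \<in> sets borel"
    and w: "\<And>y. y \<in> A \<Longrightarrow> w y \<le> c" and c: "c \<ge> 0"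
  shows "weighted_pair g A \<le> ennreal c * pair_integral g A (B 0)"
proof -
  have "weighted_pair g A \<le> (\<integral>\<^sup>+y. ennreal c * ((\<integral>\<^sup>+z\<in>B 0. ennreal ((g y - g z)\<^sup>2) \<partial>lborel) * indicator A y) \<partial>lborel)"
    unfolding weighted_pair_def
    by (intro nn_integral_mono) (auto simp: indicator_def intro!: mult_right_mono ennreal_leI w)
  also have "\<dots> = ennreal c * pair_integral g A (B 0)"
    unfolding pair_integral_def by (simp add: nn_integral_cmult)
  finally show ?thesis .
qed

lemma weighted_pair_Un:
  assumes [measurable]: "g \<in> borel_measurable borel" "A \<in> sets borel" "A' \<in> sets borel"
  shows "weighted_pair g (A \<union> A') \<le> weighted_pair g A + weighted_pair g A'"
  unfolding weighted_pair_def
  by (subst nn_integral_add[symmetric]) (auto intro!: nn_integral_mono simp: indicator_def)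

text \<open>The last factor \<open>4 * \<theta>\<close> pays for an index shift: the shell outside
  \<open>B j\<close> has weight at most \<open>cu / \<theta> ^ j\<close>, but its pairs are bounded
  at scale \<open>Suc j\<close>.\<close>

definition CB :: real where "CB = cu * (6 * 2 ^ DIM('a) / cl) * (4 * \<theta>)"

lemma CB_pos: "CB > 0"
  using cu_pos cl_pos \<theta>_pos by (simp add: CB_def)

text \<open>On each shell the weight cancels the power of \<theta> and leaves
  \<open>CB * 4 ^ j\<close>. The sum over the shells is geometric, hence governed by its last term:
  \<open>2 * 4 ^ j\<close> still fits below \<open>4 ^ Suc j\<close>.\<close>

lemma weighted_pair_B:
  assumes [measurable]: "g \<in> borel_measurable borel"
  shows "weighted_pair g (B j) \<le> ennreal (CB * 4 ^ j) * increment_energy w r g"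
proof (induction j)
  case 0
  have "weighted_pair g (B 0) \<le> ennreal cu * pair_integral g (B 0) (B 0)"
    using w_bounded cu_pos by (intro weighted_pair_le) auto
  also have "\<dots> \<le> ennreal cu * (ennreal (6 * 2 ^ DIM('a) / cl * (4 * \<theta>) ^ 0) * increment_energy w r g)"
    by (intro mult_left_mono pair_integral_B_B0) auto
  also have "\<dots> = ennreal (cu * (6 * 2 ^ DIM('a) / cl * (4 * \<theta>) ^ 0)) * increment_energy w r g"
    using cu_pos cl_pos by (subst ennreal_mult') (simp_all add: mult.assoc)
  also have "\<dots> \<le> ennreal (CB * 4 ^ 0) * increment_energy w r g"
  proof (intro mult_right_mono ennreal_leI)
    have "cu * (6 * 2 ^ DIM('a) / cl) * 1 \<le> cu * (6 * 2 ^ DIM('a) / cl) * (4 * \<theta>)"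
      using cu_pos cl_pos \<theta>_ge1 by (intro mult_left_mono) auto
    then show "cu * (6 * 2 ^ DIM('a) / cl * (4 * \<theta>) ^ 0) \<le> CB * 4 ^ 0" by (simp add: CB_def)
  qed auto
  finally show ?case .
next
  case (Suc j)
  have "weighted_pair g (B (Suc j)) = weighted_pair g (B j \<union> (B (Suc j) - B j))"
    using B_mono[of j "Suc j"] by (simp add: Un_absorb1)
  also have "\<dots> \<le> weighted_pair g (B j) + weighted_pair g (B (Suc j) - B j)"
    by (intro weighted_pair_Un) auto
  also have "weighted_pair g (B (Suc j) - B j) \<le> ennreal (cu / \<theta> ^ j) * pair_integral g (B (Suc j) - B j) (B 0)"
    using w_upper cu_pos \<theta>_pos by (intro weighted_pair_le) (auto simp: B_def)
  also have "pair_integral g (B (Suc j) - B j) (B 0) \<le> pair_integral g (B (Suc j)) (B 0)"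
    unfolding pair_integral_def by (intro nn_integral_mono) (auto simp: indicator_def)
  also have "\<dots> \<le> ennreal (6 * 2 ^ DIM('a) / cl * (4 * \<theta>) ^ Suc j) * increment_energy w r g"
    by (rule pair_integral_B_B0) simp
  also have "ennreal (cu / \<theta> ^ j) * (ennreal (6 * 2 ^ DIM('a) / cl * (4 * \<theta>) ^ Suc j) * increment_energy w r g)
     = ennreal (cu / \<theta> ^ j * (6 * 2 ^ DIM('a) / cl * (4 * \<theta>) ^ Suc j)) * increment_energy w r g"
    using cu_pos cl_pos \<theta>_pos by (intro ennreal_scale) auto
  also have "cu / \<theta> ^ j * (6 * 2 ^ DIM('a) / cl * (4 * \<theta>) ^ Suc j) = CB * 4 ^ j"
    using \<theta>_pos by (simp add: CB_def power_mult_distrib field_simps)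
  also have "weighted_pair g (B j) + ennreal (CB * 4 ^ j) * increment_energy w r g
     \<le> ennreal (CB * 4 ^ j) * increment_energy w r g + ennreal (CB * 4 ^ j) * increment_energy w r g"
    by (intro add_mono Suc) auto
  also have "\<dots> = ennreal (2 * (CB * 4 ^ j)) * increment_energy w r g"
    using CB_pos by (simp add: distrib_right[symmetric] ennreal_plus[symmetric] mult.assoc)
  also have "\<dots> \<le> ennreal (CB * 4 ^ Suc j) * increment_energy w r g"
    using CB_pos by (intro mult_right_mono ennreal_leI) auto
  finally show ?case by (auto simp: add_left_mono mult_left_mono)
qed

text \<open>Sum of a geometric series of shell masses with ratio
  \<open>2 ^ DIM('a) / \<theta>\<close>. The extra \<open>2 ^ DIM('a)\<close> arises because a shell
  is weighed at its inner radius and measured at its outer one.\<close>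

definition CT :: real where "CT = cu * 2 ^ DIM('a) * measure lborel (B 0) / (1 - 2 ^ DIM('a) / \<theta>)"

lemma CT_pos: "CT > 0"
  using cu_pos \<theta>_pos \<theta> emeasure_B0(2) by (simp add: CT_def)

lemma weight_tail: "(\<integral>\<^sup>+y\<in>- B J. ennreal (w y) \<partial>lborel) \<le> ennreal (CT * (2 ^ DIM('a) / \<theta>) ^ J)"
proof -
  let ?N = "density lborel (\<lambda>y. ennreal (w y))" and ?\<kappa> = "2 ^ DIM('a) / \<theta>" and ?b = "measure lborel (B 0)"
  have cover: "- B J \<subseteq> (\<Union>i. B (Suc (J + i)) - B (J + i))"
  proof
    fix y assume y: "y \<in> - B J"
    obtain n where "norm y / (r / 2) < 2 ^ n" using real_arch_pow[of 2 "norm y / (r / 2)"] by auto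
    then have "norm y \<le> 2 ^ n * (r / 2)" using r_pos by (simp add: field_simps)
    then have n: "y \<in> B n" by (simp add: B_def)
    \<comment> \<open>The first ball that contains \<open>y\<close> is the outer ball of its
      shell.\<close>
    define m where "m = (LEAST n. y \<in> B n)"
    have m: "y \<in> B m" and least: "\<And>k. k < m \<Longrightarrow> y \<notin> B k"
      unfolding m_def using LeastI[of "\<lambda>n. y \<in> B n", OF n] not_less_Least by blast+
    have "m > J" using m y B_mono[of m J] by (cases "m \<le> J") auto
    then obtain i where i: "m = Suc (J + i)" using less_imp_Suc_add by blast
    have "y \<in> B (Suc (J + i)) - B (J + i)" using m least[of "J + i"] i by simp
    then show "y \<in> (\<Union>i. B (Suc (J + i)) - B (J + i))" by blast
  qed
  have shell: "emeasure ?N (B (Suc (J + i)) - B (J + i)) \<le> ennreal (cu * 2 ^ DIM('a) * ?b * ?\<kappa> ^ J * ?\<kappa> ^ i)" for i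
  proof -
    have "emeasure ?N (B (Suc (J + i)) - B (J + i))
      = (\<integral>\<^sup>+y\<in>B (Suc (J + i)) - B (J + i). ennreal (w y) \<partial>lborel)"
      by (subst emeasure_density) auto
    also have "\<dots> \<le> (\<integral>\<^sup>+y. ennreal (cu / \<theta> ^ (J + i)) * indicator (B (Suc (J + i))) y \<partial>lborel)"
      by (intro nn_integral_mono) (auto simp: indicator_def B_def intro!: ennreal_leI w_upper)
    also have "\<dots> = ennreal (cu / \<theta> ^ (J + i)) * (ennreal ((2 ^ DIM('a)) ^ Suc (J + i)) * ennreal ?b)"
      by (simp add: nn_integral_cmult emeasure_B[of "Suc (J + i)"] emeasure_B0(1)[symmetric])
    also have "\<dots> = ennreal (cu / \<theta> ^ (J + i) * ((2 ^ DIM('a)) ^ Suc (J + i) * ?b))"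
      using cu_pos \<theta>_pos by (subst ennreal_mult[symmetric], simp, simp)+ simp
    also have "cu / \<theta> ^ (J + i) * ((2 ^ DIM('a)) ^ Suc (J + i) * ?b) = cu * 2 ^ DIM('a) * ?b * ?\<kappa> ^ J * ?\<kappa> ^ i"
      by (simp add: power_add power_divide field_simps)
    finally show ?thesis .
  qed
  have sums: "(\<lambda>i. cu * 2 ^ DIM('a) * ?b * ?\<kappa> ^ J * ?\<kappa> ^ i) sums (cu * 2 ^ DIM('a) * ?b * ?\<kappa> ^ J * (1 / (1 - ?\<kappa>)))"
    using \<theta> \<theta>_pos by (intro sums_mult geometric_sums) auto
  have "(\<integral>\<^sup>+y\<in>- B J. ennreal (w y) \<partial>lborel) = emeasure ?N (- B J)"
    by (subst emeasure_density) auto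
  also have "\<dots> \<le> emeasure ?N (\<Union>i. B (Suc (J + i)) - B (J + i))"
    by (intro emeasure_mono cover) auto
  also have "\<dots> \<le> (\<Sum>i. emeasure ?N (B (Suc (J + i)) - B (J + i)))"
    by (intro emeasure_subadditive_countably) auto
  also have "\<dots> \<le> (\<Sum>i. ennreal (cu * 2 ^ DIM('a) * ?b * ?\<kappa> ^ J * ?\<kappa> ^ i))"
    by (intro suminf_le shell) auto
  also have "\<dots> = ennreal (cu * 2 ^ DIM('a) * ?b * ?\<kappa> ^ J * (1 / (1 - ?\<kappa>)))"
    using cu_pos \<theta>_pos sums by (intro suminf_ennreal_eq) auto
  also have "cu * 2 ^ DIM('a) * ?b * ?\<kappa> ^ J * (1 / (1 - ?\<kappa>)) = CT * ?\<kappa> ^ J"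
    by (simp add: CT_def)
  finally show ?thesis .
qed

lemma weight_integrable: "integrable lborel w"
proof -
  have "(\<integral>\<^sup>+y. ennreal (w y) \<partial>lborel)
    \<le> (\<integral>\<^sup>+y. ennreal cu * indicator (B 0) y + ennreal (w y) * indicator (- B 0) y \<partial>lborel)"
    by (intro nn_integral_mono) (auto simp: indicator_def intro!: ennreal_leI w_bounded)
  also have "\<dots> = ennreal cu * emeasure lborel (B 0) + (\<integral>\<^sup>+y\<in>- B 0. ennreal (w y) \<partial>lborel)"
    by (simp add: nn_integral_add nn_integral_cmult)
  also have "\<dots> < \<infinity>"
    unfolding emeasure_B0(1) using weight_tail[of 0] by (auto simp: ennreal_mult_less_top intro: le_less_trans)
  finally show ?thesis
    using w_nonneg by (intro integrableI_nonneg) auto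
qed

text \<open>The scale \<open>J\<close> stays free: increasing it makes the energy term larger and
  the oscillation term smaller, and the best choice depends on the size of the variance.\<close>

theorem weak_poincare:
  assumes [measurable]: "g \<in> borel_measurable borel" and osc: "\<And>x y. \<bar>g x - g y\<bar> \<le> \<omega>"
  shows "weighted_pair g UNIV \<le> ennreal (CB * 4 ^ J) * increment_energy w r g
    + ennreal (CT * measure lborel (B 0) * \<omega>\<^sup>2 * (2 ^ DIM('a) / \<theta>) ^ J)"
proof -
  have "weighted_pair g (- B J) \<le> (\<integral>\<^sup>+y. ennreal (\<omega>\<^sup>2 * measure lborel (B 0)) * (ennreal (w y) * indicator (- B J) y) \<partial>lborel)"
    unfolding weighted_pair_def
  proof (intro nn_integral_mono)
    fix y
    have "(\<integral>\<^sup>+z\<in>B 0. ennreal ((g y - g z)\<^sup>2) \<partial>lborel) \<le> (\<integral>\<^sup>+z. ennreal (\<omega>\<^sup>2) * indicator (B 0) z \<partial>lborel)"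
      using power_mono[OF osc, of y _ 2] by (intro nn_integral_mono mult_right_mono ennreal_leI) auto
    also have "\<dots> = ennreal (\<omega>\<^sup>2 * measure lborel (B 0))"
      by (simp add: nn_integral_cmult emeasure_B0(1) ennreal_mult)
    finally have "(\<integral>\<^sup>+z\<in>B 0. ennreal ((g y - g z)\<^sup>2) \<partial>lborel) \<le> \<dots>" .
    from mult_left_mono[OF this, of "ennreal (w y)"]
    show "ennreal (w y) * (\<integral>\<^sup>+z\<in>B 0. ennreal ((g y - g z)\<^sup>2) \<partial>lborel) * indicator (- B J) y
      \<le> ennreal (\<omega>\<^sup>2 * measure lborel (B 0)) * (ennreal (w y) * indicator (- B J) y)"
      by (auto simp: indicator_def mult.commute)
  qed
  also have "\<dots> = ennreal (\<omega>\<^sup>2 * measure lborel (B 0)) * (\<integral>\<^sup>+y\<in>- B J. ennreal (w y) \<partial>lborel)"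
    by (simp add: nn_integral_cmult)
  also have "\<dots> \<le> ennreal (\<omega>\<^sup>2 * measure lborel (B 0)) * ennreal (CT * (2 ^ DIM('a) / \<theta>) ^ J)"
    by (intro mult_left_mono weight_tail) auto
  also have "\<dots> = ennreal (CT * measure lborel (B 0) * \<omega>\<^sup>2 * (2 ^ DIM('a) / \<theta>) ^ J)"
    using CT_pos \<theta>_pos by (subst ennreal_mult[symmetric]) (auto simp: ac_simps)
  finally have tail: "weighted_pair g (- B J) \<le> \<dots>" .
  have "weighted_pair g UNIV = weighted_pair g (B J \<union> - B J)" by simp
  also have "\<dots> \<le> weighted_pair g (B J) + weighted_pair g (- B J)"
    by (intro weighted_pair_Un) auto
  also have "\<dots> \<le> ennreal (CB * 4 ^ J) * increment_energy w r g
    + ennreal (CT * measure lborel (B 0) * \<omega>\<^sup>2 * (2 ^ DIM('a) / \<theta>) ^ J)"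
    by (intro add_mono weighted_pair_B tail) auto
  finally show ?thesis .
qed

end

section \<open>Polynomial decay from a multiscale drift\<close>

text \<open>For the differential equation \<open>x' = - c * x powr (1 + 1/\<alpha>)\<close>, the
  function \<open>x powr (- 1/\<alpha>)\<close> grows at the constant rate
  \<open>c / \<alpha>\<close>. The discrete version follows from a Bernoulli-type bound,
  \<open>(1 - z) powr (- 1/\<alpha>) \<ge> 1 + z / \<alpha>\<close>.\<close>

lemma powr_neg_growth_step:
  fixes x y c \<alpha> :: real
  assumes y: "0 < y" and x: "0 < x" and \<alpha>: "\<alpha> > 0" and c: "c > 0"
    and le: "y \<le> x - c * x powr (1 + 1/\<alpha>)"
  shows "x powr (- 1/\<alpha>) + c / \<alpha> \<le> y powr (- 1/\<alpha>)"
proof -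
  define z where "z = c * x powr (1/\<alpha>)"
  have z: "z > 0" using c x by (simp add: z_def)
  have yz: "y \<le> x * (1 - z)" using le x by (simp add: z_def powr_add algebra_simps)
  then have z1: "z < 1" using x y by (smt (verit) mult_pos_neg mult_nonneg_nonpos)
  have "x powr (- 1/\<alpha>) * (1 + z / \<alpha>) \<le> x powr (- 1/\<alpha>) * (1 - z) powr (- 1/\<alpha>)"
  proof (intro mult_left_mono)
    have "1 + z / \<alpha> \<le> 1 + (- 1/\<alpha>) * ln (1 - z)"
      using ln_le_minus_one[of "1 - z"] z1 \<alpha> mult_nonneg_nonpos[of \<alpha> "z + ln (1 - z)"]
      by (simp add: field_simps)
    also have "\<dots> \<le> exp ((- 1/\<alpha>) * ln (1 - z))" by (rule exp_ge_add_one_self)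
    also have "\<dots> = (1 - z) powr (- 1/\<alpha>)" using z1 by (simp add: powr_def)
    finally show "1 + z / \<alpha> \<le> (1 - z) powr (- 1/\<alpha>)" .
  qed simp
  also have "\<dots> = (x * (1 - z)) powr (- 1/\<alpha>)"
    using x z1 by (simp add: powr_mult)
  also have "\<dots> \<le> y powr (- 1/\<alpha>)"
    using yz y \<alpha> by (intro powr_mono2') auto
  finally have "x powr (- 1/\<alpha>) * (1 + z / \<alpha>) \<le> y powr (- 1/\<alpha>)" .
  moreover have "x powr (- 1/\<alpha>) * x powr (1/\<alpha>) = 1"
    using x by (simp add: powr_add[symmetric])
  ultimately show ?thesis by (simp add: z_def algebra_simps)
qed

text \<open>The linear growth of \<open>x n powr (- 1/\<alpha>)\<close> is summed and inverted.
  Monotonicity makes all terms before a positive one positive, so the negative powers are meaningful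
  up to \<open>n\<close>.\<close>

lemma polynomial_decay:
  fixes x :: "nat \<Rightarrow> real"
  assumes nonneg: "\<And>n. x n \<ge> 0" and \<alpha>: "\<alpha> > 0" and c: "c > 0" and n: "n \<ge> 1"
    and step: "\<And>n. x n > 0 \<Longrightarrow> x (Suc n) \<le> x n - c * x n powr (1 + 1/\<alpha>)"
    and zero: "\<And>n. x (Suc n) \<le> x n"
  shows "x n \<le> (\<alpha> / c) powr \<alpha> * real n powr (- \<alpha>)"
proof (cases "x n > 0")
  case True
  have pos: "x m > 0" if "m \<le> n" for m
    using that True
  proof (induction rule: inc_induct)
    case (step k) then show ?case using zero[of k] by simp
  qed simp
  have "real m * (c / \<alpha>) \<le> x m powr (- 1/\<alpha>)" if "m \<le> n" for m
    using that
  proof (induction m)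
    case (Suc m)
    then have "x m powr (- 1/\<alpha>) + c / \<alpha> \<le> x (Suc m) powr (- 1/\<alpha>)"
      by (intro powr_neg_growth_step pos step \<alpha> c) auto
    moreover have "real m * (c / \<alpha>) \<le> x m powr (- 1/\<alpha>)" using Suc by simp
    ultimately show ?case by (simp add: ring_distribs add_divide_distrib)
  qed simp
  then have "real n * (c / \<alpha>) \<le> x n powr (- 1/\<alpha>)" by simp
  then have "(x n powr (- 1/\<alpha>)) powr (- \<alpha>) \<le> (real n * (c / \<alpha>)) powr (- \<alpha>)"
    using n c \<alpha> by (intro powr_mono2') auto
  also have "(x n powr (- 1/\<alpha>)) powr (- \<alpha>) = x n"
    using True \<alpha> by (simp add: powr_powr)
  also have "(real n * (c / \<alpha>)) powr (- \<alpha>) = (\<alpha> / c) powr \<alpha> * real n powr (- \<alpha>)"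
    using c \<alpha> n by (simp add: powr_mult powr_minus powr_divide field_simps)
  finally show ?thesis .
next
  case False
  then show ?thesis using nonneg[of n] by (simp add: order_antisym)
qed

text \<open>The scale is the first \<open>J\<close> at which the tail term is at most
  \<open>x / 2\<close>. Failure at the preceding scale bounds \<open>(1/4) ^ J\<close> from below.
  The denominator 8 combines a factor 4 for that one scale with a factor 2 for halving
  \<open>x\<close>.\<close>

lemma multiscale_drift:
  fixes x y C D \<alpha> :: real
  assumes x: "0 < x" "x \<le> 1" and D: "D > 0" and C: "C \<ge> 1" and \<alpha>: "\<alpha> > 0"
    and drift: "\<And>J::nat. D * (1/4) ^ J * (x - C * (4 powr (- \<alpha>)) ^ J) \<le> x - y"
  shows "y \<le> x - D / (8 * (2 * C) powr (1/\<alpha>)) * x powr (1 + 1/\<alpha>)"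
proof -
  let ?k = "4 powr (- \<alpha>) :: real"
  have k: "0 < ?k" "?k < 1" using \<alpha> by (auto simp: powr_less_one)
  have ex: "\<exists>J. ?k ^ J \<le> x / (2 * C)"
  proof -
    obtain J where "?k ^ J < x / (2 * C)" using real_arch_pow_inv[of "x / (2*C)" ?k] k x C by auto
    then show ?thesis by (auto intro: less_imp_le)
  qed
  define J where "J = (LEAST J. ?k ^ J \<le> x / (2 * C))"
  have J: "?k ^ J \<le> x / (2 * C)" unfolding J_def using ex by (rule LeastI_ex)
  \<comment> \<open>This excludes \<open>J = 0\<close>, so that a preceding scale exists.\<close>
  have "x / (2 * C) < 1" using x C by (simp add: field_simps)
  then have "J \<noteq> 0" using J by (cases J) auto
  then obtain i where i: "J = Suc i" by (cases J) auto
  have "\<not> ?k ^ i \<le> x / (2 * C)" using not_less_Least[of i "\<lambda>J. ?k ^ J \<le> x / (2 * C)"] i by (simp add: J_def)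
  then have "x / (2 * C) < ?k ^ i" by simp
  also have "?k ^ i = ((1/4) ^ i) powr \<alpha>"
    by (simp add: powr_power powr_minus_divide powr_divide[symmetric] power_one_over powr_realpow[symmetric] powr_powr mult.commute)
      (simp add: powr_divide powr_powr mult.commute)
  finally have "(x / (2 * C)) powr (1/\<alpha>) \<le> (((1/4) ^ i) powr \<alpha>) powr (1/\<alpha>)"
    using x C \<alpha> by (intro powr_mono2) auto
  also have "\<dots> = (1/4) ^ i" using \<alpha> by (simp add: powr_powr)
  finally have lower: "(x / (2 * C)) powr (1/\<alpha>) / 4 \<le> (1/4) ^ J" by (simp add: i)
  have "C * ?k ^ J \<le> x / 2" using J C by (simp add: field_simps)
  then have half: "x / 2 \<le> x - C * ?k ^ J" by simp
  have "D * ((x / (2 * C)) powr (1/\<alpha>) / 4) * (x / 2) \<le> D * (1/4) ^ J * (x - C * ?k ^ J)"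
    using D lower half x by (intro mult_mono) auto
  also have "\<dots> \<le> x - y" by (rule drift)
  finally have "D * ((x / (2 * C)) powr (1/\<alpha>) / 4) * (x / 2) \<le> x - y" .
  moreover have "D * ((x / (2 * C)) powr (1/\<alpha>) / 4) * (x / 2) = D / (8 * (2 * C) powr (1/\<alpha>)) * x powr (1 + 1/\<alpha>)"
    using x C by (simp add: powr_divide powr_add)
  ultimately show ?thesis by simp
qed

section \<open>The sampler for a general energy function\<close>

lemma AE_lborel_affine:
  fixes v :: "'a::euclidean_space"
  assumes c: "c \<noteq> 0" and [measurable]: "Measurable.pred borel T" and ae: "AE y in lborel. T y"
  shows "AE z in lborel. T (v + c *\<^sub>R z)"
proof -
  have "0 = (\<integral>\<^sup>+y. indicator {y. \<not> T y} y \<partial>lborel)"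
    using ae by (subst nn_integral_0_iff_AE[THEN iffD2]) (auto simp: indicator_def)
  also have "\<dots> = ennreal (\<bar>c\<bar> ^ DIM('a)) * (\<integral>\<^sup>+z. indicator {y. \<not> T y} (v + c *\<^sub>R z) \<partial>lborel)"
    using c by (intro nn_integral_lborel_affine) measurable
  finally have "(\<integral>\<^sup>+z. indicator {y. \<not> T y} (v + c *\<^sub>R z) \<partial>lborel) = (0::ennreal)"
    using zero_less_power[of "\<bar>c\<bar>" "DIM('a)"] c by (auto simp: ennreal_eq_0_iff dest: leD)
  then have "AE z in lborel. indicator {y. \<not> T y} (v + c *\<^sub>R z) = (0::ennreal)"
    by (subst (asm) nn_integral_0_iff_AE) auto
  then show ?thesis by (auto simp: indicator_def elim!: eventually_mono split: if_splits)
qed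

text \<open>In \<open>ereal\<close> the square of either infinity is infinite, and a sum with an
  infinite term is infinite. So both essential suprema are real.\<close>

lemma osc_norm_finiteE:
  assumes "f \<in> borel_measurable M" and fin: "(osc_norm M f)\<^sup>2 < \<infinity>"
  obtains lo hi where "AE x in M. lo \<le> f x" "AE x in M. f x \<le> hi" "osc_norm M f = ereal (hi - lo)"
proof -
  let ?S = "esssup M (\<lambda>x. ereal (f x))" and ?T = "esssup M (\<lambda>x. - ereal (f x))"
  have "\<bar>?S + ?T\<bar> \<noteq> \<infinity>"
    using fin unfolding osc_norm_def by (cases ?S; cases ?T) (auto simp: power2_eq_square)
  then obtain hi m where S: "?S = ereal hi" and T: "?T = ereal m"
    by (cases ?S; cases ?T) auto
  have "AE x in M. - m \<le> f x" using esssup_AE[where M=M and f="\<lambda>x. - ereal (f x)"] unfolding T by (auto elim!: eventually_mono)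
  moreover have "AE x in M. f x \<le> hi" using esssup_AE[where M=M and f="\<lambda>x. ereal (f x)"] unfolding S by simp
  moreover have "osc_norm M f = ereal (hi - - m)" unfolding osc_norm_def S T by simp
  ultimately show ?thesis by (rule that)
qed

lemma gamma_density_nonneg: "a > 0 \<Longrightarrow> gamma_density a b t \<ge> 0"
  by (auto simp: gamma_density_def intro!: mult_nonneg_nonneg divide_nonneg_pos Gamma_real_pos)

lemma gamma_density_measurable[measurable (raw)]:
  assumes [measurable]: "f \<in> borel_measurable N" "g \<in> borel_measurable N"
  shows "(\<lambda>x. gamma_density a (f x) (g x)) \<in> borel_measurable N"
  unfolding gamma_density_def by measurable

lemma nn_integral_gamma_density:
  assumes a: "a > 0" and b: "b > 0"
  shows "(\<integral>\<^sup>+t. ennreal (gamma_density a b t) \<partial>lborel) = 1"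
proof -
  let ?f = "\<lambda>t. ennreal (indicator {0..} t * t powr (a - 1) / exp t)"
  have G: "Gamma a > 0" using a by (rule Gamma_real_pos)
  have "ennreal (Gamma a) = (\<integral>\<^sup>+t. ?f t \<partial>lborel)"
    by (rule Gamma_conv_nn_integral_real) fact
  also have "\<dots> = ennreal \<bar>b\<bar> * (\<integral>\<^sup>+t. ?f (0 + b * t) \<partial>lborel)"
    using b by (intro nn_integral_real_affine) auto
  also have "\<dots> = (\<integral>\<^sup>+t. ennreal b * ?f (b * t) \<partial>lborel)"
    using b by (simp add: nn_integral_cmult)
  also have "\<dots> = (\<integral>\<^sup>+t. ennreal (Gamma a) * ennreal (gamma_density a b t) \<partial>lborel)"
  proof (intro nn_integral_cong_AE)
    have "AE t in lborel. t \<noteq> (0::real)" by (rule AE_lborel_singleton)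
    then show "AE t in lborel. ennreal b * ?f (b * t) = ennreal (Gamma a) * ennreal (gamma_density a b t)"
    proof eventually_elim
      case (elim t)
      show ?case
      proof (cases "t > 0")
        case True
        have "b * (b * t) powr (a - 1) = b powr a * t powr (a - 1)"
          using b True by (simp add: powr_mult powr_diff)
        then have "b * (indicator {0..} (b * t) * (b * t) powr (a - 1) / exp (b * t)) = Gamma a * gamma_density a b t"
          using True b G by (simp add: gamma_density_def exp_minus field_simps)
        then show ?thesis using b G True a
          by (subst (1 2) ennreal_mult[symmetric]) (auto simp: gamma_density_nonneg)
      next
        case False
        then show ?thesis using elim b by (auto simp: gamma_density_def indicator_def zero_le_mult_iff)
      qed
    qed
  qed
  also have "\<dots> = ennreal (Gamma a) * (\<integral>\<^sup>+t. ennreal (gamma_density a b t) \<partial>lborel)"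
    by (simp add: nn_integral_cmult)
  finally have "ennreal (Gamma a) * 1 = ennreal (Gamma a) * (\<integral>\<^sup>+t. ennreal (gamma_density a b t) \<partial>lborel)" by simp
  then show ?thesis using G by (subst (asm) ennreal_mult_cancel_left) auto
qed

lemma prob_space_gamma_measure: "a > 0 \<Longrightarrow> b > 0 \<Longrightarrow> prob_space (gamma_measure a b)"
  by (intro prob_spaceI) (simp add: gamma_measure_def emeasure_density nn_integral_gamma_density)

lemma sets_gamma_measure[simp, measurable_cong]: "sets (gamma_measure a b) = sets borel"
  by (simp add: gamma_measure_def)

lemma space_gamma_measure[simp]: "space (gamma_measure a b) = UNIV"
  by (simp add: gamma_measure_def)

text \<open>Laplace transform of the Gamma law at a multiple of its own rate; the rate cancels by
  scaling. This turns acceptance bounds depending on \<open>t\<close> and \<open>E x\<close> into a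
  constant independent of the state.\<close>

lemma nn_integral_gamma_exp:
  assumes a: "a > 0" and b: "b > 0" and k: "k \<ge> 0"
  shows "(\<integral>\<^sup>+t. ennreal (gamma_density a b t) * ennreal (exp (- t * (k * b))) \<partial>lborel) = ennreal ((1 + k) powr (- a))"
proof -
  have "(\<integral>\<^sup>+t. ennreal (gamma_density a b t) * ennreal (exp (- t * (k * b))) \<partial>lborel)
     = (\<integral>\<^sup>+t. ennreal ((1 + k) powr (- a)) * ennreal (gamma_density a ((1 + k) * b) t) \<partial>lborel)"
  proof (intro nn_integral_cong)
    fix t :: real
    have "gamma_density a b t * exp (- t * (k * b)) = (1 + k) powr (- a) * gamma_density a ((1 + k) * b) t"
    proof (cases "t > 0")
      case True
      have e: "exp (- b * t) * exp (- t * (k * b)) = exp (- ((1 + k) * b) * t)"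
        by (simp add: exp_add[symmetric] algebra_simps)
      have p: "(1 + k) powr (- a) * ((1 + k) * b) powr a = b powr a"
        using b k by (simp add: powr_mult powr_minus)
      have "gamma_density a b t * exp (- t * (k * b))
         = b powr a / Gamma a * t powr (a - 1) * (exp (- b * t) * exp (- t * (k * b)))"
        using True by (simp add: gamma_density_def)
      also have "\<dots> = ((1 + k) powr (- a) * ((1 + k) * b) powr a) / Gamma a * t powr (a - 1) * exp (- ((1 + k) * b) * t)"
        unfolding e p ..
      also have "\<dots> = (1 + k) powr (- a) * gamma_density a ((1 + k) * b) t"
        using True by (simp add: gamma_density_def)
      finally show ?thesis .
    qed (simp add: gamma_density_def)
    then show "ennreal (gamma_density a b t) * ennreal (exp (- t * (k * b)))
      = ennreal ((1 + k) powr (- a)) * ennreal (gamma_density a ((1 + k) * b) t)"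
      using a by (simp add: ennreal_mult'[symmetric] gamma_density_nonneg)
  qed
  also have "\<dots> = ennreal ((1 + k) powr (- a))"
    using b k a by (simp add: nn_integral_cmult nn_integral_gamma_density)
  finally show ?thesis .
qed

lemma (in prob_space) expectation_square_le:
  fixes X :: "'a \<Rightarrow> real"
  assumes "X \<in> borel_measurable M" "\<And>x. \<bar>X x\<bar> \<le> B"
  shows "(expectation X)\<^sup>2 \<le> expectation (\<lambda>x. (X x)\<^sup>2)"
proof -
  have [simp]: "integrable M X" using assms by (intro integrable_const_bound[of _ B]) auto
  have "(X x)\<^sup>2 \<le> B\<^sup>2" for x using power_mono[OF assms(2), of x 2] by simp
  then have [simp]: "integrable M (\<lambda>x. (X x)\<^sup>2)" using assms by (intro integrable_const_bound[of _ "B\<^sup>2"]) auto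
  show ?thesis using variance_eq[of X] variance_positive[of X] by simp
qed

lemma (in prob_space) expectation_bounds:
  fixes X :: "'a \<Rightarrow> real"
  assumes "X \<in> borel_measurable M" "\<And>x. x \<in> space M \<Longrightarrow> lo \<le> X x" "\<And>x. x \<in> space M \<Longrightarrow> X x \<le> hi"
  shows "integrable M X" "lo \<le> expectation X" "expectation X \<le> hi"
proof -
  show i: "integrable M X"
  proof (intro integrable_const_bound[of _ "\<bar>lo\<bar> + \<bar>hi\<bar>"] AE_I2 assms(1))
    fix x assume "x \<in> space M"
    from assms(2,3)[OF this] show "norm (X x) \<le> \<bar>lo\<bar> + \<bar>hi\<bar>" by auto
  qed
  show "lo \<le> expectation X" using assms i by (intro integral_ge_const) auto
  show "expectation X \<le> hi" using assms i by (intro integral_le_const) auto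
qed

section \<open>The abstract sampler and its operators\<close>

text \<open>The unnormalized joint density is \<open>t powr (\<alpha> - 1) * exp (- t * E x)\<close>
  on \<open>t > 0\<close>: \<open>E\<close> is both the rate of the Gamma conditional and the
  potential of the conditional of \<open>x\<close>. Quadratic bounds on \<open>E\<close> give a
  marginal of order \<open>norm x\<close> to the power \<open>- 2 * \<alpha>\<close>, and the
  condition on \<alpha> makes it integrable. \<open>q\<close> is the density of a symmetric
  proposal, bounded below on the unit ball.\<close>

locale metropolis_within_gibbs =
  fixes E q :: "'a::euclidean_space \<Rightarrow> real" and \<alpha> s e1 e2 q0 :: real
  assumes E_meas[measurable]: "E \<in> borel_measurable borel"
    and e1: "e1 > 0"
    and E_lower: "e1 * (1 + (norm x)\<^sup>2) \<le> E x"
    and E_upper: "E x \<le> e2 * (1 + (norm x)\<^sup>2)"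
    and q_meas[measurable]: "q \<in> borel_measurable borel"
    and q_nonneg: "q z \<ge> 0"
    and q_even: "q (- z) = q z"
    and q_mass: "(\<integral>\<^sup>+z. ennreal (q z) \<partial>lborel) = 1"
    and q0: "q0 > 0" and q_lower: "norm z \<le> 1 \<Longrightarrow> q0 \<le> q z"
    and s: "s > 0"
    and \<alpha>: "\<alpha> > DIM('a) / 2"
begin

lemma E_pos: "E x > 0"
proof -
  have "0 < e1 * (1 + (norm x)\<^sup>2)" using e1 by (intro mult_pos_pos) (auto simp: add_pos_nonneg)
  then show ?thesis using E_lower[of x] by simp
qed

lemma e2: "e2 > 0"
  using E_pos[of 0] E_upper[of 0] by simp

lemma \<alpha>_pos: "\<alpha> > 0"
  using \<alpha> DIM_positive[where 'a='a] by (smt (verit) divide_nonneg_nonneg of_nat_0_le_iff)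

text \<open>The unnormalized marginal density of \<open>x\<close>: integrating out \<open>t\<close>
  from \<open>t powr (\<alpha> - 1) * exp (- t * E x)\<close> gives it up to the factor
  \<open>Gamma \<alpha>\<close>.\<close>

definition W :: "'a \<Rightarrow> real" where "W x = E x powr (- \<alpha>)"

lemma W_meas[measurable]: "W \<in> borel_measurable borel"
  unfolding W_def by measurable

lemma W_pos: "W x > 0"
  using E_pos[of x] by (simp add: W_def)

definition Q :: "'a measure" where "Q = density lborel (\<lambda>z. ennreal (q z))"

lemma sets_Q[simp, measurable_cong]: "sets Q = sets borel"
  by (simp add: Q_def)

lemma space_Q[simp]: "space Q = UNIV"
  by (simp add: Q_def)

sublocale Q: prob_space Q
  by (intro prob_spaceI) (simp add: Q_def emeasure_density q_mass)

sublocale \<Gamma>: prob_space "gamma_measure \<alpha> (E x)" for x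
  using \<alpha>_pos E_pos by (rule prob_space_gamma_measure)

text \<open>
  At \<open>t = 0\<close> the covariance \<open>1 / t\<close> is 0 and the ratio of target densities is \<open>0 / 0 = 0\<close>, so the
  original kernel rejects every proposal there.
\<close>

definition acc :: "real \<Rightarrow> 'a \<Rightarrow> 'a \<Rightarrow> real" where
  "acc t x y = (if t = 0 then 0 else min 1 (exp (t * (E x - E y))))"

lemma acc_bounds: "0 \<le> acc t x y" "acc t x y \<le> 1"
  by (auto simp: acc_def)

lemma acc_meas[measurable (raw)]:
  assumes [measurable]: "f \<in> borel_measurable N" "g \<in> borel_measurable N" "h \<in> borel_measurable N"
  shows "(\<lambda>x. acc (f x) (g x) (h x)) \<in> borel_measurable N"
  unfolding acc_def by measurable

definition K :: "real \<Rightarrow> ('a \<Rightarrow> real) \<Rightarrow> 'a \<Rightarrow> real" where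
  "K t \<phi> x = (LINT z|Q. acc t x (x + s *\<^sub>R z) * \<phi> (x + s *\<^sub>R z) + (1 - acc t x (x + s *\<^sub>R z)) * \<phi> x)"

definition H :: "(real \<times> 'a \<Rightarrow> real) \<Rightarrow> real \<times> 'a \<Rightarrow> real" where
  "H f = (\<lambda>(t, x). K t (\<lambda>y. f (t, y)) x)"

definition P :: "(real \<times> 'a \<Rightarrow> real) \<Rightarrow> real \<times> 'a \<Rightarrow> real" where
  "P f = (\<lambda>(t, x). LINT t'|gamma_measure \<alpha> (E x). H f (t', x))"

text \<open>\<open>P\<close> sends every function to one that is constant in \<open>t\<close>, and
  on such functions it acts as \<open>R\<close>. After one step the analysis thus takes place in the
  space of \<open>x\<close> alone.\<close>

definition R :: "('a \<Rightarrow> real) \<Rightarrow> 'a \<Rightarrow> real" where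
  "R g x = (LINT t|gamma_measure \<alpha> (E x). K t g x)"

lemma H_meas:
  assumes "f \<in> borel_measurable borel"
  shows "H f \<in> borel_measurable borel"
proof -
  have [measurable]: "f \<in> borel_measurable (borel \<Otimes>\<^sub>M borel)" using assms by (simp add: borel_prod)
  have "(\<lambda>p. LINT z|Q. acc (fst p) (snd p) (snd p + s *\<^sub>R z) * f (fst p, snd p + s *\<^sub>R z)
      + (1 - acc (fst p) (snd p) (snd p + s *\<^sub>R z)) * f (fst p, snd p)) \<in> borel_measurable (borel \<Otimes>\<^sub>M borel)"
    by (rule Q.borel_measurable_lebesgue_integral) measurable
  then show ?thesis
    by (simp add: H_def K_def case_prod_unfold borel_prod)
qed

lemma K_meas[measurable (raw)]:
  assumes [measurable]: "g \<in> borel_measurable borel" "f \<in> borel_measurable N" "h \<in> borel_measurable N"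
  shows "(\<lambda>x. K (f x) g (h x)) \<in> borel_measurable N"
proof -
  have [measurable]: "H (\<lambda>(t, x). g x) \<in> borel_measurable (borel \<Otimes>\<^sub>M borel)"
    using H_meas[of "\<lambda>(t, x). g x"] by (simp add: borel_prod[symmetric])
  have "(\<lambda>x. H (\<lambda>(t, x). g x) (f x, h x)) \<in> borel_measurable N" by measurable
  then show ?thesis by (simp add: H_def)
qed

lemma integral_gamma_measure:
  assumes [measurable]: "f \<in> borel_measurable borel"
  shows "(LINT t|gamma_measure \<alpha> b. f t) = (LINT t|lborel. gamma_density \<alpha> b t * f t)"
  unfolding gamma_measure_def using \<alpha>_pos
  by (subst integral_density) (auto simp: gamma_density_nonneg)

text \<open>The Gamma measure varies with \<open>x\<close>; moving its density into the integrand
  leaves a parameter integral over a fixed measure.\<close>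

lemma P_meas_aux:
  assumes "f \<in> borel_measurable borel"
  shows "(\<lambda>x. LINT t|gamma_measure \<alpha> (E x). H f (t, x)) \<in> borel_measurable borel"
proof -
  have [measurable]: "H f \<in> borel_measurable (borel \<Otimes>\<^sub>M borel)" using H_meas[OF assms] by (simp add: borel_prod)
  have "(\<lambda>x. LINT t|lborel. gamma_density \<alpha> (E x) t * H f (t, x)) \<in> borel_measurable borel"
    by (rule lborel.borel_measurable_lebesgue_integral) measurable
  then show ?thesis by (subst integral_gamma_measure) auto
qed

lemma R_eq: "R g = (\<lambda>x. LINT t|gamma_measure \<alpha> (E x). H (\<lambda>(t, x). g x) (t, x))"
  by (simp add: R_def H_def fun_eq_iff)

lemma R_meas[measurable]:
  assumes [measurable]: "g \<in> borel_measurable borel"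
  shows "R g \<in> borel_measurable borel"
  unfolding R_eq by (intro P_meas_aux) (simp add: borel_prod[symmetric])

lemma mix_bounds:
  assumes "lo \<le> a" "a \<le> hi" "lo \<le> b" "b \<le> hi" "0 \<le> c" "c \<le> (1::real)"
  shows "lo \<le> c * a + (1 - c) * b" "c * a + (1 - c) * b \<le> hi"
  using convex_bound_le[of a hi b c "1 - c"] convex_bound_le[of "- a" "- lo" "- b" c "1 - c"] assms
  by (auto simp: algebra_simps)

lemma K_bounds:
  assumes [measurable]: "g \<in> borel_measurable borel" and b: "\<And>x. lo \<le> g x" "\<And>x. g x \<le> hi"
  shows "integrable Q (\<lambda>z. acc t x (x + s *\<^sub>R z) * g (x + s *\<^sub>R z) + (1 - acc t x (x + s *\<^sub>R z)) * g x)"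
    and "lo \<le> K t g x" "K t g x \<le> hi"
proof -
  let ?X = "\<lambda>z. acc t x (x + s *\<^sub>R z) * g (x + s *\<^sub>R z) + (1 - acc t x (x + s *\<^sub>R z)) * g x"
  have m: "?X \<in> borel_measurable Q" by measurable
  have X: "lo \<le> ?X z" "?X z \<le> hi" for z by (rule mix_bounds[OF b b acc_bounds])+
  show "integrable Q ?X" "lo \<le> K t g x" "K t g x \<le> hi"
    unfolding K_def using Q.expectation_bounds[OF m X] by auto
qed

lemma R_bounds:
  assumes [measurable]: "g \<in> borel_measurable borel" and b: "\<And>x. lo \<le> g x" "\<And>x. g x \<le> hi"
  shows "lo \<le> R g x" "R g x \<le> hi"
proof -
  have m: "(\<lambda>t. K t g x) \<in> borel_measurable (gamma_measure \<alpha> (E x))" by measurable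
  show "lo \<le> R g x" "R g x \<le> hi"
    unfolding R_def using \<Gamma>.expectation_bounds[OF m K_bounds(2,3)[OF assms]] by auto
qed

section \<open>Stationarity\<close>

lemma ennreal_K:
  assumes [measurable]: "g \<in> borel_measurable borel" and b: "\<And>x. 0 \<le> g x" "\<And>x. g x \<le> hi"
  shows "ennreal (K t g x) = (\<integral>\<^sup>+z. ennreal (q z) * (ennreal (acc t x (x + s *\<^sub>R z)) * ennreal (g (x + s *\<^sub>R z))
      + ennreal (1 - acc t x (x + s *\<^sub>R z)) * ennreal (g x)) \<partial>lborel)"
proof -
  have "ennreal (K t g x) = (\<integral>\<^sup>+z. ennreal (acc t x (x + s *\<^sub>R z) * g (x + s *\<^sub>R z) + (1 - acc t x (x + s *\<^sub>R z)) * g x) \<partial>Q)"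
    unfolding K_def using K_bounds(1)[OF assms] acc_bounds b
    by (intro nn_integral_eq_integral[symmetric]) (auto intro!: AE_I2 add_nonneg_nonneg mult_nonneg_nonneg)
  also have "\<dots> = (\<integral>\<^sup>+z. ennreal (q z) * ennreal (acc t x (x + s *\<^sub>R z) * g (x + s *\<^sub>R z) + (1 - acc t x (x + s *\<^sub>R z)) * g x) \<partial>lborel)"
    unfolding Q_def by (subst nn_integral_density) auto
  also have "\<dots> = (\<integral>\<^sup>+z. ennreal (q z) * (ennreal (acc t x (x + s *\<^sub>R z)) * ennreal (g (x + s *\<^sub>R z))
      + ennreal (1 - acc t x (x + s *\<^sub>R z)) * ennreal (g x)) \<partial>lborel)"
    using acc_bounds b by (intro nn_integral_cong) (simp add: ennreal_plus ennreal_mult)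
  finally show ?thesis .
qed

text \<open>Detailed balance: \<open>exp (- t * E x) * acc t x y = exp (- t * max (E x) (E y))\<close> is symmetric.\<close>

lemma stationary_fixed:
  assumes [measurable]: "g \<in> borel_measurable borel" and b: "\<And>x. 0 \<le> g x" "\<And>x. g x \<le> hi" and t: "t > 0"
  shows "(\<integral>\<^sup>+x. ennreal (exp (- t * E x)) * ennreal (K t g x) \<partial>lborel)
    = (\<integral>\<^sup>+x. ennreal (exp (- t * E x)) * ennreal (g x) \<partial>lborel)"
proof -
  define \<pi> where "\<pi> x = ennreal (exp (- t * E x))" for x
  define m where "m x y = ennreal (exp (- t * max (E x) (E y)))" for x y
  have [measurable]: "\<pi> \<in> borel_measurable borel" unfolding \<pi>_def by measurable
  have m_meas[measurable (raw)]: "(\<lambda>x. m (f x) (h x)) \<in> borel_measurable N"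
    if [measurable]: "f \<in> borel_measurable N" "h \<in> borel_measurable N" for f h :: "'z \<Rightarrow> 'a" and N
    unfolding m_def by measurable
  have sym: "m x y = m y x" for x y by (simp add: m_def max.commute)
  have bal: "\<pi> x * ennreal (acc t x y) = m x y" for x y
  proof -
    have "exp (- t * E x) * acc t x y = exp (- t * max (E x) (E y))"
      using t by (auto simp: acc_def max_def min_def exp_add[symmetric] algebra_simps mult_le_cancel_left)
    then show ?thesis by (simp add: \<pi>_def m_def ennreal_mult[symmetric] acc_bounds)
  qed
  \<comment> \<open>Exchanging the two ends of a move: shift \<open>x\<close> by the move, then
    reflect \<open>z\<close>. The first uses translation invariance and the symmetry of
    \<open>m\<close>, the second that the proposal density is even.\<close>
  have swap: "(\<integral>\<^sup>+x. \<integral>\<^sup>+z. ennreal (q z) * (m x (x + s *\<^sub>R z) * ennreal (g (x + s *\<^sub>R z))) \<partial>lborel \<partial>lborel)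
     = (\<integral>\<^sup>+x. \<integral>\<^sup>+z. ennreal (q z) * (m x (x + s *\<^sub>R z) * ennreal (g x)) \<partial>lborel \<partial>lborel)" (is "?L = ?R")
  proof -
    have "?L = (\<integral>\<^sup>+z. \<integral>\<^sup>+x. ennreal (q z) * (m x (x + s *\<^sub>R z) * ennreal (g (x + s *\<^sub>R z))) \<partial>lborel \<partial>lborel)"
      by (rule lborel_pair.Fubini') measurable
    also have "\<dots> = (\<integral>\<^sup>+z. \<integral>\<^sup>+x. ennreal (q z) * (m x (x + s *\<^sub>R (- z)) * ennreal (g x)) \<partial>lborel \<partial>lborel)"
    proof (rule nn_integral_cong)
      fix z :: 'a
      have "(\<integral>\<^sup>+x. ennreal (q z) * (m (x + s *\<^sub>R (- z)) x * ennreal (g x)) \<partial>lborel)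
         = (\<integral>\<^sup>+x. ennreal (q z) * (m (x + s *\<^sub>R z + s *\<^sub>R (- z)) (x + s *\<^sub>R z) * ennreal (g (x + s *\<^sub>R z))) \<partial>lborel)"
        by (subst nn_integral_lborel_translate[where c="s *\<^sub>R z", symmetric]) auto
      then show "(\<integral>\<^sup>+x. ennreal (q z) * (m x (x + s *\<^sub>R z) * ennreal (g (x + s *\<^sub>R z))) \<partial>lborel)
         = (\<integral>\<^sup>+x. ennreal (q z) * (m x (x + s *\<^sub>R (- z)) * ennreal (g x)) \<partial>lborel)"
        by (subst sym[of _ "_ + s *\<^sub>R (- z)"]) simp
    qed
    also have "\<dots> = (\<integral>\<^sup>+z. \<integral>\<^sup>+x. ennreal (q (- z)) * (m x (x + s *\<^sub>R (- z)) * ennreal (g x)) \<partial>lborel \<partial>lborel)"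
      by (simp add: q_even)
    also have "\<dots> = (\<integral>\<^sup>+z. \<integral>\<^sup>+x. ennreal (q z) * (m x (x + s *\<^sub>R z) * ennreal (g x)) \<partial>lborel \<partial>lborel)"
      by (rule nn_integral_lborel_uminus[where f="\<lambda>z. \<integral>\<^sup>+x. ennreal (q z) * (m x (x + s *\<^sub>R z) * ennreal (g x)) \<partial>lborel"]) measurable
    also have "\<dots> = ?R"
      by (rule lborel_pair.Fubini') measurable
    finally show ?thesis .
  qed
  have "(\<integral>\<^sup>+x. \<pi> x * ennreal (K t g x) \<partial>lborel)
    = (\<integral>\<^sup>+x. \<integral>\<^sup>+z. ennreal (q z) * (m x (x + s *\<^sub>R z) * ennreal (g (x + s *\<^sub>R z)))
      + ennreal (q z) * (\<pi> x * ennreal (1 - acc t x (x + s *\<^sub>R z)) * ennreal (g x)) \<partial>lborel \<partial>lborel)"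
    by (subst ennreal_K[OF assms(1) b])
      (simp add: nn_integral_cmult[symmetric] bal[symmetric] ring_distribs ac_simps)
  also have "\<dots> = (\<integral>\<^sup>+x. \<integral>\<^sup>+z. ennreal (q z) * (m x (x + s *\<^sub>R z) * ennreal (g (x + s *\<^sub>R z))) \<partial>lborel \<partial>lborel)
      + (\<integral>\<^sup>+x. \<integral>\<^sup>+z. ennreal (q z) * (\<pi> x * ennreal (1 - acc t x (x + s *\<^sub>R z)) * ennreal (g x)) \<partial>lborel \<partial>lborel)"
    by (simp add: nn_integral_add)
  also have "\<dots> = (\<integral>\<^sup>+x. \<integral>\<^sup>+z. ennreal (q z) * (m x (x + s *\<^sub>R z) * ennreal (g x))
      + ennreal (q z) * (\<pi> x * ennreal (1 - acc t x (x + s *\<^sub>R z)) * ennreal (g x)) \<partial>lborel \<partial>lborel)"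
    unfolding swap by (simp add: nn_integral_add)
  also have "\<dots> = (\<integral>\<^sup>+x. \<integral>\<^sup>+z. ennreal (q z) * (\<pi> x * ennreal (g x)) \<partial>lborel \<partial>lborel)"
  proof (intro nn_integral_cong)
    fix x z
    have "ennreal (acc t x (x + s *\<^sub>R z)) + ennreal (1 - acc t x (x + s *\<^sub>R z)) = 1"
      using acc_bounds by (simp add: ennreal_plus[symmetric] del: ennreal_plus)
    then have "m x (x + s *\<^sub>R z) + \<pi> x * ennreal (1 - acc t x (x + s *\<^sub>R z)) = \<pi> x"
      unfolding bal[symmetric] by (simp add: distrib_left[symmetric])
    then show "ennreal (q z) * (m x (x + s *\<^sub>R z) * ennreal (g x))
      + ennreal (q z) * (\<pi> x * ennreal (1 - acc t x (x + s *\<^sub>R z)) * ennreal (g x)) = ennreal (q z) * (\<pi> x * ennreal (g x))"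
      by (simp add: distrib_left[symmetric] distrib_right[symmetric])
  qed
  also have "\<dots> = (\<integral>\<^sup>+x. \<pi> x * ennreal (g x) \<partial>lborel)"
    by (simp add: nn_integral_multc q_mass)
  finally show ?thesis by (simp add: \<pi>_def)
qed

text \<open>The powers of \<open>E x\<close> cancel, and what remains depends on \<open>x\<close>
  only through \<open>exp (- t * E x)\<close>, the target of the Metropolis step at fixed
  \<open>t\<close>.\<close>

lemma W_gamma_density:
  "W x * gamma_density \<alpha> (E x) t = (if t > 0 then t powr (\<alpha> - 1) / Gamma \<alpha> * exp (- t * E x) else 0)"
  using E_pos[of x] by (simp add: W_def gamma_density_def powr_minus field_simps)

text \<open>After exchanging the integrals, \<open>t\<close> is fixed and the claim holds slice by
  slice; slices with \<open>t \<le> 0\<close> carry no mass.\<close>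

lemma stationary:
  assumes "f \<in> borel_measurable borel" and b: "\<And>p. 0 \<le> f p" "\<And>p. f p \<le> hi"
  shows "(\<integral>\<^sup>+x. \<integral>\<^sup>+t. ennreal (W x * gamma_density \<alpha> (E x) t) * ennreal (H f (t, x)) \<partial>lborel \<partial>lborel)
    = (\<integral>\<^sup>+x. \<integral>\<^sup>+t. ennreal (W x * gamma_density \<alpha> (E x) t) * ennreal (f (t, x)) \<partial>lborel \<partial>lborel)"
proof -
  have [measurable]: "f \<in> borel_measurable (borel \<Otimes>\<^sub>M borel)" using assms by (simp add: borel_prod)
  have [measurable]: "H f \<in> borel_measurable (borel \<Otimes>\<^sub>M borel)" using H_meas assms by (simp add: borel_prod)
  have "(\<integral>\<^sup>+x. \<integral>\<^sup>+t. ennreal (W x * gamma_density \<alpha> (E x) t) * ennreal (H f (t, x)) \<partial>lborel \<partial>lborel)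
    = (\<integral>\<^sup>+t. \<integral>\<^sup>+x. ennreal (W x * gamma_density \<alpha> (E x) t) * ennreal (H f (t, x)) \<partial>lborel \<partial>lborel)"
    by (rule lborel_pair.Fubini') measurable
  also have "\<dots> = (\<integral>\<^sup>+t. \<integral>\<^sup>+x. ennreal (W x * gamma_density \<alpha> (E x) t) * ennreal (f (t, x)) \<partial>lborel \<partial>lborel)"
  proof (rule nn_integral_cong)
    fix t :: real
    show "(\<integral>\<^sup>+x. ennreal (W x * gamma_density \<alpha> (E x) t) * ennreal (H f (t, x)) \<partial>lborel)
      = (\<integral>\<^sup>+x. ennreal (W x * gamma_density \<alpha> (E x) t) * ennreal (f (t, x)) \<partial>lborel)"
    proof (cases "t > 0")
      case True
      define c where "c = t powr (\<alpha> - 1) / Gamma \<alpha>"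
      have c: "c \<ge> 0" using Gamma_real_pos[OF \<alpha>_pos] by (simp add: c_def)
      have eq: "ennreal (W x * gamma_density \<alpha> (E x) t) * y = ennreal c * (ennreal (exp (- t * E x)) * y)" for x y
        using True c by (simp add: W_gamma_density c_def[symmetric] ennreal_mult mult.assoc)
      show ?thesis
        unfolding eq using stationary_fixed[of "\<lambda>y. f (t, y)" hi t] b True
        by (simp add: nn_integral_cmult H_def)
    qed (simp add: W_gamma_density)
  qed
  also have "\<dots> = (\<integral>\<^sup>+x. \<integral>\<^sup>+t. ennreal (W x * gamma_density \<alpha> (E x) t) * ennreal (f (t, x)) \<partial>lborel \<partial>lborel)"
    by (rule lborel_pair.Fubini') measurable
  finally show ?thesis .
qed

section \<open>Squared norm lost in one step\<close>

text \<open>Growth factor of \<open>E\<close> under a displacement of length at most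
  \<open>s\<close>: \<open>2 + 2 * s\<^sup>2\<close> for \<open>1 + (norm x)\<^sup>2\<close>, and
  \<open>e2 / e1\<close> for the comparison of \<open>E\<close> with it.\<close>

definition \<kappa> :: real where "\<kappa> = (2 + 2 * s\<^sup>2) * e2 / e1"

lemma \<kappa>_pos: "\<kappa> > 0"
  using e1 e2 by (auto simp: \<kappa>_def intro!: divide_pos_pos mult_pos_pos add_pos_nonneg)

lemma E_shift:
  assumes "norm v \<le> s"
  shows "E (x + v) \<le> \<kappa> * E x"
proof -
  have "(norm (x + v))\<^sup>2 \<le> (norm x + s)\<^sup>2"
    using assms norm_triangle_ineq[of x v] by (intro power_mono) auto
  also have "\<dots> \<le> 2 * (norm x)\<^sup>2 + 2 * s\<^sup>2"
    using zero_le_power2[of "norm x - s"] by (simp add: power2_eq_square algebra_simps)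
  finally have "1 + (norm (x + v))\<^sup>2 \<le> (2 + 2 * s\<^sup>2) * (1 + (norm x)\<^sup>2)"
    by (simp add: algebra_simps add_nonneg_nonneg trans_le_add1)
       (smt (verit) mult_nonneg_nonneg zero_le_power2)
  then have "e2 * (1 + (norm (x + v))\<^sup>2) \<le> e2 * ((2 + 2 * s\<^sup>2) * (1 + (norm x)\<^sup>2))"
    using e2 by (intro mult_left_mono) auto
  then have "E (x + v) \<le> (2 + 2 * s\<^sup>2) * e2 / e1 * (e1 * (1 + (norm x)\<^sup>2))"
    using E_upper[of "x + v"] e1 by (simp add: mult.commute mult.left_commute)
  also have "\<dots> \<le> \<kappa> * E x"
    unfolding \<kappa>_def[symmetric] using \<kappa>_pos by (intro mult_left_mono E_lower) auto
  finally show ?thesis .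
qed

text \<open>A short move raises \<open>E\<close> by at most \<open>\<kappa> * E x\<close>. Since
  \<open>E x\<close> is also the Gamma rate of \<open>t\<close>, the exponent is of order one for
  typical \<open>t\<close>.\<close>

lemma acc_lower:
  assumes "t > 0" "norm z \<le> 1"
  shows "exp (- t * (\<kappa> * E x)) \<le> acc t x (x + s *\<^sub>R z)"
proof -
  have "norm (s *\<^sub>R z) \<le> s" using s assms by (simp add: mult_left_le)
  then have "E (x + s *\<^sub>R z) \<le> \<kappa> * E x" by (rule E_shift)
  then have "t * (E (x + s *\<^sub>R z) - E x) \<le> t * (\<kappa> * E x)"
    using assms E_pos[of x] by (intro mult_left_mono) auto
  moreover have "0 \<le> t * (\<kappa> * E x)" using assms \<kappa>_pos E_pos[of x] by simp
  ultimately show ?thesis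
    using assms by (simp add: acc_def algebra_simps)
qed

abbreviation B1 :: "'a set" where "B1 \<equiv> cball 0 1"

definition V1 :: real where "V1 = measure lborel B1"

lemma V1: "V1 > 0" "emeasure lborel B1 = ennreal V1"
  by (auto simp: V1_def content_cball_pos emeasure_eq_ennreal_measure emeasure_cball)

text \<open>Unnormalized variance of \<open>g\<close> over proposals from \<open>x\<close> in a ball
  of radius \<open>s\<close>, written with two independent copies so that no mean value
  occurs.\<close>

definition local_spread :: "('a \<Rightarrow> real) \<Rightarrow> 'a \<Rightarrow> ennreal" where
  "local_spread g x = (\<integral>\<^sup>+z\<in>B1. (\<integral>\<^sup>+z'\<in>B1. ennreal ((g (x + s *\<^sub>R z) - g (x + s *\<^sub>R z'))\<^sup>2) \<partial>lborel) \<partial>lborel)"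

lemma local_spread_meas[measurable]:
  assumes [measurable]: "g \<in> borel_measurable borel"
  shows "local_spread g \<in> borel_measurable borel"
proof -
  have [measurable]: "B1 \<in> sets borel" by simp
  show ?thesis unfolding local_spread_def by measurable
qed

text \<open>The centre \<open>k\<close> is arbitrary, which later allows the mean under the kernel.
  Splitting around \<open>k\<close> gives a factor 2 for each copy, and the other copy integrates to
  \<open>V1\<close>.\<close>

lemma local_spread_le:
  assumes [measurable]: "g \<in> borel_measurable borel"
  shows "local_spread g x \<le> ennreal (4 * V1) * (\<integral>\<^sup>+z\<in>B1. ennreal ((g (x + s *\<^sub>R z) - k)\<^sup>2) \<partial>lborel)"
proof -
  have [measurable]: "B1 \<in> sets borel" by simp
  define f where "f z = ennreal ((g (x + s *\<^sub>R z) - k)\<^sup>2)" for z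
  have [measurable]: "f \<in> borel_measurable borel" unfolding f_def by measurable
  define F where "F = (\<integral>\<^sup>+z\<in>B1. f z \<partial>lborel)"
  have pt: "ennreal ((a - b)\<^sup>2) \<le> 2 * ennreal ((a - k)\<^sup>2) + 2 * ennreal ((b - k)\<^sup>2)" for a b
  proof -
    have "(a - b)\<^sup>2 \<le> 2 * (a - k)\<^sup>2 + 2 * (b - k)\<^sup>2"
      using zero_le_power2[of "(a - k) + (b - k)"] by (simp add: power2_eq_square algebra_simps)
    then have "ennreal ((a - b)\<^sup>2) \<le> ennreal (2 * (a - k)\<^sup>2 + 2 * (b - k)\<^sup>2)" by (rule ennreal_leI)
    then show ?thesis by (simp add: ennreal_mult')
  qed
  have "local_spread g x \<le> (\<integral>\<^sup>+z\<in>B1. (\<integral>\<^sup>+z'\<in>B1. (2 * f z + 2 * f z') \<partial>lborel) \<partial>lborel)"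
    unfolding local_spread_def f_def by (intro nn_integral_mono mult_right_mono pt) auto
  also have "\<dots> = (\<integral>\<^sup>+z. 2 * ennreal V1 * (f z * indicator B1 z) + 2 * F * indicator B1 z \<partial>lborel)"
  proof (rule nn_integral_cong)
    fix z
    have "(\<integral>\<^sup>+z'\<in>B1. (2 * f z + 2 * f z') \<partial>lborel)
      = (\<integral>\<^sup>+z'. 2 * f z * indicator B1 z' + 2 * (f z' * indicator B1 z') \<partial>lborel)"
      by (simp add: distrib_right mult.assoc)
    also have "\<dots> = 2 * f z * ennreal V1 + 2 * F"
      by (simp add: nn_integral_add nn_integral_cmult nn_integral_cmult_indicator V1(2) F_def)
    finally show "(\<integral>\<^sup>+z'\<in>B1. (2 * f z + 2 * f z') \<partial>lborel) * indicator B1 z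
      = 2 * ennreal V1 * (f z * indicator B1 z) + 2 * F * indicator B1 z"
      by (simp only:) (auto simp: indicator_def ac_simps)
  qed
  also have "\<dots> = 2 * ennreal V1 * F + 2 * F * ennreal V1"
    by (simp add: nn_integral_add nn_integral_cmult nn_integral_cmult_indicator V1(2) F_def)
  also have "\<dots> = ((2 + 2) * ennreal V1) * F"
    unfolding distrib_right by (simp only: ac_simps)
  also have "(2 + 2 :: ennreal) = 4" by simp
  also have "4 * ennreal V1 = ennreal (4 * V1)" by (simp add: ennreal_mult')
  finally show ?thesis by (simp add: F_def f_def)
qed

lemma K_square_centered:
  assumes [measurable]: "g \<in> borel_measurable borel" and b: "\<And>x. \<bar>g x\<bar> \<le> hi"
  shows "K t (\<lambda>y. (g y - k)\<^sup>2) x = K t (\<lambda>y. (g y)\<^sup>2) x - 2 * k * K t g x + k\<^sup>2"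
proof -
  let ?a = "\<lambda>z. acc t x (x + s *\<^sub>R z)"
  have b': "- hi \<le> g y" "g y \<le> hi" for y using b[of y] by auto
  have sq: "0 \<le> (g y)\<^sup>2" "(g y)\<^sup>2 \<le> hi\<^sup>2" for y using power_mono[OF b, of y 2] by auto
  have i1: "integrable Q (\<lambda>z. ?a z * (g (x + s *\<^sub>R z))\<^sup>2 + (1 - ?a z) * (g x)\<^sup>2)"
    using K_bounds(1)[where g="\<lambda>y. (g y)\<^sup>2", OF _ sq] by simp
  have i2: "integrable Q (\<lambda>z. ?a z * g (x + s *\<^sub>R z) + (1 - ?a z) * g x)"
    using K_bounds(1)[where g=g, OF _ b'] by simp
  have "K t (\<lambda>y. (g y - k)\<^sup>2) x = (LINT z|Q. (?a z * (g (x + s *\<^sub>R z))\<^sup>2 + (1 - ?a z) * (g x)\<^sup>2)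
      - 2 * k * (?a z * g (x + s *\<^sub>R z) + (1 - ?a z) * g x) + k\<^sup>2)"
    unfolding K_def by (intro Bochner_Integration.integral_cong refl) (simp add: power2_eq_square algebra_simps)
  also have "\<dots> = K t (\<lambda>y. (g y)\<^sup>2) x - 2 * k * K t g x + k\<^sup>2"
    unfolding K_def using i1 i2 Q.prob_space by simp
  finally show ?thesis .
qed

definition c0 :: real where "c0 = q0 / (4 * V1)"

lemma c0: "c0 > 0"
  using q0 V1 by (simp add: c0_def)

text \<open>The difference of \<open>K t\<close> applied to the square and the square of
  \<open>K t g x\<close> is the variance under the kernel. It is bounded below by accepted proposals
  in the unit ball alone; there the density is at least \<open>q0\<close>, and the constant
  \<open>c0\<close> absorbs the factor \<open>4 * V1\<close> of the spread.\<close>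

lemma variance_gain:
  assumes g[measurable]: "g \<in> borel_measurable borel" and b: "\<And>x. \<bar>g x\<bar> \<le> hi" and t: "t > 0"
  shows "ennreal ((K t g x)\<^sup>2) + ennreal c0 * ennreal (exp (- t * (\<kappa> * E x))) * local_spread g x
    \<le> ennreal (K t (\<lambda>y. (g y)\<^sup>2) x)"
proof -
  have [measurable]: "B1 \<in> sets borel" by simp
  define k where "k = K t g x"
  define e where "e = exp (- t * (\<kappa> * E x))"
  let ?I = "\<integral>\<^sup>+z\<in>B1. ennreal ((g (x + s *\<^sub>R z) - k)\<^sup>2) \<partial>lborel"
  have b': "- hi \<le> g y" "g y \<le> hi" for y using b[of y] by auto
  have k: "\<bar>k\<bar> \<le> hi" using K_bounds(2,3)[OF g b'] by (simp add: k_def abs_le_iff minus_le_iff)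
  have sq: "0 \<le> (g y - k)\<^sup>2" "(g y - k)\<^sup>2 \<le> (2 * hi)\<^sup>2" for y
  proof -
    have "\<bar>g y - k\<bar> \<le> 2 * hi" using b[of y] k by linarith
    from power_mono[OF this, of 2] show "(g y - k)\<^sup>2 \<le> (2 * hi)\<^sup>2" by simp
  qed simp
  have eq: "K t (\<lambda>y. (g y)\<^sup>2) x = K t (\<lambda>y. (g y - k)\<^sup>2) x + k\<^sup>2"
    unfolding K_square_centered[OF g b] by (simp add: k_def[symmetric] power2_eq_square)
  have "ennreal c0 * ennreal e * local_spread g x \<le> ennreal c0 * ennreal e * (ennreal (4 * V1) * ?I)"
    by (intro mult_left_mono local_spread_le) auto
  also have "\<dots> = ennreal (c0 * e * (4 * V1)) * ?I"
    using c0 V1 by (simp add: ennreal_mult e_def mult.assoc)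
  also have "c0 * e * (4 * V1) = q0 * e" using V1 by (simp add: c0_def)
  also have "ennreal (q0 * e) * ?I = (\<integral>\<^sup>+z. ennreal (q0 * e) * (ennreal ((g (x + s *\<^sub>R z) - k)\<^sup>2) * indicator B1 z) \<partial>lborel)"
    by (simp add: nn_integral_cmult)
  also have "\<dots> \<le> (\<integral>\<^sup>+z. ennreal (q z) * (ennreal (acc t x (x + s *\<^sub>R z)) * ennreal ((g (x + s *\<^sub>R z) - k)\<^sup>2)
      + ennreal (1 - acc t x (x + s *\<^sub>R z)) * ennreal ((g x - k)\<^sup>2)) \<partial>lborel)"
  proof (intro nn_integral_mono)
    fix z
    show "ennreal (q0 * e) * (ennreal ((g (x + s *\<^sub>R z) - k)\<^sup>2) * indicator B1 z)
     \<le> ennreal (q z) * (ennreal (acc t x (x + s *\<^sub>R z)) * ennreal ((g (x + s *\<^sub>R z) - k)\<^sup>2)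
      + ennreal (1 - acc t x (x + s *\<^sub>R z)) * ennreal ((g x - k)\<^sup>2))"
    proof (cases "z \<in> B1")
      case True
      then have "q0 * e \<le> q z * acc t x (x + s *\<^sub>R z)"
        unfolding e_def using q0 t by (intro mult_mono q_lower acc_lower) (auto simp: q_nonneg)
      then have "ennreal (q0 * e) * ennreal ((g (x + s *\<^sub>R z) - k)\<^sup>2)
        \<le> ennreal (q z * acc t x (x + s *\<^sub>R z)) * ennreal ((g (x + s *\<^sub>R z) - k)\<^sup>2)"
        by (intro mult_right_mono ennreal_leI) auto
      also have "\<dots> = ennreal (q z) * (ennreal (acc t x (x + s *\<^sub>R z)) * ennreal ((g (x + s *\<^sub>R z) - k)\<^sup>2))"
        by (simp add: ennreal_mult q_nonneg acc_bounds mult.assoc)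
      also have "\<dots> \<le> ennreal (q z) * (ennreal (acc t x (x + s *\<^sub>R z)) * ennreal ((g (x + s *\<^sub>R z) - k)\<^sup>2)
      + ennreal (1 - acc t x (x + s *\<^sub>R z)) * ennreal ((g x - k)\<^sup>2))"
        by (intro mult_left_mono) auto
      finally show ?thesis using True by simp
    qed simp
  qed
  also have "\<dots> = ennreal (K t (\<lambda>y. (g y - k)\<^sup>2) x)"
    by (rule ennreal_K[symmetric, OF _ sq]) simp
  finally have "ennreal c0 * ennreal e * local_spread g x \<le> ennreal (K t (\<lambda>y. (g y - k)\<^sup>2) x)" .
  then have "ennreal (k\<^sup>2) + ennreal c0 * ennreal e * local_spread g x \<le> ennreal (k\<^sup>2) + ennreal (K t (\<lambda>y. (g y - k)\<^sup>2) x)"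
    by (rule add_left_mono)
  also have "\<dots> = ennreal (K t (\<lambda>y. (g y)\<^sup>2) x)"
    unfolding eq using K_bounds(2)[OF _ sq] by (subst ennreal_plus[symmetric]) (auto simp: add.commute)
  finally show ?thesis by (simp add: k_def e_def)
qed

text \<open>With one proposal in the half ball and a relative displacement in the half ball, the
  second proposal stays in the unit ball; scaled by \<open>s\<close>, the displacements fill a ball
  of this radius.\<close>

definition r :: real where "r = s / 2"

text \<open>Three costs: \<open>\<kappa> powr (- \<alpha>)\<close> for moving the weight from
  \<open>x\<close> to the first proposal, the volume of the half ball in which that proposal is
  kept, and the Jacobian of scaling increments by \<open>s\<close>.\<close>

definition cS :: real where "cS = \<kappa> powr (- \<alpha>) * measure lborel (cball (0::'a) (1/2)) / s ^ DIM('a)"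

lemma cS: "cS > 0"
  using \<kappa>_pos s by (simp add: cS_def content_cball_pos)

lemma W_shift:
  assumes "norm v \<le> s"
  shows "\<kappa> powr (- \<alpha>) * W x \<le> W (x + v)"
proof -
  have "\<kappa> powr (- \<alpha>) * W x = (\<kappa> * E x) powr (- \<alpha>)"
    using \<kappa>_pos E_pos[of x] by (simp add: W_def powr_mult)
  also have "\<dots> \<le> E (x + v) powr (- \<alpha>)"
    using \<alpha>_pos E_pos E_shift[OF assms] by (intro powr_mono2') auto
  finally show ?thesis by (simp add: W_def)
qed

text \<open>Taking the first proposal \<open>y = x + s z\<close> as the new base point, the second
  one is \<open>y + s (z' - z)\<close>, an increment of \<open>y\<close>. The weight is then
  evaluated at \<open>y - s z\<close>, within distance \<open>s\<close> of \<open>y\<close>, and is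
  comparable to \<open>W y\<close>.\<close>

lemma local_spread_energy:
  assumes g[measurable]: "g \<in> borel_measurable borel"
  shows "ennreal cS * increment_energy W r g \<le> (\<integral>\<^sup>+x. ennreal (W x) * local_spread g x \<partial>lborel)"
proof -
  have B1[measurable]: "B1 \<in> sets borel" "cball (0::'a) (1/2) \<in> sets borel" "cball (0::'a) (s/2) \<in> sets borel" by simp_all
  define \<Phi> where "\<Phi> d = (\<integral>\<^sup>+y. ennreal (W y) * ennreal ((g y - g (y + d))\<^sup>2) \<partial>lborel)" for d
  have [measurable]: "\<Phi> \<in> borel_measurable borel" unfolding \<Phi>_def by measurable
  let ?v = "measure lborel (cball (0::'a) (1/2))"
  have v: "emeasure lborel (cball (0::'a) (1/2)) = ennreal ?v"
    by (simp add: emeasure_eq_ennreal_measure emeasure_cball)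
  define \<Psi> where "\<Psi> = (\<integral>\<^sup>+e\<in>cball 0 (1/2). \<Phi> (s *\<^sub>R e) \<partial>lborel)"
  have "increment_energy W r g = (\<integral>\<^sup>+d. \<Phi> d * indicator (cball 0 (s/2)) d \<partial>lborel)"
    by (simp add: increment_energy_def \<Phi>_def r_def)
  also have "\<dots> = ennreal (s ^ DIM('a)) * (\<integral>\<^sup>+e. \<Phi> (s *\<^sub>R e) * indicator (cball 0 (s/2)) (s *\<^sub>R e) \<partial>lborel)"
    using s by (subst nn_integral_lborel_affine[where c=s and v=0]) auto
  also have "(\<integral>\<^sup>+e. \<Phi> (s *\<^sub>R e) * indicator (cball 0 (s/2)) (s *\<^sub>R e) \<partial>lborel) = \<Psi>"
    unfolding \<Psi>_def using s by (intro nn_integral_cong) (auto simp: indicator_def field_simps)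
  finally have energy: "increment_energy W r g = ennreal (s ^ DIM('a)) * \<Psi>" .
  have "ennreal cS * increment_energy W r g = ennreal (\<kappa> powr (- \<alpha>)) * (ennreal ?v * \<Psi>)"
  proof -
    have "cS * s ^ DIM('a) = \<kappa> powr (- \<alpha>) * ?v" using s by (simp add: cS_def)
    then have "ennreal cS * ennreal (s ^ DIM('a)) = ennreal (\<kappa> powr (- \<alpha>)) * ennreal ?v"
      using s cS by (simp add: ennreal_mult[symmetric])
    then show ?thesis by (simp add: energy mult.assoc[symmetric])
  qed
  also have "ennreal ?v * \<Psi> = (\<integral>\<^sup>+z\<in>cball (0::'a) (1/2). \<Psi> \<partial>lborel)"
    by (simp add: nn_integral_cmult_indicator v mult.commute)
  also have "\<dots> \<le> (\<integral>\<^sup>+z\<in>B1. (\<integral>\<^sup>+z'\<in>B1. \<Phi> (s *\<^sub>R (z' - z)) \<partial>lborel) \<partial>lborel)"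
  proof (intro nn_integral_mono)
    fix z :: 'a
    have "\<Psi> \<le> (\<integral>\<^sup>+z'\<in>B1. \<Phi> (s *\<^sub>R (z' - z)) \<partial>lborel)" if z: "z \<in> cball 0 (1/2)"
    proof -
      have "\<Psi> \<le> (\<integral>\<^sup>+e. \<Phi> (s *\<^sub>R (e + z - z)) * indicator B1 (e + z) \<partial>lborel)"
        unfolding \<Psi>_def
      proof (intro nn_integral_mono)
        fix e :: 'a
        have "e + z \<in> B1" if "e \<in> cball 0 (1/2)" using z that norm_triangle_ineq[of e z] by simp
        then show "\<Phi> (s *\<^sub>R e) * indicator (cball 0 (1/2)) e \<le> \<Phi> (s *\<^sub>R (e + z - z)) * indicator B1 (e + z)"
          by (auto simp: indicator_def)
      qed
      also have "\<dots> = (\<integral>\<^sup>+z'. \<Phi> (s *\<^sub>R (z' - z)) * indicator B1 z' \<partial>lborel)"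
        by (rule nn_integral_lborel_translate) measurable
      finally show ?thesis .
    qed
    then show "\<Psi> * indicator (cball 0 (1/2)) z \<le> (\<integral>\<^sup>+z'\<in>B1. \<Phi> (s *\<^sub>R (z' - z)) \<partial>lborel) * indicator B1 z"
      by (auto simp: indicator_def)
  qed
  also have "ennreal (\<kappa> powr (- \<alpha>)) * \<dots>
     = (\<integral>\<^sup>+z\<in>B1. (\<integral>\<^sup>+z'\<in>B1. ennreal (\<kappa> powr (- \<alpha>)) * \<Phi> (s *\<^sub>R (z' - z)) \<partial>lborel) \<partial>lborel)"
    by (simp add: nn_integral_cmult mult.assoc)
  also have "\<dots> \<le> (\<integral>\<^sup>+z\<in>B1. (\<integral>\<^sup>+z'\<in>B1. (\<integral>\<^sup>+x. ennreal (W x) * ennreal ((g (x + s *\<^sub>R z) - g (x + s *\<^sub>R z'))\<^sup>2) \<partial>lborel) \<partial>lborel) \<partial>lborel)"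
  proof (intro nn_integral_mono)
    fix z :: 'a
    have "ennreal (\<kappa> powr (- \<alpha>)) * \<Phi> (s *\<^sub>R (z' - z))
      \<le> (\<integral>\<^sup>+x. ennreal (W x) * ennreal ((g (x + s *\<^sub>R z) - g (x + s *\<^sub>R z'))\<^sup>2) \<partial>lborel)" if z: "z \<in> B1" for z'
    proof -
      have "norm (- (s *\<^sub>R z)) \<le> s" using z s by (simp add: mult_left_le)
      then have "ennreal (\<kappa> powr (- \<alpha>)) * \<Phi> (s *\<^sub>R (z' - z))
        \<le> (\<integral>\<^sup>+y. ennreal (W (y + - (s *\<^sub>R z))) * ennreal ((g y - g (y + s *\<^sub>R (z' - z)))\<^sup>2) \<partial>lborel)"
        unfolding \<Phi>_def using W_pos \<kappa>_pos
        by (subst nn_integral_cmult[symmetric], simp)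
          (auto intro!: nn_integral_mono mult_right_mono ennreal_leI W_shift
            simp: mult.assoc[symmetric] ennreal_mult'[symmetric] simp del: add_uminus_conv_diff)
      also have "\<dots> = (\<integral>\<^sup>+x. ennreal (W (x + s *\<^sub>R z + - (s *\<^sub>R z))) * ennreal ((g (x + s *\<^sub>R z) - g (x + s *\<^sub>R z + s *\<^sub>R (z' - z)))\<^sup>2) \<partial>lborel)"
        by (subst nn_integral_lborel_translate[where c="s *\<^sub>R z", symmetric]) auto
      also have "\<dots> = (\<integral>\<^sup>+x. ennreal (W x) * ennreal ((g (x + s *\<^sub>R z) - g (x + s *\<^sub>R z'))\<^sup>2) \<partial>lborel)"
        by (intro nn_integral_cong) (simp add: algebra_simps)
      finally show ?thesis .
    qed
    then show "(\<integral>\<^sup>+z'\<in>B1. ennreal (\<kappa> powr (- \<alpha>)) * \<Phi> (s *\<^sub>R (z' - z)) \<partial>lborel) * indicator B1 z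
       \<le> (\<integral>\<^sup>+z'\<in>B1. (\<integral>\<^sup>+x. ennreal (W x) * ennreal ((g (x + s *\<^sub>R z) - g (x + s *\<^sub>R z'))\<^sup>2) \<partial>lborel) \<partial>lborel) * indicator B1 z"
      by (auto simp: indicator_def intro!: nn_integral_mono)
  qed
  also have "\<dots> = (\<integral>\<^sup>+z. \<integral>\<^sup>+z'. \<integral>\<^sup>+x. indicator B1 z * indicator B1 z' * (ennreal (W x) * ennreal ((g (x + s *\<^sub>R z) - g (x + s *\<^sub>R z'))\<^sup>2)) \<partial>lborel \<partial>lborel \<partial>lborel)"
    by (simp add: nn_integral_cmult[symmetric] nn_integral_multc[symmetric] ac_simps)
  also have "\<dots> = (\<integral>\<^sup>+z. \<integral>\<^sup>+x. \<integral>\<^sup>+z'. indicator B1 z * indicator B1 z' * (ennreal (W x) * ennreal ((g (x + s *\<^sub>R z) - g (x + s *\<^sub>R z'))\<^sup>2)) \<partial>lborel \<partial>lborel \<partial>lborel)"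
    by (intro nn_integral_cong lborel_pair.Fubini') measurable
  also have "\<dots> = (\<integral>\<^sup>+x. \<integral>\<^sup>+z. \<integral>\<^sup>+z'. indicator B1 z * indicator B1 z' * (ennreal (W x) * ennreal ((g (x + s *\<^sub>R z) - g (x + s *\<^sub>R z'))\<^sup>2)) \<partial>lborel \<partial>lborel \<partial>lborel)"
    by (intro lborel_pair.Fubini') measurable
  also have "\<dots> = (\<integral>\<^sup>+x. ennreal (W x) * local_spread g x \<partial>lborel)"
    unfolding local_spread_def by (simp add: nn_integral_cmult[symmetric] nn_integral_multc[symmetric] ac_simps)
  finally show ?thesis by (simp add: mult_left_mono)
qed

definition c1 :: real where "c1 = c0 * (1 + \<kappa>) powr (- \<alpha>) * cS"

lemma c1: "c1 > 0"
  using c0 cS \<kappa>_pos by (simp add: c1_def)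

text \<open>Jensen's inequality moves the square inside the Gamma average, the variance gain is
  averaged over \<open>t\<close> with the state-independent factor
  \<open>(1 + \<kappa>) powr (- \<alpha>)\<close>, and stationarity applied to the square of
  \<open>g\<close> returns its own norm.\<close>

lemma R_energy:
  assumes g[measurable]: "g \<in> borel_measurable borel" and b: "\<And>x. \<bar>g x\<bar> \<le> hi"
  shows "(\<integral>\<^sup>+x. ennreal (W x) * ennreal ((R g x)\<^sup>2) \<partial>lborel) + ennreal c1 * increment_energy W r g
    \<le> (\<integral>\<^sup>+x. ennreal (W x) * ennreal ((g x)\<^sup>2) \<partial>lborel)"
proof -
  let ?\<gamma> = "\<lambda>x t. gamma_density \<alpha> (E x) t"
  have b': "- hi \<le> g y" "g y \<le> hi" for y using b[of y] by auto
  have sq: "0 \<le> (g y)\<^sup>2" "(g y)\<^sup>2 \<le> hi\<^sup>2" for y using power_mono[OF b, of y 2] by auto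
  define e where "e x t = ennreal (?\<gamma> x t) * ennreal (exp (- t * (\<kappa> * E x)))" for x t
  have pt: "ennreal (W x) * ennreal ((R g x)\<^sup>2) + ennreal (c0 * (1 + \<kappa>) powr (- \<alpha>)) * (ennreal (W x) * local_spread g x)
    \<le> (\<integral>\<^sup>+t. ennreal (W x * ?\<gamma> x t) * ennreal (K t (\<lambda>y. (g y)\<^sup>2) x) \<partial>lborel)" for x
  proof -
    have Kb: "\<bar>K t g x\<bar> \<le> hi" for t using K_bounds(2,3)[OF g b', of t x] by (simp add: abs_le_iff)
    have Kb2: "(K t g x)\<^sup>2 \<le> hi\<^sup>2" for t using power_mono[OF Kb, of t 2] by simp
    have "ennreal ((R g x)\<^sup>2) \<le> ennreal (LINT t|gamma_measure \<alpha> (E x). (K t g x)\<^sup>2)"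
      unfolding R_def by (intro ennreal_leI \<Gamma>.expectation_square_le[where B=hi] Kb) measurable
    also have "\<dots> = (\<integral>\<^sup>+t. ennreal ((K t g x)\<^sup>2) \<partial>gamma_measure \<alpha> (E x))"
      using Kb2 by (intro nn_integral_eq_integral[symmetric] \<Gamma>.integrable_const_bound[where B="hi\<^sup>2"]) auto
    also have "\<dots> = (\<integral>\<^sup>+t. ennreal (?\<gamma> x t) * ennreal ((K t g x)\<^sup>2) \<partial>lborel)"
      unfolding gamma_measure_def by (subst nn_integral_density) auto
    finally have 1: "ennreal ((R g x)\<^sup>2) \<le> \<dots>" .
    have 2: "(\<integral>\<^sup>+t. e x t \<partial>lborel) = ennreal ((1 + \<kappa>) powr (- \<alpha>))"
      unfolding e_def using \<kappa>_pos E_pos \<alpha>_pos by (intro nn_integral_gamma_exp) auto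
    have [measurable]: "(\<lambda>t. e x t) \<in> borel_measurable borel" unfolding e_def by measurable
    have "ennreal ((R g x)\<^sup>2) + ennreal (c0 * (1 + \<kappa>) powr (- \<alpha>)) * local_spread g x
      \<le> (\<integral>\<^sup>+t. ennreal (?\<gamma> x t) * ennreal ((K t g x)\<^sup>2) \<partial>lborel) + ennreal c0 * (\<integral>\<^sup>+t. e x t \<partial>lborel) * local_spread g x"
      using 1 c0 unfolding 2 by (intro add_mono) (simp_all add: ennreal_mult)
    also have "\<dots> = (\<integral>\<^sup>+t. ennreal (?\<gamma> x t) * ennreal ((K t g x)\<^sup>2) + ennreal c0 * e x t * local_spread g x \<partial>lborel)"
      by (simp add: nn_integral_add nn_integral_cmult nn_integral_multc)
    also have "\<dots> \<le> (\<integral>\<^sup>+t. ennreal (?\<gamma> x t) * ennreal (K t (\<lambda>y. (g y)\<^sup>2) x) \<partial>lborel)"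
    proof (intro nn_integral_mono)
      fix t
      show "ennreal (?\<gamma> x t) * ennreal ((K t g x)\<^sup>2) + ennreal c0 * e x t * local_spread g x
        \<le> ennreal (?\<gamma> x t) * ennreal (K t (\<lambda>y. (g y)\<^sup>2) x)"
      proof (cases "t > 0")
        case True
        have "ennreal (?\<gamma> x t) * ennreal ((K t g x)\<^sup>2) + ennreal c0 * e x t * local_spread g x
          = ennreal (?\<gamma> x t) * (ennreal ((K t g x)\<^sup>2) + ennreal c0 * ennreal (exp (- t * (\<kappa> * E x))) * local_spread g x)"
          by (simp add: e_def distrib_left ac_simps)
        also have "\<dots> \<le> ennreal (?\<gamma> x t) * ennreal (K t (\<lambda>y. (g y)\<^sup>2) x)"
          using True b by (intro mult_left_mono variance_gain) auto
        finally show ?thesis .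
      qed (simp add: e_def gamma_density_def)
    qed
    finally have "ennreal (W x) * (ennreal ((R g x)\<^sup>2) + ennreal (c0 * (1 + \<kappa>) powr (- \<alpha>)) * local_spread g x)
      \<le> ennreal (W x) * (\<integral>\<^sup>+t. ennreal (?\<gamma> x t) * ennreal (K t (\<lambda>y. (g y)\<^sup>2) x) \<partial>lborel)"
      by (rule mult_left_mono) simp
    also have "\<dots> = (\<integral>\<^sup>+t. ennreal (W x * ?\<gamma> x t) * ennreal (K t (\<lambda>y. (g y)\<^sup>2) x) \<partial>lborel)"
      using W_pos[of x] by (subst nn_integral_cmult[symmetric]) (auto simp: ennreal_mult' mult.assoc)
    finally show ?thesis by (simp add: distrib_left ac_simps)
  qed
  have "(\<integral>\<^sup>+x. ennreal (W x) * ennreal ((R g x)\<^sup>2) \<partial>lborel) + ennreal c1 * increment_energy W r g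
    = (\<integral>\<^sup>+x. ennreal (W x) * ennreal ((R g x)\<^sup>2) \<partial>lborel)
      + ennreal (c0 * (1 + \<kappa>) powr (- \<alpha>)) * (ennreal cS * increment_energy W r g)"
    using c0 cS by (subst ennreal_scale) (auto simp: c1_def)
  also have "\<dots> \<le> (\<integral>\<^sup>+x. ennreal (W x) * ennreal ((R g x)\<^sup>2) \<partial>lborel)
      + ennreal (c0 * (1 + \<kappa>) powr (- \<alpha>)) * (\<integral>\<^sup>+x. ennreal (W x) * local_spread g x \<partial>lborel)"
    by (intro add_left_mono mult_left_mono local_spread_energy g) simp
  also have "\<dots> = (\<integral>\<^sup>+x. ennreal (W x) * ennreal ((R g x)\<^sup>2) + ennreal (c0 * (1 + \<kappa>) powr (- \<alpha>)) * (ennreal (W x) * local_spread g x) \<partial>lborel)"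
    by (simp add: nn_integral_add nn_integral_cmult)
  also have "\<dots> \<le> (\<integral>\<^sup>+x. \<integral>\<^sup>+t. ennreal (W x * ?\<gamma> x t) * ennreal (K t (\<lambda>y. (g y)\<^sup>2) x) \<partial>lborel \<partial>lborel)"
    by (intro nn_integral_mono pt)
  also have "\<dots> = (\<integral>\<^sup>+x. \<integral>\<^sup>+t. ennreal (W x * ?\<gamma> x t) * ennreal ((g x)\<^sup>2) \<partial>lborel \<partial>lborel)"
    using stationary[of "\<lambda>(t, x). (g x)\<^sup>2" "hi\<^sup>2"] sq by (simp add: H_def borel_prod[symmetric] case_prod_unfold)
  also have "\<dots> = (\<integral>\<^sup>+x. ennreal (W x) * ennreal ((g x)\<^sup>2) \<partial>lborel)"
  proof (rule nn_integral_cong)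
    fix x
    have "(\<integral>\<^sup>+t. ennreal (W x * ?\<gamma> x t) * ennreal ((g x)\<^sup>2) \<partial>lborel)
      = ennreal (W x) * (\<integral>\<^sup>+t. ennreal (?\<gamma> x t) \<partial>lborel) * ennreal ((g x)\<^sup>2)"
      using W_pos[of x] by (simp add: ennreal_mult' nn_integral_multc nn_integral_cmult)
    then show "(\<integral>\<^sup>+t. ennreal (W x * ?\<gamma> x t) * ennreal ((g x)\<^sup>2) \<partial>lborel) = ennreal (W x) * ennreal ((g x)\<^sup>2)"
      using \<alpha>_pos E_pos by (simp add: nn_integral_gamma_density)
  qed
  finally show ?thesis .
qed

section \<open>Polynomial tails of the marginal weight\<close>

text \<open>Constants at scale zero. On the ball of radius \<open>2 ^ j * (r / 2)\<close> one has
  \<open>1 + (norm y)\<^sup>2 \<le> 4 ^ j * (1 + r\<^sup>2 / 4)\<close>; outside it,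
  \<open>(norm y)\<^sup>2\<close> is at least \<open>4 ^ j * (r\<^sup>2 / 4)\<close>. The maximum in
  \<open>cu\<close> also covers the global bound \<open>E y \<ge> e1\<close>.\<close>

definition cl :: real where "cl = (e2 * (1 + r\<^sup>2 / 4)) powr (- \<alpha>)"
definition cu :: real where "cu = max (e1 powr (- \<alpha>)) ((e1 * (r\<^sup>2 / 4)) powr (- \<alpha>))"

lemma r_pos: "r > 0" using s by (simp add: r_def)

lemma powr4: "(4 powr \<alpha>) ^ j = (4 ^ j) powr \<alpha>"
  by (induction j) (auto simp: powr_mult)

text \<open>Doubling the radius multiplies \<open>E\<close> by about 4 and so divides
  \<open>W\<close> by about \<open>4 powr \<alpha>\<close>. This exceeds \<open>2 ^ DIM('a)\<close>
  exactly when \<alpha> exceeds half the dimension.\<close>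

sublocale D: dyadic_weight W r "4 powr \<alpha>" cl cu
proof
  show "W \<in> borel_measurable borel" by measurable
  show "0 \<le> W y" for y using W_pos[of y] by simp
  show "r > 0" by (rule r_pos)
  have "1 + r\<^sup>2 / 4 > 0" by (simp add: add_pos_nonneg)
  then show "cl > 0" using e2 by (simp add: cl_def)
  show "cu > 0" using e1 by (simp add: cu_def less_max_iff_disj)
  have "(2::real) ^ DIM('a) = 4 powr (DIM('a) / 2)"
    using powr_powr[of 2 2 "DIM('a) / 2"] by (simp add: powr_realpow)
  also have "\<dots> < 4 powr \<alpha>" using \<alpha> by (intro powr_less_mono) auto
  finally show "2 ^ DIM('a) < 4 powr \<alpha>" .
  show "W y \<le> cu" for y
  proof -
    have "e1 * 1 \<le> e1 * (1 + (norm y)\<^sup>2)" using e1 by (intro mult_left_mono) auto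
    then have "e1 \<le> E y" using E_lower[of y] by linarith
    then have "W y \<le> e1 powr (- \<alpha>)" unfolding W_def
      using e1 \<alpha>_pos by (intro powr_mono2') auto
    then show ?thesis by (simp add: cu_def le_max_iff_disj)
  qed
  show "cl / (4 powr \<alpha>) ^ j \<le> W y" if "norm y \<le> 2 ^ j * (r / 2)" for y j
  proof -
    have "(norm y)\<^sup>2 \<le> (2 ^ j * (r / 2))\<^sup>2" using that by (intro power_mono) auto
    also have "\<dots> = 4 ^ j * (r\<^sup>2 / 4)"
      by (simp add: power_mult_distrib power_divide power_mult[symmetric] mult.commute)
        (simp add: power_mult mult.commute[of j])
    finally have "1 + (norm y)\<^sup>2 \<le> 4 ^ j * (1 + r\<^sup>2 / 4)" by (simp add: algebra_simps add_mono)
    then have "e2 * (1 + (norm y)\<^sup>2) \<le> e2 * (4 ^ j * (1 + r\<^sup>2 / 4))" using e2 by (intro mult_left_mono) auto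
    then have "E y \<le> (e2 * (1 + r\<^sup>2 / 4)) * 4 ^ j" using E_upper[of y] by (simp add: ac_simps)
    then have "((e2 * (1 + r\<^sup>2 / 4)) * 4 ^ j) powr (- \<alpha>) \<le> W y"
      unfolding W_def using E_pos[of y] \<alpha>_pos by (intro powr_mono2') auto
    moreover have "((e2 * (1 + r\<^sup>2 / 4)) * 4 ^ j) powr (- \<alpha>) = cl / (4 powr \<alpha>) ^ j"
      using e2 by (simp add: cl_def powr4 powr_mult powr_minus_divide add_nonneg_nonneg)
    ultimately show ?thesis by simp
  qed
  show "W y \<le> cu / (4 powr \<alpha>) ^ j" if "norm y > 2 ^ j * (r / 2)" for y j
  proof -
    have "4 ^ j * (r\<^sup>2 / 4) = (2 ^ j * (r / 2))\<^sup>2"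
      by (simp add: power_mult_distrib power_divide power_mult[symmetric] mult.commute)
        (simp add: power_mult mult.commute[of j])
    also have "\<dots> \<le> (norm y)\<^sup>2" using that r_pos by (intro power_mono) auto
    finally have "4 ^ j * (r\<^sup>2 / 4) \<le> 1 + (norm y)\<^sup>2" by simp
    then have "e1 * (4 ^ j * (r\<^sup>2 / 4)) \<le> e1 * (1 + (norm y)\<^sup>2)" using e1 by (intro mult_left_mono) auto
    from order_trans[OF this E_lower[of y]] have "(e1 * (r\<^sup>2 / 4)) * 4 ^ j \<le> E y" by (simp add: ac_simps)
    then have "W y \<le> ((e1 * (r\<^sup>2 / 4)) * 4 ^ j) powr (- \<alpha>)"
      unfolding W_def using e1 r_pos \<alpha>_pos by (intro powr_mono2') auto
    also have "\<dots> = (e1 * (r\<^sup>2 / 4)) powr (- \<alpha>) / (4 powr \<alpha>) ^ j"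
      by (simp only: powr4 powr_mult powr_minus_divide times_divide_eq_right mult_1_right divide_divide_eq_left)
    also have "\<dots> \<le> cu / (4 powr \<alpha>) ^ j"
      by (intro divide_right_mono) (auto simp: cu_def)
    finally show ?thesis .
  qed
qed

section \<open>Decay for functions of the second coordinate\<close>

definition Z :: real where "Z = (LINT x|lborel. W x)"

lemma nn_integral_W: "(\<integral>\<^sup>+x. ennreal (W x) \<partial>lborel) = ennreal Z"
  unfolding Z_def using W_pos by (intro nn_integral_eq_integral D.weight_integrable) (auto intro: less_imp_le)

lemma Z_pos: "Z > 0"
proof -
  have "Z \<noteq> 0"
  proof
    assume "Z = 0"
    then have "AE x in lborel. ennreal (W x) = 0"
      using nn_integral_W by (subst nn_integral_0_iff_AE[symmetric]) auto
    then have "AE x in (lborel :: 'a measure). False"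
      by (rule eventually_mono) (simp add: ennreal_eq_0_iff W_pos[unfolded not_le[symmetric]])
    then show False by (simp add: eventually_False ae_filter_eq_bot_iff)
  qed
  moreover have "Z \<ge> 0" unfolding Z_def using W_pos by (intro integral_nonneg_AE) (auto intro: less_imp_le)
  ultimately show ?thesis by simp
qed

lemma integrable_W_mult:
  assumes [measurable]: "g \<in> borel_measurable borel" and b: "\<And>x. \<bar>g x\<bar> \<le> hi"
  shows "integrable lborel (\<lambda>x. W x * g x)"
proof (rule Bochner_Integration.integrable_bound)
  show "integrable lborel (\<lambda>x. hi * W x)" using D.weight_integrable by simp
  show "AE x in lborel. norm (W x * g x) \<le> norm (hi * W x)"
  proof (rule AE_I2)
    fix x
    have "\<bar>g x\<bar> \<le> \<bar>hi\<bar>" using b[of x] by linarith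
    from mult_left_mono[OF this, of "\<bar>W x\<bar>"] show "norm (W x * g x) \<le> norm (hi * W x)"
      by (simp add: abs_mult mult.commute)
  qed
qed measurable

text \<open>Bounds are required at every point rather than almost everywhere, so that
  \<open>R\<close> preserves them with the same \<open>lo\<close> and \<open>hi\<close> and the
  oscillation bound stays fixed along the iteration.\<close>

definition bounded_mean_zero :: "real \<Rightarrow> real \<Rightarrow> ('a \<Rightarrow> real) \<Rightarrow> bool" where
  "bounded_mean_zero lo hi g \<longleftrightarrow> g \<in> borel_measurable borel \<and> (\<forall>x. lo \<le> g x \<and> g x \<le> hi) \<and> (LINT x|lborel. W x * g x) = 0"

definition sq_norm :: "('a \<Rightarrow> real) \<Rightarrow> real" where "sq_norm g = (LINT x|lborel. W x * (g x)\<^sup>2)"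

lemma bounded_mean_zeroD:
  assumes "bounded_mean_zero lo hi g"
  shows "g \<in> borel_measurable borel" "lo \<le> g x" "g x \<le> hi" "\<bar>g x\<bar> \<le> \<bar>lo\<bar> + \<bar>hi\<bar>" "\<bar>g x - g y\<bar> \<le> hi - lo"
    "(LINT x|lborel. W x * g x) = 0"
proof -
  have b: "lo \<le> g x" "g x \<le> hi" for x using assms by (auto simp: bounded_mean_zero_def)
  show "g \<in> borel_measurable borel" "lo \<le> g x" "g x \<le> hi" "(LINT x|lborel. W x * g x) = 0"
    using assms by (auto simp: bounded_mean_zero_def)
  show "\<bar>g x\<bar> \<le> \<bar>lo\<bar> + \<bar>hi\<bar>" using b[of x] by linarith
  show "\<bar>g x - g y\<bar> \<le> hi - lo" using b[of x] b[of y] by linarith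
qed

lemma integrable_W_square:
  assumes [measurable]: "g \<in> borel_measurable borel" and b: "\<And>x. \<bar>g x\<bar> \<le> hi"
  shows "integrable lborel (\<lambda>x. W x * (g x)\<^sup>2)"
proof (rule integrable_W_mult)
  show "\<bar>(g x)\<^sup>2\<bar> \<le> hi\<^sup>2" for x using power_mono[OF b, of x 2] by simp
qed measurable

lemma nn_integral_W_square:
  assumes "g \<in> borel_measurable borel" and b: "\<And>x. \<bar>g x\<bar> \<le> hi"
  shows "(\<integral>\<^sup>+x. ennreal (W x) * ennreal ((g x)\<^sup>2) \<partial>lborel) = ennreal (sq_norm g)"
proof -
  have "(\<integral>\<^sup>+x. ennreal (W x) * ennreal ((g x)\<^sup>2) \<partial>lborel) = (\<integral>\<^sup>+x. ennreal (W x * (g x)\<^sup>2) \<partial>lborel)"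
    using W_pos by (intro nn_integral_cong) (simp add: ennreal_mult less_imp_le)
  also have "\<dots> = ennreal (sq_norm g)"
    unfolding sq_norm_def using W_pos by (intro nn_integral_eq_integral integrable_W_square[OF assms]) (auto simp: less_imp_le)
  finally show ?thesis .
qed

lemma sq_norm_nonneg: "sq_norm g \<ge> 0"
  unfolding sq_norm_def using W_pos by (intro integral_nonneg_AE) (auto simp: less_imp_le)

text \<open>For mean zero, replacing \<open>g\<close> by \<open>g - g z\<close> adds
  \<open>Z * (g z)\<^sup>2\<close> to the squared norm, so it only grows; averaging over
  \<open>z\<close> in the core gives the pair form.\<close>

lemma variance_le_weighted_pair:
  assumes "bounded_mean_zero lo hi g"
  shows "ennreal (measure lborel (D.B 0) * sq_norm g) \<le> D.weighted_pair g UNIV"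
proof -
  note g = bounded_mean_zeroD[OF assms]
  note [measurable] = g(1)
  have pt: "ennreal (sq_norm g) \<le> (\<integral>\<^sup>+y. ennreal (W y) * ennreal ((g y - g z)\<^sup>2) \<partial>lborel)" for z
  proof -
    have i1: "integrable lborel (\<lambda>x. W x * (g x)\<^sup>2)" by (rule integrable_W_square[OF g(1,4)])
    have i2: "integrable lborel (\<lambda>x. W x * g x)" by (rule integrable_W_mult[OF g(1,4)])
    have "sq_norm (\<lambda>y. g y - g z) = (LINT y|lborel. W y * (g y)\<^sup>2 - 2 * g z * (W y * g y) + (g z)\<^sup>2 * W y)"
      unfolding sq_norm_def by (intro Bochner_Integration.integral_cong refl) (simp add: power2_eq_square algebra_simps)
    also have "\<dots> = sq_norm g - 2 * g z * 0 + (g z)\<^sup>2 * Z"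
      using i1 i2 D.weight_integrable g(6) by (simp add: sq_norm_def Z_def)
    finally have "sq_norm g \<le> sq_norm (\<lambda>y. g y - g z)" using Z_pos by simp
    then have "ennreal (sq_norm g) \<le> ennreal (sq_norm (\<lambda>y. g y - g z))" by (rule ennreal_leI)
    also have "\<dots> = (\<integral>\<^sup>+y. ennreal (W y) * ennreal ((g y - g z)\<^sup>2) \<partial>lborel)"
      using g(5) by (intro nn_integral_W_square[symmetric]) auto
    finally show ?thesis .
  qed
  have "ennreal (measure lborel (D.B 0) * sq_norm g) = (\<integral>\<^sup>+z\<in>D.B 0. ennreal (sq_norm g) \<partial>lborel)"
    by (simp add: nn_integral_cmult_indicator D.emeasure_B0(1) ennreal_mult sq_norm_nonneg mult.commute)
  also have "\<dots> \<le> (\<integral>\<^sup>+z\<in>D.B 0. (\<integral>\<^sup>+y. ennreal (W y) * ennreal ((g y - g z)\<^sup>2) \<partial>lborel) \<partial>lborel)"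
    by (intro nn_integral_mono mult_right_mono pt) auto
  also have "\<dots> = (\<integral>\<^sup>+z. \<integral>\<^sup>+y. ennreal (W y) * (ennreal ((g y - g z)\<^sup>2) * indicator (D.B 0) z) \<partial>lborel \<partial>lborel)"
    by (simp add: nn_integral_multc[symmetric] mult.assoc)
  also have "\<dots> = (\<integral>\<^sup>+y. \<integral>\<^sup>+z. ennreal (W y) * (ennreal ((g y - g z)\<^sup>2) * indicator (D.B 0) z) \<partial>lborel \<partial>lborel)"
    by (rule lborel_pair.Fubini') measurable
  also have "\<dots> = D.weighted_pair g UNIV"
    unfolding D.weighted_pair_def by (simp add: nn_integral_cmult)
  finally show ?thesis .
qed

text \<open>Stationarity is available for nonnegative functions, so \<open>f\<close> is shifted by
  its lower bound and the constant cancelled afterwards. Functions of both coordinates are allowed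
  because the first step of the chain acts on such a function.\<close>

lemma R_mean:
  assumes f: "f \<in> borel_measurable borel" and b: "\<And>p. lo \<le> f p" "\<And>p. f p \<le> hi"
  shows "(LINT x|lborel. W x * (LINT t|gamma_measure \<alpha> (E x). H f (t, x)))
    = (LINT x|lborel. W x * (LINT t|gamma_measure \<alpha> (E x). f (t, x)))"
proof -
  have [measurable]: "f \<in> borel_measurable (borel \<Otimes>\<^sub>M borel)" using f by (simp add: borel_prod)
  have Hm[measurable]: "H f \<in> borel_measurable (borel \<Otimes>\<^sub>M borel)" using H_meas f by (simp add: borel_prod)
  have Hb: "lo \<le> H f p" "H f p \<le> hi" for p
    using K_bounds(2,3)[of "\<lambda>y. f (fst p, y)" lo hi] b by (auto simp: H_def case_prod_unfold)
  have key: "ennreal (LINT x|lborel. W x * ((LINT t|gamma_measure \<alpha> (E x). h (t, x)) - lo))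
     = (\<integral>\<^sup>+x. \<integral>\<^sup>+t. ennreal (W x * gamma_density \<alpha> (E x) t) * ennreal (h (t, x) - lo) \<partial>lborel \<partial>lborel)
     \<and> integrable lborel (\<lambda>x. W x * (LINT t|gamma_measure \<alpha> (E x). h (t, x)))
     \<and> (LINT x|lborel. W x * ((LINT t|gamma_measure \<alpha> (E x). h (t, x)) - lo)) \<ge> 0"
    if hm: "h \<in> borel_measurable (borel \<Otimes>\<^sub>M borel)" and hb: "\<And>p. lo \<le> h p" "\<And>p. h p \<le> hi" for h
  proof -
    note [measurable] = hm
    have sec: "(\<lambda>t. h (t, x)) \<in> borel_measurable borel" for x by measurable
    have gb: "integrable (gamma_measure \<alpha> (E x)) (\<lambda>t. h (t, x))"
      "lo \<le> (LINT t|gamma_measure \<alpha> (E x). h (t, x))" "(LINT t|gamma_measure \<alpha> (E x). h (t, x)) \<le> hi" for x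
      using \<Gamma>.expectation_bounds[of "\<lambda>t. h (t, x)" x lo hi] hb by auto
    have m: "(\<lambda>x. LINT t|gamma_measure \<alpha> (E x). h (t, x)) \<in> borel_measurable borel"
    proof -
      have "(\<lambda>x. LINT t|lborel. gamma_density \<alpha> (E x) t * h (t, x)) \<in> borel_measurable borel"
        by (rule lborel.borel_measurable_lebesgue_integral) measurable
      then show ?thesis using sec by (subst integral_gamma_measure) auto
    qed
    have i: "integrable lborel (\<lambda>x. W x * (LINT t|gamma_measure \<alpha> (E x). h (t, x)))"
      by (rule integrable_W_mult[where hi="\<bar>lo\<bar> + \<bar>hi\<bar>", OF m]) (use gb(2,3) in \<open>smt (verit)\<close>)
    have i': "integrable lborel (\<lambda>x. W x * ((LINT t|gamma_measure \<alpha> (E x). h (t, x)) - lo))"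
      using i D.weight_integrable by (simp add: right_diff_distrib)
    have nn: "0 \<le> W x * ((LINT t|gamma_measure \<alpha> (E x). h (t, x)) - lo)" for x
      using gb(2)[of x] W_pos[of x] by simp
    have "ennreal (LINT x|lborel. W x * ((LINT t|gamma_measure \<alpha> (E x). h (t, x)) - lo))
       = (\<integral>\<^sup>+x. ennreal (W x * ((LINT t|gamma_measure \<alpha> (E x). h (t, x)) - lo)) \<partial>lborel)"
      using i' nn by (intro nn_integral_eq_integral[symmetric]) auto
    also have "\<dots> = (\<integral>\<^sup>+x. \<integral>\<^sup>+t. ennreal (W x * gamma_density \<alpha> (E x) t) * ennreal (h (t, x) - lo) \<partial>lborel \<partial>lborel)"
    proof (rule nn_integral_cong)
      fix x
      have "ennreal ((LINT t|gamma_measure \<alpha> (E x). h (t, x)) - lo) = ennreal (LINT t|gamma_measure \<alpha> (E x). h (t, x) - lo)"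
        using gb(1)[of x] \<Gamma>.prob_space[of x] by simp
      also have "\<dots> = (\<integral>\<^sup>+t. ennreal (h (t, x) - lo) \<partial>gamma_measure \<alpha> (E x))"
        using gb(1)[of x] hb by (intro nn_integral_eq_integral[symmetric]) auto
      also have "\<dots> = (\<integral>\<^sup>+t. ennreal (gamma_density \<alpha> (E x) t) * ennreal (h (t, x) - lo) \<partial>lborel)"
        unfolding gamma_measure_def by (subst nn_integral_density) auto
      finally show "ennreal (W x * ((LINT t|gamma_measure \<alpha> (E x). h (t, x)) - lo))
        = (\<integral>\<^sup>+t. ennreal (W x * gamma_density \<alpha> (E x) t) * ennreal (h (t, x) - lo) \<partial>lborel)"
        using W_pos[of x] by (simp add: ennreal_mult' nn_integral_cmult mult.assoc)
    qed
    finally show ?thesis using i nn by (auto intro: integral_nonneg_AE)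
  qed
  \<comment> \<open>The weights of acceptance and rejection add up to one, so constants are
    fixed.\<close>
  have K_lo: "H f p - lo = H (\<lambda>p. f p - lo) p" for p
  proof -
    obtain t x where p: "p = (t, x)" by (cases p)
    have i: "integrable Q (\<lambda>z. acc t x (x + s *\<^sub>R z) * f (t, x + s *\<^sub>R z) + (1 - acc t x (x + s *\<^sub>R z)) * f (t, x))"
      using K_bounds(1)[of "\<lambda>y. f (t, y)" lo hi t x] b by simp
    have "H (\<lambda>p. f p - lo) p = (LINT z|Q. (acc t x (x + s *\<^sub>R z) * f (t, x + s *\<^sub>R z) + (1 - acc t x (x + s *\<^sub>R z)) * f (t, x)) - lo)"
      unfolding p H_def K_def by (auto intro!: Bochner_Integration.integral_cong simp: algebra_simps)
    also have "\<dots> = H f p - lo" using i Q.prob_space by (simp add: p H_def K_def)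
    finally show ?thesis by simp
  qed
  have "(\<integral>\<^sup>+x. \<integral>\<^sup>+t. ennreal (W x * gamma_density \<alpha> (E x) t) * ennreal (H f (t, x) - lo) \<partial>lborel \<partial>lborel)
    = (\<integral>\<^sup>+x. \<integral>\<^sup>+t. ennreal (W x * gamma_density \<alpha> (E x) t) * ennreal (f (t, x) - lo) \<partial>lborel \<partial>lborel)"
    unfolding K_lo using f b by (intro stationary[where hi="hi - lo"]) auto
  then have "ennreal (LINT x|lborel. W x * ((LINT t|gamma_measure \<alpha> (E x). H f (t, x)) - lo))
    = ennreal (LINT x|lborel. W x * ((LINT t|gamma_measure \<alpha> (E x). f (t, x)) - lo))"
    using key[of "H f", OF _ Hb] key[of f, OF _ b] by simp
  then have "(LINT x|lborel. W x * ((LINT t|gamma_measure \<alpha> (E x). H f (t, x)) - lo))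
    = (LINT x|lborel. W x * ((LINT t|gamma_measure \<alpha> (E x). f (t, x)) - lo))"
    using key[of "H f", OF _ Hb] key[of f, OF _ b] by (subst (asm) ennreal_inj) simp_all
  then show ?thesis
    using key[of "H f", OF _ Hb] key[of f, OF _ b] D.weight_integrable by (simp add: right_diff_distrib)
qed

lemma R_bounded_mean_zero:
  assumes "bounded_mean_zero lo hi g"
  shows "bounded_mean_zero lo hi (R g)"
proof -
  note g = bounded_mean_zeroD[OF assms]
  note [measurable] = g(1)
  have m: "(\<lambda>(t::real, x). g x) \<in> borel_measurable borel" by (simp add: borel_prod[symmetric])
  have "(LINT x|lborel. W x * R g x) = (LINT x|lborel. W x * (LINT t|gamma_measure \<alpha> (E x). g x))"
    using R_mean[OF m, of lo hi] g(2,3) by (simp add: R_def H_def case_prod_unfold)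
  also have "\<dots> = 0" using g(6) \<Gamma>.prob_space by simp
  finally show ?thesis unfolding bounded_mean_zero_def using R_bounds[OF g(1-3)] by simp
qed

text \<open>The ratio of the energy gained per step to the energy needed in the weak Poincare
  inequality; \<open>measure lborel (D.B 0)\<close> comes from averaging over the core.\<close>

definition drift_const :: real where "drift_const = c1 * measure lborel (D.B 0) / D.CB"
definition tail_const :: real where "tail_const = max 1 (D.CT / Z)"

text \<open>The energy is eliminated between the loss in one step and the weak Poincare inequality
  at scale \<open>J\<close>.\<close>

lemma R_step:
  assumes "bounded_mean_zero lo hi g"
  shows "drift_const * (1/4) ^ J * (sq_norm g - D.CT * (hi - lo)\<^sup>2 * (4 powr (- (\<alpha> - DIM('a) / 2))) ^ J) \<le> sq_norm g - sq_norm (R g)"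
    and "sq_norm (R g) \<le> sq_norm g"
proof -
  note g = bounded_mean_zeroD[OF assms]
  note [measurable] = g(1)
  note Rg = bounded_mean_zeroD[OF R_bounded_mean_zero[OF assms]]
  let ?I = "increment_energy W r g" and ?b = "measure lborel (D.B 0)"
  let ?k = "4 powr (- (\<alpha> - DIM('a) / 2)) :: real"
  have e: "ennreal (sq_norm (R g)) + ennreal c1 * ?I \<le> ennreal (sq_norm g)"
    using R_energy[OF g(1,4)] by (simp add: nn_integral_W_square[OF g(1,4)] nn_integral_W_square[OF Rg(1,4)])
  \<comment> \<open>The energy is bounded by a finite norm, which permits the passage from
    \<open>ennreal\<close> to real numbers.\<close>
  have "ennreal c1 * ?I \<le> ennreal (sq_norm g)" using e by (rule order_trans[rotated]) simp
  then have "?I \<noteq> top" using c1 by (auto simp: ennreal_mult_top top_unique)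
  then obtain I where I: "?I = ennreal I" "I \<ge> 0" by (cases ?I) auto
  have e': "sq_norm (R g) + c1 * I \<le> sq_norm g"
    using e c1 I sq_norm_nonneg by (simp add: ennreal_mult'[symmetric] ennreal_plus[symmetric] del: ennreal_plus)
  moreover have "0 \<le> c1 * I" using c1 I by simp
  ultimately show "sq_norm (R g) \<le> sq_norm g" by linarith
  have p2: "(2::real) ^ DIM('a) / 4 powr \<alpha> = ?k"
  proof -
    have "(2::real) ^ DIM('a) = 4 powr (DIM('a) / 2)"
      using powr_powr[of 2 2 "DIM('a) / 2"] by (simp add: powr_realpow)
    then show ?thesis unfolding minus_diff_eq powr_diff by (rule arg_cong)
  qed
  have "ennreal (?b * sq_norm g) \<le> ennreal (D.CB * 4 ^ J) * ?I + ennreal (D.CT * ?b * (hi - lo)\<^sup>2 * ?k ^ J)"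
    using order_trans[OF variance_le_weighted_pair[OF assms] D.weak_poincare[OF g(1,5), of J]] p2 by simp
  also have "\<dots> = ennreal (D.CB * 4 ^ J * I + D.CT * ?b * (hi - lo)\<^sup>2 * ?k ^ J)"
    using I D.CB_pos D.CT_pos by (simp add: ennreal_mult' ennreal_plus)
  finally have "?b * sq_norm g \<le> D.CB * 4 ^ J * I + D.CT * ?b * (hi - lo)\<^sup>2 * ?k ^ J"
    using I D.CB_pos D.CT_pos by (subst (asm) ennreal_le_iff) (auto intro!: add_nonneg_nonneg mult_nonneg_nonneg)
  then have "?b * (sq_norm g - D.CT * (hi - lo)\<^sup>2 * ?k ^ J) \<le> D.CB * 4 ^ J * I"
    by (simp add: algebra_simps)
  then have "(c1 / (D.CB * 4 ^ J)) * (?b * (sq_norm g - D.CT * (hi - lo)\<^sup>2 * ?k ^ J)) \<le> (c1 / (D.CB * 4 ^ J)) * (D.CB * 4 ^ J * I)"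
    using c1 D.CB_pos by (intro mult_left_mono) auto
  also have "\<dots> = c1 * I" using D.CB_pos by simp
  also have "\<dots> \<le> sq_norm g - sq_norm (R g)" using e' by simp
  finally show "drift_const * (1/4) ^ J * (sq_norm g - D.CT * (hi - lo)\<^sup>2 * ?k ^ J) \<le> sq_norm g - sq_norm (R g)"
    by (simp add: drift_const_def power_one_over ac_simps)
qed

text \<open>The constant of \<open>polynomial_decay\<close> for the drift coefficient supplied by
  \<open>multiscale_drift\<close>. The factor \<open>Z\<close> undoes the division by
  \<open>Z * (hi - lo)\<^sup>2\<close> that brings the squared norms into the unit interval.\<close>

definition rate_const :: real where
  "rate_const = Z * ((\<alpha> - DIM('a) / 2) / (drift_const / (8 * (2 * tail_const) powr (1 / (\<alpha> - DIM('a) / 2))))) powr (\<alpha> - DIM('a) / 2)"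

theorem R_decay:
  assumes "bounded_mean_zero lo hi g" and n: "n \<ge> 1"
  shows "sq_norm ((R ^^ n) g) \<le> rate_const * (hi - lo)\<^sup>2 * real n powr (- (\<alpha> - DIM('a) / 2))"
proof -
  let ?\<alpha> = "\<alpha> - DIM('a) / 2" and ?\<omega> = "hi - lo"
  let ?c = "drift_const / (8 * (2 * tail_const) powr (1 / ?\<alpha>))"
  have \<alpha>': "?\<alpha> > 0" using \<alpha> by simp
  have drift_const: "drift_const > 0" using c1 D.CB_pos D.emeasure_B0(2) by (simp add: drift_const_def)
  have tail_const: "tail_const \<ge> 1" "D.CT / Z \<le> tail_const" by (auto simp: tail_const_def)
  have c: "?c > 0" using drift_const tail_const by simp
  have good: "bounded_mean_zero lo hi ((R ^^ m) g)" for m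
    by (induction m) (auto intro: assms R_bounded_mean_zero)
  have \<omega>: "?\<omega> \<ge> 0" using bounded_mean_zeroD(2,3)[OF assms(1), of 0] by linarith
  \<comment> \<open>Mean zero forces \<open>lo \<le> 0 \<le> hi\<close>, so the values are bounded
    by the oscillation itself.\<close>
  have sq_norm_le: "sq_norm h \<le> Z * ?\<omega>\<^sup>2" if "bounded_mean_zero lo hi h" for h
  proof -
    note h = bounded_mean_zeroD[OF that]
    have "0 \<le> hi" "lo \<le> 0"
    proof -
      have i: "integrable lborel (\<lambda>x. W x * h x)" by (rule integrable_W_mult[OF h(1,4)])
      have "(LINT x|lborel. W x * h x) \<le> (LINT x|lborel. W x * hi)"
        using i D.weight_integrable h(3) W_pos by (intro integral_mono) (auto intro!: mult_left_mono less_imp_le)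
      then have "0 \<le> Z * hi" using h(6) by (simp add: Z_def)
      then show "0 \<le> hi" using Z_pos by (simp add: zero_le_mult_iff)
      have "(LINT x|lborel. W x * lo) \<le> (LINT x|lborel. W x * h x)"
        using i D.weight_integrable h(2) W_pos by (intro integral_mono) (auto intro!: mult_left_mono less_imp_le)
      then have "Z * lo \<le> 0" using h(6) by (simp add: Z_def)
      then show "lo \<le> 0" using Z_pos by (simp add: mult_le_0_iff)
    qed
    then have "\<bar>h x\<bar> \<le> ?\<omega>" for x using h(2,3)[of x] by linarith
    from power_mono[OF this, of _ 2] have "(h x)\<^sup>2 \<le> ?\<omega>\<^sup>2" for x by simp
    then have "sq_norm h \<le> (LINT x|lborel. W x * ?\<omega>\<^sup>2)"
      unfolding sq_norm_def using integrable_W_square[OF h(1,4)] D.weight_integrable W_pos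
      by (intro integral_mono) (auto intro!: mult_left_mono less_imp_le)
    then show ?thesis by (simp add: Z_def)
  qed
  \<comment> \<open>With zero oscillation the normalization would divide by zero, but then the
    squared norm vanishes.\<close>
  show ?thesis
  proof (cases "?\<omega> = 0")
    case True
    then show ?thesis using sq_norm_le[OF good[of n]] by simp
  next
    case False
    then have \<omega>2: "Z * ?\<omega>\<^sup>2 > 0" using Z_pos by simp
    define x where "x m = sq_norm ((R ^^ m) g) / (Z * ?\<omega>\<^sup>2)" for m
    have x0: "x m \<ge> 0" for m unfolding x_def using sq_norm_nonneg Z_pos by simp
    have x1: "x m \<le> 1" for m unfolding x_def using sq_norm_le[OF good[of m]] \<omega>2 by (simp add: divide_le_eq)
    have drift: "drift_const * (1/4) ^ J * (x m - tail_const * (4 powr (- ?\<alpha>)) ^ J) \<le> x m - x (Suc m)" for J m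
    proof -
      have "drift_const * (1/4) ^ J * (x m - tail_const * (4 powr (- ?\<alpha>)) ^ J) \<le> drift_const * (1/4) ^ J * (x m - (D.CT / Z) * (4 powr (- ?\<alpha>)) ^ J)"
        using drift_const tail_const(2) by (intro mult_left_mono diff_left_mono mult_right_mono) auto
      also have "\<dots> = (drift_const * (1/4) ^ J * (sq_norm ((R ^^ m) g) - D.CT * ?\<omega>\<^sup>2 * (4 powr (- ?\<alpha>)) ^ J)) / (Z * ?\<omega>\<^sup>2)"
        using \<omega>2 Z_pos False by (simp add: x_def field_simps)
      also have "\<dots> \<le> (sq_norm ((R ^^ m) g) - sq_norm (R ((R ^^ m) g))) / (Z * ?\<omega>\<^sup>2)"
        using \<omega>2 by (intro divide_right_mono R_step good) auto
      also have "\<dots> = x m - x (Suc m)" by (simp add: x_def diff_divide_distrib)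
      finally show ?thesis .
    qed
    have "x n \<le> (?\<alpha> / ?c) powr ?\<alpha> * real n powr (- ?\<alpha>)"
    proof (rule polynomial_decay[OF x0 \<alpha>' c n])
      show "x (Suc m) \<le> x m - ?c * x m powr (1 + 1 / ?\<alpha>)" if "x m > 0" for m
        using that x1 drift_const tail_const \<alpha>' drift by (intro multiscale_drift) auto
      show "x (Suc m) \<le> x m" for m
        unfolding x_def using R_step(2)[OF good[of m]] \<omega>2 by (simp add: divide_right_mono)
    qed
    then show ?thesis
      unfolding x_def rate_const_def using \<omega>2 by (simp add: divide_le_eq ac_simps)
  qed
qed

lemma rate_const_pos: "rate_const > 0"
proof -
  have "drift_const > 0" using c1 D.CB_pos D.emeasure_B0(2) by (simp add: drift_const_def)
  moreover have "tail_const > 0" by (simp add: tail_const_def)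
  ultimately show ?thesis using Z_pos \<alpha> by (simp add: rate_const_def)
qed

section \<open>The joint law and its null sets\<close>

definition dens :: "real \<times> 'a \<Rightarrow> real" where
  "dens = (\<lambda>(t, x). W x / Z * gamma_density \<alpha> (E x) t)"

definition \<mu> :: "(real \<times> 'a) measure" where "\<mu> = density lborel (\<lambda>p. ennreal (dens p))"

lemma dens_meas'[measurable]: "dens \<in> borel_measurable (borel \<Otimes>\<^sub>M borel)"
  unfolding dens_def by measurable

lemma dens_meas: "dens \<in> borel_measurable borel"
  using dens_meas' by (simp add: borel_prod)

lemma dens_nonneg: "dens p \<ge> 0"
  using W_pos Z_pos \<alpha>_pos by (auto simp: dens_def case_prod_unfold less_imp_le gamma_density_nonneg intro!: mult_nonneg_nonneg)

lemma dens_pos_iff: "dens (t, x) > 0 \<longleftrightarrow> t > 0"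
  using W_pos[of x] Z_pos E_pos[of x] Gamma_real_pos[OF \<alpha>_pos] by (auto simp: dens_def gamma_density_def)

lemma sets_\<mu>[simp]: "sets \<mu> = sets borel" by (simp add: \<mu>_def)
lemma space_\<mu>[simp]: "space \<mu> = UNIV" by (simp add: \<mu>_def)

lemma measurable_\<mu>: "borel_measurable \<mu> = borel_measurable borel"
  by (rule measurable_cong_sets) auto

lemma nn_integral_\<mu>:
  assumes F: "F \<in> borel_measurable borel"
  shows "(\<integral>\<^sup>+p. F p \<partial>\<mu>) = (\<integral>\<^sup>+x. \<integral>\<^sup>+t. ennreal (dens (t, x)) * F (t, x) \<partial>lborel \<partial>lborel)"
proof -
  have [measurable]: "F \<in> borel_measurable (borel \<Otimes>\<^sub>M borel)" using F by (simp add: borel_prod)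
  have "(\<integral>\<^sup>+p. F p \<partial>\<mu>) = (\<integral>\<^sup>+p. ennreal (dens p) * F p \<partial>(lborel \<Otimes>\<^sub>M lborel))"
    unfolding \<mu>_def lborel_prod using dens_meas F by (subst nn_integral_density) auto
  also have "\<dots> = (\<integral>\<^sup>+x. \<integral>\<^sup>+t. ennreal (dens (t, x)) * F (t, x) \<partial>lborel \<partial>lborel)"
    by (rule lborel_pair.nn_integral_snd[symmetric]) measurable
  finally show ?thesis .
qed

lemma nn_integral_dens: "(\<integral>\<^sup>+x. \<integral>\<^sup>+t. ennreal (dens (t, x)) \<partial>lborel \<partial>lborel) = 1"
proof -
  have "(\<integral>\<^sup>+t. ennreal (dens (t, x)) \<partial>lborel) = ennreal (1 / Z) * ennreal (W x)" for x
  proof -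
    have "(\<integral>\<^sup>+t. ennreal (dens (t, x)) \<partial>lborel) = (\<integral>\<^sup>+t. ennreal (W x / Z) * ennreal (gamma_density \<alpha> (E x) t) \<partial>lborel)"
      using W_pos[of x] Z_pos by (intro nn_integral_cong) (simp add: dens_def ennreal_mult'[symmetric])
    also have "\<dots> = ennreal (1 / Z * W x)"
      using \<alpha>_pos E_pos by (simp add: nn_integral_cmult nn_integral_gamma_density)
    finally show ?thesis using Z_pos by (simp only: ennreal_mult' zero_le_divide_1_iff less_imp_le)
  qed
  then have "(\<integral>\<^sup>+x. \<integral>\<^sup>+t. ennreal (dens (t, x)) \<partial>lborel \<partial>lborel) = (\<integral>\<^sup>+x. ennreal (1 / Z) * ennreal (W x) \<partial>lborel)"
    by (simp only:)
  also have "\<dots> = ennreal (1 / Z) * ennreal Z"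
    by (subst nn_integral_cmult) (auto simp: nn_integral_W)
  finally show ?thesis using Z_pos by (simp add: ennreal_mult'[symmetric])
qed

sublocale \<mu>: prob_space \<mu>
proof
  have "emeasure \<mu> (space \<mu>) = (\<integral>\<^sup>+p. 1 \<partial>\<mu>)" by simp
  also have "\<dots> = 1" using nn_integral_dens by (subst nn_integral_\<mu>) auto
  finally show "emeasure \<mu> (space \<mu>) = 1" .
qed

text \<open>Identifies the normalizing constant of the posterior once its joint density is written
  in this form.\<close>

lemma integral_W_gamma: "(LINT p|lborel. W (snd p) * gamma_density \<alpha> (E (snd p)) (fst p)) = Z"
proof -
  have "(LINT p|lborel. dens p) = (LINT p|\<mu>. 1)"
    unfolding \<mu>_def using dens_meas dens_nonneg by (subst integral_density) auto
  also have "\<dots> = 1" using \<mu>.prob_space by simp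
  finally have 1: "(LINT p|lborel. dens p) = 1" .
  have "(LINT p|lborel. W (snd p) * gamma_density \<alpha> (E (snd p)) (fst p)) = (LINT p|lborel. Z * dens p)"
    using Z_pos by (intro Bochner_Integration.integral_cong refl) (simp add: dens_def case_prod_unfold)
  then show ?thesis using 1 by simp
qed

lemma integral_\<mu>:
  assumes F: "F \<in> borel_measurable borel" and b: "\<And>p. \<bar>F p\<bar> \<le> B"
  shows "(LINT p|\<mu>. F p) = (LINT x|lborel. W x * (LINT t|gamma_measure \<alpha> (E x). F (t, x))) / Z"
proof -
  have Fp[measurable]: "F \<in> borel_measurable (borel \<Otimes>\<^sub>M borel)" using F by (simp add: borel_prod)
  have i: "integrable \<mu> F" using b F by (intro \<mu>.integrable_const_bound[where B=B]) (auto simp: measurable_\<mu>)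
  then have i': "integrable (lborel \<Otimes>\<^sub>M lborel) (\<lambda>p. dens p * F p)"
    unfolding \<mu>_def lborel_prod using dens_meas dens_nonneg F by (subst (asm) integrable_density) auto
  have "(LINT p|\<mu>. F p) = (LINT p|(lborel \<Otimes>\<^sub>M lborel). dens p * F p)"
    unfolding \<mu>_def lborel_prod using dens_meas dens_nonneg F by (subst integral_density) auto
  also have "\<dots> = (LINT x|lborel. LINT t|lborel. dens (t, x) * F (t, x))"
    using lborel_pair.integral_snd[of "\<lambda>t x. dens (t, x) * F (t, x)"] i' by (simp add: case_prod_unfold)
  also have "\<dots> = (LINT x|lborel. (W x * (LINT t|gamma_measure \<alpha> (E x). F (t, x))) / Z)"
  proof (intro Bochner_Integration.integral_cong refl)
    fix x
    have [measurable]: "(\<lambda>t. F (t, x)) \<in> borel_measurable borel" by measurable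
    have "(LINT t|lborel. dens (t, x) * F (t, x)) = (LINT t|lborel. W x / Z * (gamma_density \<alpha> (E x) t * F (t, x)))"
      by (simp add: dens_def mult.assoc)
    also have "\<dots> = W x / Z * (LINT t|gamma_measure \<alpha> (E x). F (t, x))"
      by (simp add: integral_gamma_measure)
    finally show "(LINT t|lborel. dens (t, x) * F (t, x)) = (W x * (LINT t|gamma_measure \<alpha> (E x). F (t, x))) / Z"
      by simp
  qed
  finally show ?thesis by simp
qed

text \<open>Both orders are needed: a Metropolis step is a statement about almost all
  \<open>x\<close> at fixed \<open>t\<close>, a Gibbs step one about almost all \<open>t\<close> at
  fixed \<open>x\<close>.\<close>

lemma AE_\<mu>_iff:
  assumes T: "Measurable.pred borel T"
  shows "(AE p in \<mu>. T p) \<longleftrightarrow> (AE x in lborel. AE t in lborel. t > 0 \<longrightarrow> T (t, x))"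
    and "(AE p in \<mu>. T p) \<longleftrightarrow> (AE t in lborel. AE x in lborel. t > 0 \<longrightarrow> T (t, x))"
proof -
  have [measurable]: "Measurable.pred (borel \<Otimes>\<^sub>M borel) T" using T by (simp add: borel_prod)
  have m: "{p \<in> space (lborel \<Otimes>\<^sub>M lborel). fst p > 0 \<longrightarrow> T (fst p, snd p)} \<in> sets (lborel \<Otimes>\<^sub>M lborel)"
    by measurable
  have "(AE p in \<mu>. T p) \<longleftrightarrow> (AE p in lborel \<Otimes>\<^sub>M lborel. fst p > 0 \<longrightarrow> T (fst p, snd p))"
    unfolding \<mu>_def lborel_prod using dens_meas dens_pos_iff
    by (subst AE_density) (auto intro!: arg_cong[where f="\<lambda>X. eventually X _"] simp: fun_eq_iff)
  then show 2: "(AE p in \<mu>. T p) \<longleftrightarrow> (AE t in lborel. AE x in lborel. t > 0 \<longrightarrow> T (t, x))"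
    using lborel_pair.AE_pair_iff[of "\<lambda>t x. t > 0 \<longrightarrow> T (t, x)"] m by simp
  show "(AE p in \<mu>. T p) \<longleftrightarrow> (AE x in lborel. AE t in lborel. t > 0 \<longrightarrow> T (t, x))"
    unfolding 2 using lborel_pair.AE_commute[of "\<lambda>t x. t > 0 \<longrightarrow> T (t, x)"] m by simp
qed

lemma P_meas:
  assumes "f \<in> borel_measurable borel"
  shows "P f \<in> borel_measurable borel"
proof -
  note [measurable] = P_meas_aux[OF assms]
  have "P f = (\<lambda>p. (\<lambda>x. LINT t|gamma_measure \<alpha> (E x). H f (t, x)) (snd p))" by (auto simp: P_def)
  also have "\<dots> \<in> borel_measurable (borel \<Otimes>\<^sub>M borel)" by measurable
  finally show ?thesis by (simp add: borel_prod)
qed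

text \<open>The kernel has an atom at the current point, so equality is needed at \<open>x\<close>
  itself as well as at almost every proposal. At almost every \<open>x\<close> both hold, since
  affine maps preserve null sets.\<close>

lemma P_AE_cong:
  assumes f: "f \<in> borel_measurable borel" and f': "f' \<in> borel_measurable borel"
    and eq: "AE p in \<mu>. f p = f' p"
  shows "AE p in \<mu>. P f p = P f' p"
proof -
  have [measurable]: "f \<in> borel_measurable (borel \<Otimes>\<^sub>M borel)" "f' \<in> borel_measurable (borel \<Otimes>\<^sub>M borel)"
    "H f \<in> borel_measurable (borel \<Otimes>\<^sub>M borel)" "H f' \<in> borel_measurable (borel \<Otimes>\<^sub>M borel)"
    using f f' H_meas by (simp_all add: borel_prod)
  note [measurable] = f f' H_meas[OF f] H_meas[OF f'] P_meas[OF f] P_meas[OF f']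
  have "AE t in lborel. AE x in lborel. t > 0 \<longrightarrow> f (t, x) = f' (t, x)"
    using eq by (subst (asm) AE_\<mu>_iff(2)) measurable
  then have "AE t in lborel. AE x in lborel. t > 0 \<longrightarrow> H f (t, x) = H f' (t, x)"
  proof eventually_elim
    case (elim t)
    have "AE x in lborel. H f (t, x) = H f' (t, x)" if t: "t > 0"
    proof -
      have ae: "AE x in lborel. f (t, x) = f' (t, x)" using elim t by simp
      have m: "Measurable.pred borel (\<lambda>x. f (t, x) = f' (t, x))" by measurable
      show ?thesis using ae
      proof eventually_elim
        case (elim x)
        have "AE z in lborel. f (t, x + s *\<^sub>R z) = f' (t, x + s *\<^sub>R z)"
          using AE_lborel_affine[OF _ m ae, of s x] s by simp
        then have "AE z in Q. f (t, x + s *\<^sub>R z) = f' (t, x + s *\<^sub>R z)"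
          unfolding Q_def by (subst AE_density) (auto elim: eventually_mono)
        then show ?case
          unfolding H_def K_def prod.case using elim
          by (intro integral_cong_AE) (measurable, auto elim!: eventually_mono)
      qed
    qed
    then show ?case by auto
  qed
  then have "AE p in \<mu>. H f p = H f' p"
    by (subst AE_\<mu>_iff(2)) measurable
  then have "AE x in lborel. AE t in lborel. t > 0 \<longrightarrow> H f (t, x) = H f' (t, x)"
    by (subst (asm) AE_\<mu>_iff(1)) measurable
  then have "AE x in lborel. \<forall>t. P f (t, x) = P f' (t, x)"
  proof eventually_elim
    case (elim x)
    have "AE t in gamma_measure \<alpha> (E x). H f (t, x) = H f' (t, x)"
      unfolding gamma_measure_def using elim
      by (subst AE_density) (auto simp: gamma_density_def elim!: eventually_mono split: if_splits)
    moreover have "(\<lambda>t. H f (t, x)) \<in> borel_measurable (gamma_measure \<alpha> (E x))"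
      "(\<lambda>t. H f' (t, x)) \<in> borel_measurable (gamma_measure \<alpha> (E x))" by measurable
    ultimately have "(LINT t|gamma_measure \<alpha> (E x). H f (t, x)) = (LINT t|gamma_measure \<alpha> (E x). H f' (t, x))"
      by (intro integral_cong_AE)
    then show ?case by (simp add: P_def)
  qed
  then have "AE x in lborel. AE t in lborel. t > 0 \<longrightarrow> P f (t, x) = P f' (t, x)"
    by (auto elim: eventually_mono)
  then show ?thesis by (subst AE_\<mu>_iff(1)) measurable
qed

lemma P_power_meas: "f \<in> borel_measurable borel \<Longrightarrow> (P ^^ n) f \<in> borel_measurable borel"
  by (induction n) (auto intro: P_meas)

lemma P_power_AE_cong:
  assumes "f \<in> borel_measurable borel" "f' \<in> borel_measurable borel" "AE p in \<mu>. f p = f' p"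
  shows "AE p in \<mu>. (P ^^ n) f p = (P ^^ n) f' p"
proof (induction n)
  case (Suc n)
  from P_AE_cong[OF P_power_meas[OF assms(1)] P_power_meas[OF assms(2)] Suc] show ?case by simp
qed (use assms in simp)

lemma P_lift: "P (\<lambda>(t, x). g x) = (\<lambda>(t, x). R g x)"
  by (simp add: P_def H_def R_def fun_eq_iff)

lemma P_power_lift: "(P ^^ n) (\<lambda>(t, x). g x) = (\<lambda>(t, x). (R ^^ n) g x)"
  by (induction n) (simp_all add: P_lift)

lemma L2_norm_lift:
  assumes "bounded_mean_zero lo hi g"
  shows "(L2_norm \<mu> (\<lambda>(t, x). g x))\<^sup>2 = sq_norm g / Z"
proof -
  note g = bounded_mean_zeroD[OF assms]
  note [measurable] = g(1)
  have m: "(\<lambda>p. (g (snd p))\<^sup>2) \<in> borel_measurable (borel :: (real \<times> 'a) measure)"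
    unfolding borel_prod[symmetric] by measurable
  have "(LINT p|\<mu>. (g (snd p))\<^sup>2) = sq_norm g / Z"
    unfolding sq_norm_def
  proof (subst integral_\<mu>[OF m])
    show "\<bar>(g (snd p))\<^sup>2\<bar> \<le> (\<bar>lo\<bar> + \<bar>hi\<bar>)\<^sup>2" for p using power_mono[OF g(4), of "snd p" 2] by simp
  qed (use \<Gamma>.prob_space in simp)
  moreover have "(LINT p|\<mu>. (g (snd p))\<^sup>2) \<ge> 0" by simp
  ultimately show ?thesis by (simp add: L2_norm_def case_prod_unfold)
qed

text \<open>The first application of \<open>P\<close> removes the dependence on \<open>t\<close> and
  brings no quantified decay; only the remaining \<open>n - 1\<close> steps contribute to the
  rate.\<close>

theorem P_decay:
  assumes f: "f \<in> L2_0 \<mu>" and fin: "(osc_norm \<mu> f)\<^sup>2 < \<infinity>" and n: "n \<ge> 2"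
  shows "(L2_norm \<mu> ((P ^^ n) f))\<^sup>2
    \<le> rate_const / Z * (real_of_ereal (osc_norm \<mu> f))\<^sup>2 * (real n - 1) powr (- (\<alpha> - DIM('a) / 2))"
proof -
  have fm: "f \<in> borel_measurable borel" and f0: "(LINT p|\<mu>. f p) = 0"
    using f by (auto simp: L2_0_def measurable_\<mu>)
  obtain lo hi where lo: "AE p in \<mu>. lo \<le> f p" and hi: "AE p in \<mu>. f p \<le> hi"
    and osc: "osc_norm \<mu> f = ereal (hi - lo)"
    using osc_norm_finiteE[OF _ fin] f by (auto simp: L2_0_def)
  have "AE p in \<mu>. lo \<le> hi" using lo hi by eventually_elim simp
  then have lohi: "lo \<le> hi" by simp
  \<comment> \<open>Clipping turns essential bounds into pointwise ones and changes \<open>f\<close>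
    only on a null set, which the iterates of \<open>P\<close> respect.\<close>
  define f' where "f' p = max lo (min hi (f p))" for p
  have f'm: "f' \<in> borel_measurable borel" unfolding f'_def using fm by measurable
  have eq: "AE p in \<mu>. f p = f' p" using lo hi by eventually_elim (simp add: f'_def)
  have f'b: "lo \<le> f' p" "f' p \<le> hi" for p using lohi by (auto simp: f'_def)
  have f'0: "(LINT p|\<mu>. f' p) = 0"
    using f0 eq fm f'm integral_cong_AE[of f \<mu> f'] by (simp add: measurable_\<mu>)
  define g where "g x = (LINT t|gamma_measure \<alpha> (E x). H f' (t, x))" for x
  have Pf': "P f' = (\<lambda>(t, x). g x)" by (simp add: P_def g_def)
  have "bounded_mean_zero lo hi g"
    unfolding bounded_mean_zero_def
  proof (intro conjI allI)
    show "g \<in> borel_measurable borel" unfolding g_def by (rule P_meas_aux[OF f'm])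
    have Hb: "lo \<le> H f' p" "H f' p \<le> hi" for p
    proof -
      have [measurable]: "f' \<in> borel_measurable (borel \<Otimes>\<^sub>M borel)" using f'm by (simp add: borel_prod)
      show "lo \<le> H f' p" "H f' p \<le> hi"
        using K_bounds(2,3)[of "\<lambda>y. f' (fst p, y)" lo hi] f'b by (auto simp: H_def case_prod_unfold)
    qed
    have [measurable]: "H f' \<in> borel_measurable (borel \<Otimes>\<^sub>M borel)" using H_meas[OF f'm] by (simp add: borel_prod)
    show "lo \<le> g x" "g x \<le> hi" for x
      unfolding g_def using \<Gamma>.expectation_bounds[of "\<lambda>t. H f' (t, x)" x lo hi] Hb by auto
    have "(LINT x|lborel. W x * g x) = (LINT x|lborel. W x * (LINT t|gamma_measure \<alpha> (E x). f' (t, x)))"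
      unfolding g_def by (rule R_mean[OF f'm f'b])
    also have "\<dots> = 0"
    proof -
      have "\<bar>f' p\<bar> \<le> \<bar>lo\<bar> + \<bar>hi\<bar>" for p using f'b[of p] by linarith
      from integral_\<mu>[OF f'm this] f'0 Z_pos show ?thesis by simp
    qed
    finally show "(LINT x|lborel. W x * g x) = 0" .
  qed
  note g = this
  have good: "bounded_mean_zero lo hi ((R ^^ m) g)" for m
    by (induction m) (auto intro: g R_bounded_mean_zero)
  obtain m where m: "n = Suc m" "m \<ge> 1" using n by (cases n) auto
  have "(P ^^ n) f' = (P ^^ m) (P f')" unfolding m(1) by (simp add: funpow_swap1)
  then have Pn: "(P ^^ n) f' = (\<lambda>(t, x). (R ^^ m) g x)" by (simp add: Pf' P_power_lift)
  have "L2_norm \<mu> ((P ^^ n) f) = L2_norm \<mu> ((P ^^ n) f')"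
    unfolding L2_norm_def using P_power_AE_cong[OF fm f'm eq, of n] P_power_meas[OF fm, of n] P_power_meas[OF f'm, of n]
    by (intro arg_cong[where f=sqrt] integral_cong_AE) (auto simp: measurable_\<mu> elim!: eventually_mono)
  then have "(L2_norm \<mu> ((P ^^ n) f))\<^sup>2 = sq_norm ((R ^^ m) g) / Z"
    unfolding Pn using L2_norm_lift[OF good[of m]] by simp
  also have "\<dots> \<le> rate_const * (hi - lo)\<^sup>2 * real m powr (- (\<alpha> - DIM('a) / 2)) / Z"
    using Z_pos by (intro divide_right_mono R_decay[OF g m(2)]) auto
  finally show ?thesis by (simp add: osc m(1))
qed

end

section \<open>Bayesian linear regression\<close>

lemma det_scaleR: "det (c *\<^sub>R A) = c ^ CARD('n) * det (A :: real^'n^'n)"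
proof -
  have "c *\<^sub>R A = (\<chi> i. c *s (A $ i))" by (simp add: vec_eq_iff)
  then show ?thesis using det_rows_mul[of "\<lambda>_. c" "\<lambda>i. A $ i"] by simp
qed

lemma matrix_mul_scaleR_left: "(c *\<^sub>R A) ** B = c *\<^sub>R (A ** (B :: real^'n^'m))"
  by (simp add: matrix_matrix_mult_def vec_eq_iff sum_distrib_left mult.assoc)

lemma matrix_mul_scaleR_right: "A ** (c *\<^sub>R B) = c *\<^sub>R (A ** (B :: real^'n^'m))"
  by (simp add: matrix_matrix_mult_def vec_eq_iff sum_distrib_left mult.left_commute)

lemma matrix_inv_eqI:
  fixes A :: "real^'n^'n"
  assumes "A ** B = mat 1"
  shows "matrix_inv A = B"
proof -
  have BA: "B ** A = mat 1" using assms matrix_left_right_inverse by blast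
  have "A ** matrix_inv A = mat 1 \<and> matrix_inv A ** A = mat 1"
    unfolding matrix_inv_def by (rule someI_ex) (use assms BA in blast)
  then have inv: "matrix_inv A ** A = mat 1" by blast
  have "matrix_inv A = matrix_inv A ** (A ** B)" by (simp only: assms matrix_mul_rid)
  also have "\<dots> = B" by (simp only: matrix_mul_assoc inv matrix_mul_lid)
  finally show ?thesis .
qed

lemma matrix_inv_scaleR:
  fixes A :: "real^'n^'n"
  assumes "A ** B = mat 1" "c \<noteq> 0"
  shows "matrix_inv (c *\<^sub>R A) = (1 / c) *\<^sub>R B"
  using assms by (intro matrix_inv_eqI) (simp add: matrix_mul_scaleR_left matrix_mul_scaleR_right)

lemma nn_integral_standard_mvn:
  "(\<integral>\<^sup>+z. ennreal (mvn_density 0 (mat 1) (z :: real^'d)) \<partial>lborel) = 1"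
proof -
  have inv: "matrix_inv (mat 1 :: real^'d^'d) = mat 1" by (rule matrix_inv_eqI) simp
  have card: "card (Basis :: (real^'d) set) = CARD('d)" by simp
  have "mvn_density 0 (mat 1) z = (\<Prod>b\<in>Basis. std_normal_density (z \<bullet> b))" for z :: "real^'d"
  proof -
    have "(\<Prod>b\<in>Basis. std_normal_density (z \<bullet> b))
      = (\<Prod>b\<in>(Basis :: (real^'d) set). 1 / sqrt (2 * pi)) * (\<Prod>b\<in>Basis. exp (- (z \<bullet> b)\<^sup>2 / 2))"
      by (simp only: std_normal_density_def prod.distrib)
    also have "(\<Prod>b\<in>Basis. exp (- (z \<bullet> b)\<^sup>2 / 2)) = exp (\<Sum>b\<in>Basis. - (z \<bullet> b)\<^sup>2 / 2)"
      by (rule exp_sum[symmetric]) simp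
    also have "(\<Sum>b\<in>Basis. - (z \<bullet> b)\<^sup>2 / 2) = - (z \<bullet> z) / 2"
      unfolding euclidean_inner[of z z] by (simp add: power2_eq_square sum_negf sum_divide_distrib)
    also have "(\<Prod>b\<in>(Basis :: (real^'d) set). 1 / sqrt (2 * pi)) = 1 / sqrt ((2 * pi) ^ CARD('d))"
      by (simp only: prod_constant card real_sqrt_power power_one_over)
    finally show ?thesis by (simp add: mvn_density_def inv)
  qed
  then have "(\<integral>\<^sup>+z. ennreal (mvn_density 0 (mat 1) (z :: real^'d)) \<partial>lborel)
    = (\<integral>\<^sup>+z. (\<Prod>b\<in>Basis. ennreal (std_normal_density (z \<bullet> b))) \<partial>(lborel :: (real^'d) measure))"
    by (simp add: prod_ennreal)
  also have "\<dots> = (\<Prod>b\<in>(Basis :: (real^'d) set). (\<integral>\<^sup>+x. ennreal (std_normal_density x) \<partial>lborel))"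
    by (rule nn_integral_lborel_prod) auto
  also have "(\<integral>\<^sup>+x. ennreal (std_normal_density x) \<partial>lborel) = 1"
    using prob_space.emeasure_space_1[OF prob_space_normal_density[of 1 0]] by (simp add: emeasure_density)
  finally show ?thesis by simp
qed

lemma standard_mvn_density: "mvn_density 0 (mat 1) (z :: real^'d) = exp (- (norm z)\<^sup>2 / 2) / sqrt ((2 * pi) ^ CARD('d))"
proof -
  have inv: "matrix_inv (mat 1 :: real^'d^'d) = mat 1" by (rule matrix_inv_eqI) simp
  show ?thesis by (simp add: mvn_density_def inv power2_norm_eq_inner)
qed

section \<open>The posterior of the linear model\<close>

locale regression =
  fixes X :: "real^'p^'n" and Y :: "real^'n" and a b :: real
  assumes rank: "rank X = CARD('p)" and a: "a > 1" and b: "b > 0"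
begin

text \<open>The rate of the Gamma conditional of the precision. Up to an additive constant,
  \<open>t * E \<beta>\<close> is also the negative logarithm of the conditional density of \<beta>
  for \<open>t > 0\<close>.\<close>

definition E :: "real^'p \<Rightarrow> real" where "E \<beta> = b + ((Y - X *v \<beta>) \<bullet> (Y - X *v \<beta>)) / 2"

abbreviation G :: "real^'p^'p" where "G \<equiv> transpose X ** X"

lemma X_inj: "inj ((*v) X)"
  using rank by (simp add: full_rank_injective)

lemma inner_transpose: "v \<bullet> (transpose X *v y) = (X *v v) \<bullet> y"
  by (simp add: transpose_matrix_vector inner_commute[of v] dot_lmul_matrix) (simp add: inner_commute)

lemma inner_G: "v \<bullet> (G *v w) = (X *v v) \<bullet> (X *v w)"
  by (simp only: matrix_vector_mul_assoc[symmetric] inner_transpose)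

lemma G_invertible: "matrix_inv G ** G = mat 1" "G ** matrix_inv G = mat 1" "det G \<noteq> 0"
proof -
  have "\<forall>v. G *v v = 0 \<longrightarrow> v = 0"
  proof (intro allI impI)
    fix v assume "G *v v = 0"
    then have "(X *v v) \<bullet> (X *v v) = 0" using inner_G[of v v] by simp
    then have "X *v v = X *v 0" by simp
    then show "v = 0" using X_inj by (meson injD)
  qed
  then obtain B where B: "B ** G = mat 1" using matrix_left_invertible_ker by blast
  then have B': "G ** B = mat 1" using matrix_left_right_inverse by blast
  then have "matrix_inv G = B" by (rule matrix_inv_eqI)
  then show "matrix_inv G ** G = mat 1" "G ** matrix_inv G = mat 1" using B B' by auto
  have "det G * det B = 1" using B' by (metis det_I det_mul)
  then show "det G \<noteq> 0" by auto
qed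

text \<open>Completing the square: by the normal equations the residual at the least-squares point
  is orthogonal to the range of \<open>X\<close>.\<close>

lemma E_ols: "E \<beta> = E (ols X Y) + ((\<beta> - ols X Y) \<bullet> (G *v (\<beta> - ols X Y))) / 2"
proof -
  let ?u = "ols X Y" and ?w = "\<beta> - ols X Y"
  have "G *v ?u = transpose X *v Y"
  proof -
    have "G *v ?u = (G ** matrix_inv G) *v (transpose X *v Y)"
      unfolding ols_def by (rule matrix_vector_mul_assoc)
    then show ?thesis by (simp only: G_invertible(2) matrix_vector_mul_lid)
  qed
  moreover have "(X *v ?w) \<bullet> (Y - X *v ?u) = ?w \<bullet> (transpose X *v Y) - ?w \<bullet> (G *v ?u)"
    by (simp only: inner_diff_right inner_transpose inner_G)
  ultimately have normal: "(X *v ?w) \<bullet> (Y - X *v ?u) = 0" by simp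
  have "Y - X *v \<beta> = (Y - X *v ?u) - X *v ?w" by (simp add: matrix_vector_mult_diff_distrib)
  moreover have "(z - v) \<bullet> (z - v) = z \<bullet> z + v \<bullet> v" if "v \<bullet> z = 0" for v z :: "real^'n"
    using that by (simp add: inner_diff_left inner_diff_right inner_commute)
  ultimately have "(Y - X *v \<beta>) \<bullet> (Y - X *v \<beta>) = (Y - X *v ?u) \<bullet> (Y - X *v ?u) + (X *v ?w) \<bullet> (X *v ?w)"
    using normal by (simp only:)
  then show ?thesis by (simp add: E_def inner_G)
qed

text \<open>Full column rank makes \<open>norm (X *v \<beta>)\<close> comparable to
  \<open>norm \<beta>\<close> from both sides; the shift by \<open>Y\<close> is absorbed using
  \<open>b > 0\<close>.\<close>

lemma E_bounds:
  obtains e1 e2 where "e1 > 0" "\<And>\<beta>. e1 * (1 + (norm \<beta>)\<^sup>2) \<le> E \<beta>" "\<And>\<beta>. E \<beta> \<le> e2 * (1 + (norm \<beta>)\<^sup>2)"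
proof -
  obtain m where m: "m > 0" "\<And>v. m * norm v \<le> norm (X *v v)"
    using linear_inj_bounded_below_pos[OF _ X_inj] by auto
  obtain c where c: "c > 0" "\<And>v. norm (X *v v) \<le> norm v * c"
    using bounded_linear.pos_bounded[OF matrix_vector_mul_bounded_linear[of X]] by auto
  define y where "y = (norm Y)\<^sup>2"
  have y: "y \<ge> 0" by (simp add: y_def)
  have sq: "(norm (v + w))\<^sup>2 \<le> 2 * (norm v)\<^sup>2 + 2 * (norm w)\<^sup>2" for v w :: "real^'n"
  proof -
    have "(norm (v + w))\<^sup>2 \<le> (norm v + norm w)\<^sup>2" by (intro power_mono norm_triangle_ineq) auto
    then show ?thesis using zero_le_power2[of "norm v - norm w"] by (simp add: power2_eq_square algebra_simps)
  qed
  have E: "E \<beta> = b + (norm (Y - X *v \<beta>))\<^sup>2 / 2" for \<beta> by (simp add: E_def power2_norm_eq_inner)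
  have upper: "E \<beta> \<le> (b + y + c\<^sup>2) * (1 + (norm \<beta>)\<^sup>2)" for \<beta>
  proof -
    have "(norm (Y - X *v \<beta>))\<^sup>2 \<le> 2 * y + 2 * (norm (X *v \<beta>))\<^sup>2" using sq[of Y "- (X *v \<beta>)"] by (simp add: y_def)
    moreover have "(norm (X *v \<beta>))\<^sup>2 \<le> (norm \<beta> * c)\<^sup>2" by (intro power_mono c) auto
    ultimately have "E \<beta> \<le> b + y + c\<^sup>2 * (norm \<beta>)\<^sup>2" unfolding E by (simp add: power_mult_distrib mult.commute)
    moreover have "0 \<le> c\<^sup>2 + (b + y) * (norm \<beta>)\<^sup>2" using b y by simp
    ultimately show ?thesis by (simp add: algebra_simps)
  qed
  \<comment> \<open>A fraction small enough that the error \<open>l * y\<close> caused by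
    \<open>Y\<close> uses at most half of \<open>b\<close>; the \<open>+ 1\<close> guards against
    \<open>Y = 0\<close>.\<close>
  define l where "l = min (1/2) (b / (2 * (y + 1)))"
  have l: "0 < l" "l \<le> 1/2" "l * y \<le> b / 2"
  proof -
    show "0 < l" using b y by (auto simp: l_def)
    show "l \<le> 1/2" unfolding l_def by (rule min.cobounded1)
    have "l * y \<le> b / (2 * (y + 1)) * y" using y by (intro mult_right_mono) (auto simp: l_def)
    also have "\<dots> \<le> b / 2" using b y by (simp add: field_simps)
    finally show "l * y \<le> b / 2" .
  qed
  have lower: "min (b / 2) (l * m\<^sup>2 / 2) * (1 + (norm \<beta>)\<^sup>2) \<le> E \<beta>" for \<beta>
  proof -
    let ?D = "(norm (Y - X *v \<beta>))\<^sup>2"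
    have "(m * norm \<beta>)\<^sup>2 \<le> (norm (X *v \<beta>))\<^sup>2" using m by (intro power_mono m) auto
    also have "\<dots> \<le> 2 * y + 2 * ?D" using sq[of Y "X *v \<beta> - Y"] by (simp add: y_def norm_minus_commute)
    finally have "l * (m\<^sup>2 * (norm \<beta>)\<^sup>2) \<le> l * (2 * y + 2 * ?D)"
      using l by (intro mult_left_mono) (auto simp: power_mult_distrib)
    moreover have "l * ?D \<le> 1/2 * ?D" using l by (intro mult_right_mono) auto
    ultimately have "b / 2 + l * m\<^sup>2 / 2 * (norm \<beta>)\<^sup>2 \<le> E \<beta>"
      unfolding E using l(3) by (simp add: algebra_simps)
    moreover have "min (b / 2) (l * m\<^sup>2 / 2) * (norm \<beta>)\<^sup>2 \<le> l * m\<^sup>2 / 2 * (norm \<beta>)\<^sup>2"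
      by (intro mult_right_mono) auto
    ultimately show ?thesis by (simp add: distrib_left)
  qed
  show ?thesis using that[of "min (b / 2) (l * m\<^sup>2 / 2)" "b + y + c\<^sup>2"] lower upper b l m by auto
qed

text \<open>The normalizing constants cancel. At \<open>t = 0\<close> the covariance is the zero
  matrix, its determinant vanishes, and division by zero makes both densities and their ratio
  0.\<close>

lemma beta_conditional_ratio:
  "min 1 (beta_conditional_density X Y t \<beta>' / beta_conditional_density X Y t \<beta>)
    = (if t = 0 then 0 else min 1 (exp (t * (E \<beta> - E \<beta>'))))"
proof (cases "t = 0")
  case True
  have "det (0 :: real^'p^'p) = 0" using det_scaleR[of 0 "mat 1 :: real^'p^'p"] by simp
  then show ?thesis using True by (simp add: beta_conditional_density_def mvn_density_def)
next
  case False
  let ?u = "ols X Y" and ?S = "(1 / t) *\<^sub>R matrix_inv G"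
  have inv: "matrix_inv ?S = t *\<^sub>R G"
    using matrix_inv_scaleR[OF G_invertible(1), of "1 / t"] False by simp
  have "det (matrix_inv G) * det G = 1" by (metis G_invertible(1) det_I det_mul)
  then have "det ?S \<noteq> 0" using False by (auto simp: det_scaleR)
  \<comment> \<open>This covers negative \<open>t\<close> too, where the determinant may be
    negative: the real square root is odd, hence still nonzero.\<close>
  then have nz: "sqrt ((2 * pi) ^ CARD('p) * det ?S) \<noteq> 0" by simp
  have q: "((v - ?u) \<bullet> (matrix_inv ?S *v (v - ?u))) = 2 * t * (E v - E ?u)" for v
    unfolding inv E_ols[of v] by (simp add: scaleR_matrix_vector_assoc[symmetric])
  have "beta_conditional_density X Y t \<beta>' / beta_conditional_density X Y t \<beta>
    = exp (- (2 * t * (E \<beta>' - E ?u)) / 2) / exp (- (2 * t * (E \<beta> - E ?u)) / 2)"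
    unfolding beta_conditional_density_def mvn_density_def q using nz by simp
  also have "\<dots> = exp (t * (E \<beta> - E \<beta>'))"
  proof -
    have "- (2 * t * (B - U)) / 2 - - (2 * t * (A - U)) / 2 = t * (A - B)" for A B U :: real
      by (simp add: field_simps)
    then show ?thesis unfolding exp_diff[symmetric] by (simp only:)
  qed
  finally show ?thesis using False by simp
qed

text \<open>The likelihood contributes \<open>t\<close> to the power of half the sample size and
  completes \<open>b\<close> to \<open>E \<beta>\<close> in the exponent. The prefactor is constant
  in \<open>t\<close> and \<beta>, so it cancels in the posterior.\<close>

lemma joint_density_eq:
  assumes \<alpha>: "\<alpha> = a + real CARD('n) / 2"
  shows "joint_density X Y a b (t, \<beta>)
    = (b powr a / Gamma a / sqrt ((2 * pi) ^ CARD('n)) * Gamma \<alpha>) * (E \<beta> powr (- \<alpha>) * gamma_density \<alpha> (E \<beta>) t)"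
proof (cases "t > 0")
  case True
  have inv: "matrix_inv ((1 / t) *\<^sub>R (mat 1 :: real^'n^'n)) = t *\<^sub>R mat 1"
    using matrix_inv_scaleR[of "mat 1 :: real^'n^'n" "mat 1" "1 / t"] True by simp
  let ?d = "(Y - X *v \<beta>) \<bullet> (Y - X *v \<beta>)"
  have E0: "E \<beta> > 0" using b by (simp add: E_def add_pos_nonneg)
  have G0: "Gamma \<alpha> > 0" using a by (intro Gamma_real_pos) (auto simp: \<alpha> add_pos_nonneg)
  have sq: "sqrt ((2 * pi) ^ CARD('n) * det ((1 / t) *\<^sub>R (mat 1 :: real^'n^'n))) = sqrt ((2 * pi) ^ CARD('n)) / t powr (real CARD('n) / 2)"
  proof -
    have "(1 / t powr (real CARD('n) / 2))\<^sup>2 = (1 / t) ^ CARD('n)"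
      using True by (simp add: power_one_over power2_eq_square powr_add[symmetric] powr_realpow)
    then have "sqrt ((1 / t) ^ CARD('n)) = 1 / t powr (real CARD('n) / 2)"
      by (intro real_sqrt_unique) auto
    then show ?thesis by (simp add: det_scaleR real_sqrt_mult)
  qed
  have "joint_density X Y a b (t, \<beta>) = b powr a / Gamma a * t powr (a - 1) * exp (- b * t)
      * (exp (- (t * ?d) / 2) / (sqrt ((2 * pi) ^ CARD('n)) / t powr (real CARD('n) / 2)))"
    unfolding joint_density_def likelihood_def mvn_density_def prod.case sq inv
    using True by (simp add: gamma_density_def scaleR_matrix_vector_assoc[symmetric])
  also have "\<dots> = b powr a / Gamma a / sqrt ((2 * pi) ^ CARD('n)) * (t powr (a - 1) * t powr (real CARD('n) / 2))
      * (exp (- b * t) * exp (- (t * ?d) / 2))"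
    by simp
  also have "t powr (a - 1) * t powr (real CARD('n) / 2) = t powr (\<alpha> - 1)"
    by (simp add: powr_add[symmetric] \<alpha> algebra_simps)
  also have "exp (- b * t) * exp (- (t * ?d) / 2) = exp (- E \<beta> * t)"
  proof -
    have "- b * t + - (t * d) / 2 = - (b + d / 2) * t" for d by (simp add: field_simps)
    then show ?thesis by (simp only: exp_add[symmetric] E_def)
  qed
  also have "t powr (\<alpha> - 1) = Gamma \<alpha> * (E \<beta> powr (- \<alpha>) * (E \<beta> powr \<alpha> / Gamma \<alpha> * t powr (\<alpha> - 1)))"
    using E0 G0 by (simp add: powr_minus)
  finally show ?thesis using True by (simp add: gamma_density_def)
qed (simp add: joint_density_def gamma_density_def)

end

section \<open>Transfer to the posterior\<close>

theorem proposition6p1: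
  fixes X :: "real^'p^'n" and Y :: "real^'n" and a b \<sigma>\<^sub>0 :: real
  assumes "CARD('n) > CARD('p)"
    and "rank X = CARD('p)"
    and "a > 1" and "b > 0" and "\<sigma>\<^sub>0 > 0"
  defines "M \<equiv> posterior X Y a b"
    and "u \<equiv> matrix_inv (transpose X ** X) *v (transpose X *v Y)"
  defines "a' \<equiv> a + real CARD('n) / 2 - real CARD('p) / 2"
    and "b' \<equiv> b + (Y \<bullet> Y - u \<bullet> ((transpose X ** X) *v u)) / 2"
    and "C\<^sub>2 \<equiv> 2 * max_eigenvalue (transpose X ** X) * real CARD('p) * \<sigma>\<^sub>0\<^sup>2"
  shows "\<exists>C>0. \<forall>f\<in>L2_0 M. \<forall>n::nat. (osc_norm M f)\<^sup>2 < \<infinity> \<longrightarrow> n \<ge> 2 \<longrightarrow>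
           (L2_norm M ((P2 X Y a b \<sigma>\<^sub>0 ^^ n) f))\<^sup>2
             \<le> C * (real_of_ereal (osc_norm M f))\<^sup>2 * (real n - 1) powr (- min a' (b' / C\<^sub>2))"
proof -
  interpret Reg: regression X Y a b using assms(1-4) by unfold_locales
  let ?q = "mvn_density 0 (mat 1) :: real^'p \<Rightarrow> real"
  obtain e1 e2 where e: "e1 > 0" "\<And>\<beta>. e1 * (1 + (norm \<beta>)\<^sup>2) \<le> Reg.E \<beta>" "\<And>\<beta>. Reg.E \<beta> \<le> e2 * (1 + (norm \<beta>)\<^sup>2)"
    using Reg.E_bounds by blast
  \<comment> \<open>The last argument is the value of the standard normal density on the unit
    sphere, its minimum over the unit ball.\<close>
  interpret metropolis_within_gibbs Reg.E ?q "a + real CARD('n) / 2" \<sigma>\<^sub>0 e1 e2 "exp (- 1 / 2) / sqrt ((2 * pi) ^ CARD('p))"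
  proof
    show "Reg.E \<in> borel_measurable borel"
      unfolding Reg.E_def by (intro borel_measurable_continuous_onI continuous_intros) auto
    show "?q \<in> borel_measurable borel"
      unfolding standard_mvn_density by (intro borel_measurable_continuous_onI continuous_intros) auto
    show "(\<integral>\<^sup>+z. ennreal (?q z) \<partial>lborel) = 1" by (rule nn_integral_standard_mvn)
    show "exp (- 1 / 2) / sqrt ((2 * pi) ^ CARD('p)) \<le> ?q z" if "norm z \<le> 1" for z
      unfolding standard_mvn_density using that
      by (intro divide_right_mono) (auto simp: abs_square_le_1)
    show "real DIM(real^'p) / 2 < a + real CARD('n) / 2" using assms(1,3) by simp
  qed (use e assms(5) in \<open>auto simp: standard_mvn_density\<close>)
  have M: "M = \<mu>"
  proof -
    define c where "c = b powr a / Gamma a / sqrt ((2 * pi) ^ CARD('n)) * Gamma (a + real CARD('n) / 2)"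
    have c: "c > 0"
      unfolding c_def using assms(3,4) \<alpha>_pos Gamma_real_pos[of a] Gamma_real_pos[of "a + real CARD('n) / 2"] by simp
    have j: "joint_density X Y a b = (\<lambda>p. c * (W (snd p) * gamma_density (a + real CARD('n) / 2) (Reg.E (snd p)) (fst p)))"
      using Reg.joint_density_eq[OF refl] by (auto simp: W_def fun_eq_iff c_def)
    have "(LINT z|lborel. joint_density X Y a b z) = c * Z"
      unfolding j by (subst Bochner_Integration.integral_mult_right_zero) (simp only: integral_W_gamma)
    then show ?thesis
      unfolding M_def posterior_def \<mu>_def using c
      by (intro arg_cong[where f="density lborel"] ext) (simp add: j dens_def case_prod_unfold)
  qed
  have Pc: "precision_conditional X Y a b \<beta> = gamma_measure (a + real CARD('n) / 2) (Reg.E \<beta>)" for \<beta>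
    by (simp add: precision_conditional_def Reg.E_def)
  have "H2 X Y \<sigma>\<^sub>0 = H"
    by (simp add: H2_def H_def K_def rwm_def Let_def Q_def mvn_measure_def fun_eq_iff Reg.beta_conditional_ratio acc_def)
  then have P2: "P2 X Y a b \<sigma>\<^sub>0 = P"
    by (simp add: P2_def G1_def P_def fun_eq_iff Pc)
  show ?thesis
  proof (intro exI conjI ballI allI impI)
    show "rate_const / Z > 0" using rate_const_pos Z_pos by simp
    fix f n
    assume f: "f \<in> L2_0 M" "(osc_norm M f)\<^sup>2 < \<infinity>" and n: "(n::nat) \<ge> 2"
    have "(L2_norm M ((P2 X Y a b \<sigma>\<^sub>0 ^^ n) f))\<^sup>2
      \<le> rate_const / Z * (real_of_ereal (osc_norm M f))\<^sup>2 * (real n - 1) powr (- a')"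
      using P_decay[OF f[unfolded M] n] by (simp add: M P2 a'_def)
    \<comment> \<open>The base \<open>real n - 1\<close> is at least 1, so a larger exponent only
      weakens the bound.\<close>
    also have "\<dots> \<le> rate_const / Z * (real_of_ereal (osc_norm M f))\<^sup>2 * (real n - 1) powr (- min a' (b' / C\<^sub>2))"
      using n rate_const_pos Z_pos by (intro mult_left_mono powr_mono) auto
    finally show "(L2_norm M ((P2 X Y a b \<sigma>\<^sub>0 ^^ n) f))\<^sup>2 \<le> \<dots>" .
  qed
qed

end
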